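(* Let $a>0$, $\omega\in\mathbb{R}$, let $\kappa$ be either $\sin$ or $\cos$, and fix an integer $\ell\ge 1$. For $f\in C^0([-a,a])$, $m\ge 1$ and $y\in[-a,a]$ set $$\mathcal{I}^\omega(f,y)=\int_{-a}^a\kappa(\omega(y-x))f(x)\,dx,\qquad \mathcal{I}^\omega_{m,\ell}(f,y)=\int_{-a}^a\kappa(\omega(y-x))\,\bar B_{m,\ell}(f,x)\,dx,$$ $$\mathcal{R}^\omega_{m,\ell}(f,y)=\mathcal{I}^\omega(f,y)-\mathcal{I}^\omega_{m,\ell}(f,y),$$ where $\bar B_{m,\ell}(f)$ is the generalized Bernstein polynomial of $f$ of degree $m$ and parameter $\ell$ on $[-a,a]$. Then: (i) (Stability) There is a constant $\mathcal{C}>0$, not depending on $m$ and $f$, such that for every $f\in C^0([-a,a])$ $$\sup_{m\ge 1}\|\mathcal{I}^\omega_{m,\ell}(f)\|\le \mathcal{C}\,\|f\|.$$ (ii) (Error estimate) For every integer $r$ with $0<r\le 2\ell$ there is a constant $\mathcal{C}>0$, not depending on $m$ and $f$, such that for every $f\in W_r$ and every $m\ge 1$ $$\|\mathcal{R}^\omega_{m,\ell}(f)\|\le \mathcal{C}\,\frac{a^{r+1}\,\|f\|_{W_r}}{(\sqrt{m})^{r}}.$$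
   Context: $C^0([-a,a])$ is the space of continuous functions on $[-a,a]$ with norm $\|f\|=\max_{x\in[-a,a]}|f(x)|$; the norms of $\mathcal{I}^\omega_{m,\ell}(f)$ and $\mathcal{R}^\omega_{m,\ell}(f)$ are the uniform norms over $y\in[-a,a]$. Bernstein operator on $[-a,a]$: for $m\ge1$, $\bar B_m(f,x)=\sum_{k=0}^m f(t_k)\,\bar p_{m,k}(x)$, where $t_k=-a+k\frac{2a}{m}$ and $\bar p_{m,k}(x)=\binom{m}{k}\left(\frac{a+x}{2a}\right)^k\left(\frac{a-x}{2a}\right)^{m-k}$. Generalized Bernstein polynomial ($\ell$-th iterated Boolean sum): $\bar B_{m,\ell}(f)=f-(\mathrm{Id}-\bar B_m)^{\ell}f$, where the power denotes $\ell$-fold composition of the operator $\mathrm{Id}-\bar B_m$ on $C^0([-a,a])$; in particular $\bar B_{m,1}=\bar B_m$. Equivalently, $\bar B_{m,\ell}(f,x)=\sum_{j=0}^m f(t_j)\sum_{i=0}^m \bar p_{m,i}(x)\,c^{(m,\ell)}_{i,j}$, where $c^{(m,\ell)}_{i,j}$ ($0\le i,j\le m$) are the entries of $C_{m,\ell}=\mathbf{I}+(\mathbf{I}-\mathbf{A})+\dots+(\mathbf{I}-\mathbf{A})^{\ell-1}$, with $\mathbf{I}$ the identity matrix of order $m+1$ and $\mathbf{A}_{i,j}=\bar p_{m,j}(t_i)$. Consequently $\mathcal{I}^\omega_{m,\ell}(f,y)=\sum_{j=0}^m f(t_j)\sum_{i=0}^m c^{(m,\ell)}_{i,j}\int_{-a}^a\kappa(\omega(y-x))\bar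 p_{m,i}(x)\,dx$. Sobolev-type space: for an integer $r\ge1$, with $\phi(x)=\sqrt{a^2-x^2}$, $W_r$ is the set of $f\in C^0([-a,a])$ such that $f^{(r-1)}$ is locally absolutely continuous (i.e. absolutely continuous on every closed subinterval of $(-a,a)$) and $\|f^{(r)}\phi^r\|<\infty$ (essential supremum over $(-a,a)$, since $f^{(r)}$ exists almost everywhere), with norm $\|f\|_{W_r}=\|f\|+\|f^{(r)}\phi^r\|$. Constants $\mathcal{C}$ may depend on quantities other than those stated (such as $a,\omega,\ell,r$). *)

theory Defs
  imports "HOL-Analysis.Analysis" "HOL-Probability.Essential_Supremum"
begin

text \<open>
  Elements of \<open>C\<^sup>0([-a,a])\<close> are represented by functions \<open>f :: real \<Rightarrow> real\<close> with
  \<open>continuous_on {-a..a} f\<close>; values outside \<open>[-a,a]\<close> never matter below.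
\<close>

text \<open>For functions continuous on \<open>[-a,a]\<close> the supremum is finite and is attained.\<close>

definition unif_norm :: "real \<Rightarrow> (real \<Rightarrow> real) \<Rightarrow> real" where
  "unif_norm a f = (SUP x\<in>{-a..a}. \<bar>f x\<bar>)"

definition bern_node :: "real \<Rightarrow> nat \<Rightarrow> nat \<Rightarrow> real" where
  "bern_node a m k = - a + real k * (2 * a / real m)"

definition bern_basis :: "real \<Rightarrow> nat \<Rightarrow> nat \<Rightarrow> real \<Rightarrow> real" where
  "bern_basis a m k x =
     real (m choose k) * ((a + x) / (2 * a)) ^ k * ((a - x) / (2 * a)) ^ (m - k)"

definition bern_op :: "real \<Rightarrow> nat \<Rightarrow> (real \<Rightarrow> real) \<Rightarrow> real \<Rightarrow> real" where
  "bern_op a m f x = (\<Sum>k=0..m. f (bern_node a m k) * bern_basis a m k x)"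

text \<open>\<open>f - (Id - B\<^sub>m)\<^sup>l f\<close>, where the power is the \<open>l\<close>-fold composition of operators.\<close>

definition gen_bern_op :: "real \<Rightarrow> nat \<Rightarrow> nat \<Rightarrow> (real \<Rightarrow> real) \<Rightarrow> real \<Rightarrow> real" where
  "gen_bern_op a m l f x = f x - ((\<lambda>g t. g t - bern_op a m g t) ^^ l) f x"

definition osc_int ::
    "real \<Rightarrow> real \<Rightarrow> (real \<Rightarrow> real) \<Rightarrow> (real \<Rightarrow> real) \<Rightarrow> real \<Rightarrow> real" where
  "osc_int a \<omega> \<kappa> f y = integral {-a..a} (\<lambda>x. \<kappa> (\<omega> * (y - x)) * f x)"

definition osc_quad ::
    "real \<Rightarrow> real \<Rightarrow> (real \<Rightarrow> real) \<Rightarrow> nat \<Rightarrow> nat \<Rightarrow> (real \<Rightarrow> real) \<Rightarrow> real \<Rightarrow> real" where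
  "osc_quad a \<omega> \<kappa> m l f y =
     integral {-a..a} (\<lambda>x. \<kappa> (\<omega> * (y - x)) * gen_bern_op a m l f x)"

definition osc_rem ::
    "real \<Rightarrow> real \<Rightarrow> (real \<Rightarrow> real) \<Rightarrow> nat \<Rightarrow> nat \<Rightarrow> (real \<Rightarrow> real) \<Rightarrow> real \<Rightarrow> real" where
  "osc_rem a \<omega> \<kappa> m l f y = osc_int a \<omega> \<kappa> f y - osc_quad a \<omega> \<kappa> m l f y"

text \<open>
  Absolute continuity of a function (the library constant \<^const>\<open>absolutely_continuous\<close>
  is about measures): every finite family of non-overlapping subintervals
  \<open>[s\<^sub>i, t\<^sub>i]\<close> of \<open>[c,d]\<close> of small total length has small total increment.
\<close>

definition abs_cont_on :: "real \<Rightarrow> real \<Rightarrow> (real \<Rightarrow> real) \<Rightarrow> bool" where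
  "abs_cont_on c d F \<longleftrightarrow>
     (\<forall>\<epsilon>>0. \<exists>\<delta>>0. \<forall>n (s :: nat \<Rightarrow> real) (t :: nat \<Rightarrow> real).
        (\<forall>i<n. c \<le> s i \<and> s i \<le> t i \<and> t i \<le> d) \<and>
        disjoint_family_on (\<lambda>i. {s i<..<t i}) {..<n} \<and>
        (\<Sum>i<n. t i - s i) < \<delta> \<longrightarrow>
        (\<Sum>i<n. \<bar>F (t i) - F (s i)\<bar>) < \<epsilon>)"

definition loc_abs_cont :: "real \<Rightarrow> (real \<Rightarrow> real) \<Rightarrow> bool" where
  "loc_abs_cont a F \<longleftrightarrow> (\<forall>c d. - a < c \<and> c \<le> d \<and> d < a \<longrightarrow> abs_cont_on c d F)"

text \<open>
  \<open>\<parallel>f\<^sup>(\<^sup>r\<^sup>) \<phi>\<^sup>r\<parallel>\<close> with \<open>\<phi>(x) = sqrt (a\<^sup>2 - x\<^sup>2)\<close>. The value of \<^const>\<open>deriv\<close> is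
  arbitrary where the derivative does not exist; if \<open>f\<^sup>(\<^sup>r\<^sup>-\<^sup>1\<^sup>)\<close> is locally absolutely
  continuous, this is a null set and does not affect the essential supremum.
\<close>

definition sobolev_seminorm :: "real \<Rightarrow> nat \<Rightarrow> (real \<Rightarrow> real) \<Rightarrow> ereal" where
  "sobolev_seminorm a r f =
     esssup (lebesgue_on {-a<..<a})
       (\<lambda>x. ereal \<bar>(deriv ^^ r) f x * sqrt (a\<^sup>2 - x\<^sup>2) ^ r\<bar>)"

text \<open>
  Used for \<open>r \<ge> 1\<close>. The second condition says that \<open>f\<^sup>(\<^sup>r\<^sup>-\<^sup>1\<^sup>)\<close> exists
  everywhere on the open interval.
\<close>

definition sobolev :: "real \<Rightarrow> nat \<Rightarrow> (real \<Rightarrow> real) set" where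
  "sobolev a r = {f.
     continuous_on {-a..a} f \<and>
     (\<forall>k<r - 1. \<forall>x\<in>{-a<..<a}. (deriv ^^ k) f field_differentiable at x) \<and>
     loc_abs_cont a ((deriv ^^ (r - 1)) f) \<and>
     sobolev_seminorm a r f < \<infinity>}"

definition sobolev_norm :: "real \<Rightarrow> nat \<Rightarrow> (real \<Rightarrow> real) \<Rightarrow> real" where
  "sobolev_norm a r f = unif_norm a f + real_of_ereal (sobolev_seminorm a r f)"

end

theory Submission
  imports Defs "HOL-Computational_Algebra.Polynomial"
begin

text \<open>
  Write \<open>L = Id - B\<^sub>m\<close>. Stability holds because \<open>B\<^sub>m\<close> is positive and fixes constants. For the error, the
  kernel is only used through \<open>\<bar>\<kappa>\<bar> \<le> 1\<close>, so it suffices to bound \<open>L\<^sup>l f(x)\<close> pointwise by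
  \<open>m\<^sup>-\<^sup>r\<^sup>/\<^sup>2\<close> times the integrable weight \<open>1 + (a - \<bar>x\<bar>)\<^sup>-\<^sup>1\<^sup>/\<^sup>2\<close>.

  Expand \<open>f\<close> by Taylor's formula of order \<open>r\<close> around a point \<open>x0\<close> within \<open>a/m\<close> of \<open>x\<close>, at distance
  \<open>d \<ge> a/m\<close> from the endpoints. The remainder at \<open>t\<close> is at most a constant times \<open>(\<bar>t - x0\<bar> / \<phi>(x0))\<^sup>r\<close>, and
  \<open>L\<^sup>l\<close> turns it into \<open>O(m\<^sup>-\<^sup>r\<^sup>/\<^sup>2)\<close> because the moments of \<open>B\<^sub>m\<close> at \<open>x0\<close> live on the scale \<open>(d/m)\<^sup>1\<^sup>/\<^sup>2\<close>. On
  polynomials in \<open>h = t - x0\<close>, measured at scale \<open>d\<close>, each factor \<open>L\<close> gains \<open>1/(m d)\<close>; this compensates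
  the growth of the derivatives \<open>f\<^sup>(\<^sup>j\<^sup>)(x0)\<close> with \<open>j > r/2\<close>, while at scale \<open>a\<close> each factor gains \<open>1/m\<close>,
  which settles the remaining ones.

  Since \<open>f\<^sup>(\<^sup>r\<^sup>-\<^sup>1\<^sup>)\<close> is only locally absolutely continuous, one also needs that such functions are
  differentiable almost everywhere and obey a mean value inequality: their variation defines a measure
  that is absolutely continuous with respect to Lebesgue measure, and the Radon-Nikodym theorem applies.
\<close>

section \<open>Absolutely continuous functions on an interval\<close>

text \<open>The hypothesis \<open>r \<le> 2 * l\<close> enters through one line of arithmetic. For
  \<open>j > r/2\<close> the \<open>j\<close>-th Taylor coefficient at distance \<open>d\<close>
  from the endpoints has order \<open>d^(r/2 - j)\<close>, and \<open>L^l\<close> sends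
  \<open>h^j\<close> to order \<open>d^j (m d)^(-l)\<close>. In the product
  \<open>m^(-l) d^(r/2 - l)\<close> the exponent of \<open>d\<close> is nonpositive, so
  \<open>d \<ge> a/m\<close> bounds it by a multiple of \<open>m^(-r/2)\<close>. Hence
  \<open>x0\<close> is kept away from the endpoints; the same distance makes the node spread
  \<open>(a d/m)^(1/2)\<close> at least \<open>a/m\<close>, so that \<open>x\<close> lies within it.
  For \<open>j < r/2\<close> the coefficients stay bounded. Scale \<open>d\<close> would only give
  \<open>m^(-j)\<close> near the endpoints, which is too weak, whereas scale \<open>a\<close> gives
  the full \<open>m^(-l)\<close>. Paying a factor \<open>d^(-1/2)\<close> for the low orders is
  affordable because only an integral over \<open>x\<close> is wanted.\<close>

lemma abs_cont_onE:
  assumes "abs_cont_on c d F" "\<epsilon> > 0"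
  obtains \<delta> where "\<delta> > 0" "\<And>n (s :: nat \<Rightarrow> real) t. (\<forall>i<n. c \<le> s i \<and> s i \<le> t i \<and> t i \<le> d) \<Longrightarrow>
      disjoint_family_on (\<lambda>i. {s i<..<t i}) {..<n} \<Longrightarrow> (\<Sum>i<n. t i - s i) < \<delta> \<Longrightarrow>
      (\<Sum>i<n. \<bar>F (t i) - F (s i)\<bar>) < \<epsilon>"
proof -
  obtain \<delta> where "\<delta> > 0" and \<delta>: "\<forall>n (s :: nat \<Rightarrow> real) t.
        (\<forall>i<n. c \<le> s i \<and> s i \<le> t i \<and> t i \<le> d) \<and>
        disjoint_family_on (\<lambda>i. {s i<..<t i}) {..<n} \<and>
        (\<Sum>i<n. t i - s i) < \<delta> \<longrightarrow> (\<Sum>i<n. \<bar>F (t i) - F (s i)\<bar>) < \<epsilon>"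
    using assms(1)[unfolded abs_cont_on_def, THEN spec, THEN mp, OF assms(2)] by (elim exE conjE)
  show ?thesis
    by (rule that[OF \<open>\<delta> > 0\<close>], rule \<delta>[THEN spec, THEN spec, THEN spec, THEN mp]) (intro conjI)
qed

text \<open>Families indexed by pairs or by the intervals of a division occur below; a bijection
  with an initial segment of the naturals carries the definition over to them.\<close>

lemma abs_cont_on_familyE:
  assumes "abs_cont_on c d F" "\<epsilon> > 0"
  obtains \<delta> where "\<delta> > 0" "\<And>(I :: 'i set) s t. finite I \<Longrightarrow> (\<forall>i\<in>I. c \<le> s i \<and> s i \<le> t i \<and> t i \<le> d) \<Longrightarrow>
    disjoint_family_on (\<lambda>i. {s i<..<t i}) I \<Longrightarrow> (\<Sum>i\<in>I. t i - s i) < \<delta> \<Longrightarrow>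
    (\<Sum>i\<in>I. \<bar>F (t i) - F (s i)\<bar>) < \<epsilon>"
proof -
  obtain \<delta> where "\<delta> > 0" and \<delta>: "\<And>n (s :: nat \<Rightarrow> real) t. (\<forall>i<n. c \<le> s i \<and> s i \<le> t i \<and> t i \<le> d) \<Longrightarrow>
      disjoint_family_on (\<lambda>i. {s i<..<t i}) {..<n} \<Longrightarrow> (\<Sum>i<n. t i - s i) < \<delta> \<Longrightarrow>
      (\<Sum>i<n. \<bar>F (t i) - F (s i)\<bar>) < \<epsilon>"
    by (rule abs_cont_onE[OF assms]) (rule that)
  show ?thesis
  proof (rule that[OF \<open>\<delta> > 0\<close>])
    fix I :: "'i set" and s t :: "'i \<Rightarrow> real"
    assume I: "finite I" and st: "\<forall>i\<in>I. c \<le> s i \<and> s i \<le> t i \<and> t i \<le> d"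
      and dis: "disjoint_family_on (\<lambda>i. {s i<..<t i}) I" and less: "(\<Sum>i\<in>I. t i - s i) < \<delta>"
    obtain h where h: "bij_betw h {..<card I} I"
      using ex_bij_betw_nat_finite[OF I] by (auto simp: atLeast0LessThan)
    then have hI: "h i \<in> I" if "i < card I" for i
      using that by (auto dest: bij_betwE)
    have "(\<Sum>i<card I. \<bar>F (t (h i)) - F (s (h i))\<bar>) < \<epsilon>"
    proof (rule \<delta>)
      show "disjoint_family_on (\<lambda>i. {s (h i)<..<t (h i)}) {..<card I}"
        using dis h unfolding disjoint_family_on_def
        by (metis bij_betw_iff_bijections lessThan_iff)
      show "(\<Sum>i<card I. t (h i) - s (h i)) < \<delta>"
        using less sum.reindex_bij_betw[OF h, of "\<lambda>i. t i - s i"] by simp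
    qed (use st hI in auto)
    then show "(\<Sum>i\<in>I. \<bar>F (t i) - F (s i)\<bar>) < \<epsilon>"
      using sum.reindex_bij_betw[OF h, of "\<lambda>i. \<bar>F (t i) - F (s i)\<bar>"] by simp
  qed
qed

lemma abs_cont_on_continuous:
  assumes "abs_cont_on c d F"
  shows "continuous_on {c..d} F"
proof (clarsimp simp: continuous_on_iff dist_real_def)
  fix x \<epsilon> :: real assume x: "c \<le> x" "x \<le> d" and "0 < \<epsilon>"
  obtain \<delta> where "\<delta> > 0" and \<delta>: "\<And>(I :: unit set) s t. finite I \<Longrightarrow> (\<forall>i\<in>I. c \<le> s i \<and> s i \<le> t i \<and> t i \<le> d) \<Longrightarrow>
    disjoint_family_on (\<lambda>i. {s i<..<t i}) I \<Longrightarrow> (\<Sum>i\<in>I. t i - s i) < \<delta> \<Longrightarrow>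
    (\<Sum>i\<in>I. \<bar>F (t i) - F (s i)\<bar>) < \<epsilon>"
    by (rule abs_cont_on_familyE[OF assms \<open>0 < \<epsilon>\<close>, where 'i=unit]) (rule that)
  show "\<exists>\<delta>>0. \<forall>y\<in>{c..d}. \<bar>y - x\<bar> < \<delta> \<longrightarrow> \<bar>F y - F x\<bar> < \<epsilon>"
  proof (intro exI[of _ \<delta>] conjI ballI impI, fact)
    fix y assume y: "y \<in> {c..d}" "\<bar>y - x\<bar> < \<delta>"
    show "\<bar>F y - F x\<bar> < \<epsilon>"
      using \<delta>[of "{()}" "\<lambda>_. min x y" "\<lambda>_. max x y"] x y
      by (cases "x \<le> y") (auto simp: disjoint_family_on_def min_def max_def)
  qed
qed

text \<open>One criterion for two uses: a constant \<open>F\<close> gives Lipschitz functions, and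
  the mixed bound is what the product of \<open>F\<close> with a Lipschitz function
  satisfies.\<close>

lemma abs_cont_on_dominated:
  assumes "abs_cont_on c d F"
    and dom: "\<And>s t. c \<le> s \<Longrightarrow> s \<le> t \<Longrightarrow> t \<le> d \<Longrightarrow> \<bar>G t - G s\<bar> \<le> M * \<bar>F t - F s\<bar> + M * (t - s)"
    and M: "M > 0"
  shows "abs_cont_on c d G"
  unfolding abs_cont_on_def
proof (intro allI impI)
  fix \<epsilon> :: real assume e: "\<epsilon> > 0"
  then have "\<epsilon> / (2 * M) > 0" using M by simp
  then obtain \<delta> where "\<delta> > 0" and \<delta>: "\<And>n (s :: nat \<Rightarrow> real) t. (\<forall>i<n. c \<le> s i \<and> s i \<le> t i \<and> t i \<le> d) \<Longrightarrow>
      disjoint_family_on (\<lambda>i. {s i<..<t i}) {..<n} \<Longrightarrow> (\<Sum>i<n. t i - s i) < \<delta> \<Longrightarrow>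
      (\<Sum>i<n. \<bar>F (t i) - F (s i)\<bar>) < \<epsilon> / (2 * M)"
    by (rule abs_cont_onE[OF assms(1)]) (rule that)
  show "\<exists>\<delta>>0. \<forall>n (s :: nat \<Rightarrow> real) t. (\<forall>i<n. c \<le> s i \<and> s i \<le> t i \<and> t i \<le> d) \<and>
        disjoint_family_on (\<lambda>i. {s i<..<t i}) {..<n} \<and> (\<Sum>i<n. t i - s i) < \<delta> \<longrightarrow>
        (\<Sum>i<n. \<bar>G (t i) - G (s i)\<bar>) < \<epsilon>"
  proof (intro exI[of _ "min \<delta> (\<epsilon> / (2 * M))"] conjI allI impI)
    show "0 < min \<delta> (\<epsilon> / (2 * M))" using \<open>\<delta> > 0\<close> e M by simp
    fix n and s t :: "nat \<Rightarrow> real"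
    assume A: "(\<forall>i<n. c \<le> s i \<and> s i \<le> t i \<and> t i \<le> d) \<and>
        disjoint_family_on (\<lambda>i. {s i<..<t i}) {..<n} \<and> (\<Sum>i<n. t i - s i) < min \<delta> (\<epsilon> / (2 * M))"
    then have 1: "(\<Sum>i<n. \<bar>F (t i) - F (s i)\<bar>) < \<epsilon> / (2 * M)"
      by (intro \<delta>) auto
    have "(\<Sum>i<n. \<bar>G (t i) - G (s i)\<bar>) \<le> (\<Sum>i<n. M * \<bar>F (t i) - F (s i)\<bar> + M * (t i - s i))"
      using A by (intro sum_mono dom) auto
    also have "\<dots> = M * (\<Sum>i<n. \<bar>F (t i) - F (s i)\<bar>) + M * (\<Sum>i<n. t i - s i)"
      by (simp add: sum.distrib sum_distrib_left)
    also have "\<dots> < M * (\<epsilon> / (2 * M)) + M * (\<epsilon> / (2 * M))"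
      using 1 A M by (intro add_strict_mono mult_strict_left_mono) auto
    also have "\<dots> = \<epsilon>" using M by simp
    finally show "(\<Sum>i<n. \<bar>G (t i) - G (s i)\<bar>) < \<epsilon>" .
  qed
qed

lemma abs_cont_on_lipschitz:
  assumes "\<And>s t. c \<le> s \<Longrightarrow> s \<le> t \<Longrightarrow> t \<le> d \<Longrightarrow> \<bar>G t - G s\<bar> \<le> M * (t - s)"
  shows "abs_cont_on c d G"
proof (rule abs_cont_on_dominated[where M = "max M 1" and F = "\<lambda>_. 0"])
  show "abs_cont_on c d (\<lambda>_. 0)"
    unfolding abs_cont_on_def by (auto intro: exI[of _ 1])
  fix s t assume "c \<le> s" "s \<le> t" "t \<le> d"
  then show "\<bar>G t - G s\<bar> \<le> max M 1 * \<bar>0 - 0\<bar> + max M 1 * (t - s)"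
    using assms[of s t] mult_right_mono[of M "max M 1" "t - s"] by auto
qed auto

lemma abs_cont_on_add:
  assumes "abs_cont_on c d F" "abs_cont_on c d G"
  shows "abs_cont_on c d (\<lambda>x. F x + G x)"
  unfolding abs_cont_on_def
proof (intro allI impI)
  fix \<epsilon> :: real assume e: "\<epsilon> > 0"
  obtain \<delta> where "\<delta> > 0" and \<delta>: "\<And>n (s :: nat \<Rightarrow> real) t. (\<forall>i<n. c \<le> s i \<and> s i \<le> t i \<and> t i \<le> d) \<Longrightarrow>
      disjoint_family_on (\<lambda>i. {s i<..<t i}) {..<n} \<Longrightarrow> (\<Sum>i<n. t i - s i) < \<delta> \<Longrightarrow>
      (\<Sum>i<n. \<bar>F (t i) - F (s i)\<bar>) < \<epsilon> / 2"
    by (rule abs_cont_onE[OF assms(1) half_gt_zero[OF e]]) (rule that)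
  obtain \<delta>' where "\<delta>' > 0" and \<delta>': "\<And>n (s :: nat \<Rightarrow> real) t. (\<forall>i<n. c \<le> s i \<and> s i \<le> t i \<and> t i \<le> d) \<Longrightarrow>
      disjoint_family_on (\<lambda>i. {s i<..<t i}) {..<n} \<Longrightarrow> (\<Sum>i<n. t i - s i) < \<delta>' \<Longrightarrow>
      (\<Sum>i<n. \<bar>G (t i) - G (s i)\<bar>) < \<epsilon> / 2"
    by (rule abs_cont_onE[OF assms(2) half_gt_zero[OF e]]) (rule that)
  show "\<exists>\<delta>>0. \<forall>n (s :: nat \<Rightarrow> real) t. (\<forall>i<n. c \<le> s i \<and> s i \<le> t i \<and> t i \<le> d) \<and>
        disjoint_family_on (\<lambda>i. {s i<..<t i}) {..<n} \<and> (\<Sum>i<n. t i - s i) < \<delta> \<longrightarrow>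
        (\<Sum>i<n. \<bar>F (t i) + G (t i) - (F (s i) + G (s i))\<bar>) < \<epsilon>"
  proof (intro exI[of _ "min \<delta> \<delta>'"] conjI allI impI)
    show "0 < min \<delta> \<delta>'" using \<open>\<delta> > 0\<close> \<open>\<delta>' > 0\<close> by simp
    fix n and s t :: "nat \<Rightarrow> real"
    assume A: "(\<forall>i<n. c \<le> s i \<and> s i \<le> t i \<and> t i \<le> d) \<and>
        disjoint_family_on (\<lambda>i. {s i<..<t i}) {..<n} \<and> (\<Sum>i<n. t i - s i) < min \<delta> \<delta>'"
    have "(\<Sum>i<n. \<bar>F (t i) + G (t i) - (F (s i) + G (s i))\<bar>) \<le>
      (\<Sum>i<n. \<bar>F (t i) - F (s i)\<bar>) + (\<Sum>i<n. \<bar>G (t i) - G (s i)\<bar>)"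
      unfolding sum.distrib[symmetric] by (intro sum_mono) auto
    also have "\<dots> < \<epsilon> / 2 + \<epsilon> / 2"
      using A by (intro add_strict_mono \<delta> \<delta>') auto
    finally show "(\<Sum>i<n. \<bar>F (t i) + G (t i) - (F (s i) + G (s i))\<bar>) < \<epsilon>" by simp
  qed
qed

section \<open>Total variation of an absolutely continuous function\<close>

definition chain_sum :: "(real \<Rightarrow> real) \<Rightarrow> nat \<Rightarrow> (nat \<Rightarrow> real) \<Rightarrow> real" where
  "chain_sum F n p = (\<Sum>i<n. \<bar>F (p (Suc i)) - F (p i)\<bar>)"

text \<open>A partition is encoded as an infinite monotone sequence of which
  \<open>chain_sum\<close> reads the first \<open>n\<close> steps. Repeated points are allowed, so
  clipping with \<open>min\<close> and \<open>max\<close> yields partitions of two subintervals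
  without inserting the cut point.\<close>

definition chain_in :: "real \<Rightarrow> real \<Rightarrow> (nat \<Rightarrow> real) \<Rightarrow> bool" where
  "chain_in x y p \<longleftrightarrow> incseq p \<and> range p \<subseteq> {x..y}"

lemma chain_in_iff:
  "chain_in x y p \<longleftrightarrow> (\<forall>i. p i \<le> p (Suc i)) \<and> (\<forall>i. x \<le> p i) \<and> (\<forall>i. p i \<le> y)"
  unfolding chain_in_def incseq_Suc_iff image_subset_iff by auto

lemma chain_in_endpoints: "chain_in x y p \<Longrightarrow> x \<le> y"
  unfolding chain_in_iff by (meson order_trans)

lemma disjoint_family_chain:
  assumes "incseq p"
  shows "disjoint_family_on (\<lambda>i. {p i<..<p (Suc i)}) A"
proof -
  have "{p i<..<p (Suc i)} \<inter> {p j<..<p (Suc j)} = {}" if "i < j" for i j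
    using incseqD[OF assms, of "Suc i" j] that by auto
  then show ?thesis
    unfolding disjoint_family_on_def by (metis Int_commute linorder_neqE_nat)
qed

text \<open>A step that crosses \<open>y\<close> is cut there and costs a triangle inequality; any
  other step survives in one of the two clipped chains and collapses to a point in the
  other.\<close>

lemma chain_split:
  assumes "chain_in x z p" "x \<le> y" "y \<le> z"
  shows "chain_in x y (\<lambda>i. min (p i) y)" "chain_in y z (\<lambda>i. max (p i) y)"
    "chain_sum F n p \<le> chain_sum F n (\<lambda>i. min (p i) y) + chain_sum F n (\<lambda>i. max (p i) y)"
proof -
  have p: "p i \<le> p (Suc i)" for i using assms(1) by (auto simp: chain_in_iff)
  show "chain_in x y (\<lambda>i. min (p i) y)" "chain_in y z (\<lambda>i. max (p i) y)"
    using assms unfolding chain_in_iff by (auto simp: min_def max_def intro: order_trans)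
  have "\<bar>F (p (Suc i)) - F (p i)\<bar> \<le> \<bar>F (min (p (Suc i)) y) - F (min (p i) y)\<bar> + \<bar>F (max (p (Suc i)) y) - F (max (p i) y)\<bar>" for i
    using p[of i] by (auto simp: min_def max_def)
  then show "chain_sum F n p \<le> chain_sum F n (\<lambda>i. min (p i) y) + chain_sum F n (\<lambda>i. max (p i) y)"
    unfolding chain_sum_def sum.distrib[symmetric] by (intro sum_mono)
qed

text \<open>On an interval shorter than the \<open>\<delta>\<close> belonging to
  \<open>\<epsilon> = 1\<close> every chain sum is at most 1. Pieces of length
  \<open>\<delta> / 2\<close> are peeled off at the right end, and finitely many of them exhaust
  \<open>[c,d]\<close>.\<close>

lemma chain_sum_bounded:
  assumes F: "abs_cont_on c d F"
  shows "\<exists>M. \<forall>n p. chain_in c d p \<longrightarrow> chain_sum F n p \<le> M"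
proof -
  obtain \<delta> where "\<delta> > 0" and \<delta>: "\<And>(I :: nat set) s t. finite I \<Longrightarrow> (\<forall>i\<in>I. c \<le> s i \<and> s i \<le> t i \<and> t i \<le> d) \<Longrightarrow>
    disjoint_family_on (\<lambda>i. {s i<..<t i}) I \<Longrightarrow> (\<Sum>i\<in>I. t i - s i) < \<delta> \<Longrightarrow>
    (\<Sum>i\<in>I. \<bar>F (t i) - F (s i)\<bar>) < 1"
    by (rule abs_cont_on_familyE[OF F zero_less_one, where 'i=nat]) (rule that)
  have small: "chain_sum F n p \<le> 1" if "chain_in x y p" "c \<le> x" "y \<le> d" "y - x < \<delta>" for x y n p
  proof -
    have p: "incseq p" "\<And>i. x \<le> p i" "\<And>i. p i \<le> y"
      using that(1) by (auto simp: chain_in_iff incseq_Suc_iff)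
    have "(\<Sum>i<n. p (Suc i) - p i) = p n - p 0"
      by (rule sum_lessThan_telescope)
    also have "\<dots> < \<delta>" using p(2)[of 0] p(3)[of n] that by linarith
    finally have "(\<Sum>i<n. \<bar>F (p (Suc i)) - F (p i)\<bar>) < 1"
      using p that disjoint_family_chain[OF p(1), of "{..<n}"]
      by (intro \<delta>) (auto dest: incseq_SucD intro: order_trans)
    then show ?thesis by (simp add: chain_sum_def)
  qed
  define h where "h = \<delta> / 2"
  have h: "0 < h" "h < \<delta>" using \<open>\<delta> > 0\<close> by (auto simp: h_def)
  have step: "chain_sum F n p \<le> real k" if "chain_in c y p" "y \<le> d" "y \<le> c + real k * h" for k y n p
    using that
  proof (induction k arbitrary: y p)
    case 0
    then have "p i = c" for i unfolding chain_in_iff by (metis add_0_right antisym mult_zero_left of_nat_0 order_trans)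
    then show ?case by (simp add: chain_sum_def)
  next
    case (Suc k)
    have cy: "c \<le> y" by (rule chain_in_endpoints[OF Suc.prems(1)])
    define z where "z = max c (y - h)"
    have z: "c \<le> z" "z \<le> y" using cy h by (auto simp: z_def)
    note sp = chain_split[OF Suc.prems(1) z]
    have "chain_sum F n (\<lambda>i. min (p i) z) \<le> real k"
    proof (rule Suc.IH[OF sp(1)])
      show "z \<le> c + real k * h" using Suc.prems(3) h by (auto simp: z_def algebra_simps)
    qed (use z Suc.prems in auto)
    moreover have "chain_sum F n (\<lambda>i. max (p i) z) \<le> 1"
      using h by (intro small[OF sp(2)]) (use z Suc.prems in \<open>auto simp: z_def\<close>)
    ultimately show ?case using sp(3)[of F n] by simp
  qed
  obtain k :: nat where k: "(d - c) / h < real k" using reals_Archimedean2 by blast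
  then have "d \<le> c + real k * h" using h by (simp add: field_simps)
  then show ?thesis using step by (intro exI[of _ "real k"]) auto
qed

text \<open>The witness is the variation of \<open>F\<close> on \<open>[c,x]\<close>. Then
  \<open>V\<close> and \<open>F + V\<close> are both nondecreasing and absolutely continuous, which
  reduces the representation of \<open>F\<close> as an integral to monotone functions.\<close>

lemma abs_cont_on_Jordan:
  assumes F: "abs_cont_on c d F"
  obtains V where "abs_cont_on c d V" "\<And>x y. c \<le> x \<Longrightarrow> x \<le> y \<Longrightarrow> y \<le> d \<Longrightarrow> \<bar>F y - F x\<bar> \<le> V y - V x"
proof -
  define V where "V x = (SUP (n,p)\<in>{(n,p). chain_in c x p}. chain_sum F n p)" for x
  obtain M where M: "\<And>n p. chain_in c d p \<Longrightarrow> chain_sum F n p \<le> M"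
    using chain_sum_bounded[OF F] by blast
  have bdd: "bdd_above ((\<lambda>(n,p). chain_sum F n p) ` {(n,p). chain_in c x p})" if "x \<le> d" for x
  proof (rule bdd_aboveI2[of _ _ M], clarify)
    fix n p assume "chain_in c x p"
    then have "chain_in c d p" using that unfolding chain_in_iff by (meson order_trans)
    then show "chain_sum F n p \<le> M" by (rule M)
  qed
  have ne: "{(n::nat,p). chain_in c x p} \<noteq> {}" if "c \<le> x" for x
    using that by (auto simp: chain_in_iff intro!: exI[of _ "\<lambda>_. c"])
  have le_V: "chain_sum F n p \<le> V x" if "chain_in c x p" "x \<le> d" for n p x
    unfolding V_def using cSUP_upper[OF _ bdd[OF that(2)], of "(n,p)"] that by simp
  have V_approx: "\<exists>n p. chain_in c x p \<and> V x - \<eta> < chain_sum F n p" if "c \<le> x" "x \<le> d" "\<eta> > 0" for x \<eta>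
  proof -
    have "V x - \<eta> < (SUP (n,p)\<in>{(n,p). chain_in c x p}. chain_sum F n p)"
      using that unfolding V_def by simp
    then show ?thesis
      unfolding less_cSUP_iff[OF ne[OF that(1)] bdd[OF that(2)]] by auto
  qed
  have V_mono: "\<bar>F y - F x\<bar> \<le> V y - V x" if "c \<le> x" "x \<le> y" "y \<le> d" for x y
  proof (rule ccontr)
    assume "\<not> ?thesis"
    then have "V x - (V y - \<bar>F y - F x\<bar>) > 0" by simp
    from V_approx[OF that(1) order_trans[OF that(2,3)] this]
    obtain n p where p: "chain_in c x p" and less: "V y - \<bar>F y - F x\<bar> < chain_sum F n p"
      by auto
    \<comment> \<open>The \<open>n + 1\<close> points read from a nearly optimal chain of
      \<open>[c,x]\<close> are followed by \<open>x\<close> and \<open>y\<close>, so two further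
      steps add at least the increment of \<open>F\<close> from \<open>x\<close> to
      \<open>y\<close>.\<close>
    define q where "q i = (if i \<le> n then p i else if i = Suc n then x else y)" for i
    have p': "p i \<le> p (Suc i)" "c \<le> p i" "p i \<le> x" for i
      using p by (auto simp: chain_in_iff)
    have q: "chain_in c y q"
      unfolding chain_in_iff
    proof (intro conjI allI)
      fix i
      show "q i \<le> q (Suc i)" using p'(1,3)[of i] that by (auto simp: q_def)
      show "c \<le> q i" using p'(2)[of i] that by (auto simp: q_def)
      show "q i \<le> y" using p'(3)[of i] that by (auto simp: q_def)
    qed
    have "chain_sum F n q = chain_sum F n p"
      unfolding chain_sum_def by (intro sum.cong) (auto simp: q_def)
    then have "chain_sum F n p + \<bar>F y - F x\<bar> \<le> chain_sum F (Suc (Suc n)) q"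
      by (simp add: chain_sum_def q_def)
    with le_V[OF q, of "Suc (Suc n)"] less that show False by linarith
  qed
  \<comment> \<open>Cutting a nearly optimal chain of \<open>[c,y]\<close> at \<open>x\<close>
    leaves a nearly optimal one of \<open>[x,y]\<close>, since the left part contributes at most
    \<open>V x\<close>.\<close>
  have V_incr: "\<exists>n p. chain_in x y p \<and> V y - V x - \<eta> < chain_sum F n p" if xy: "c \<le> x" "x \<le> y" "y \<le> d" "\<eta> > 0" for x y \<eta>
  proof -
    obtain n p where p: "chain_in c y p" "V y - \<eta> < chain_sum F n p"
      using V_approx[OF order_trans[OF xy(1,2)] xy(3,4)] by auto
    note sp = chain_split[OF p(1) xy(1,2)]
    have "chain_sum F n (\<lambda>i. min (p i) x) \<le> V x" using le_V[OF sp(1)] xy by auto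
    then show ?thesis using sp(2) sp(3)[of F n] p(2)
      by (intro exI[of _ n] exI[of _ "\<lambda>i. max (p i) x"]) auto
  qed
  have "abs_cont_on c d V"
    unfolding abs_cont_on_def
  proof (intro allI impI)
    fix \<epsilon> :: real assume e: "\<epsilon> > 0"
    obtain \<delta> where "\<delta> > 0" and \<delta>: "\<And>(I :: (nat \<times> nat) set) s t. finite I \<Longrightarrow> (\<forall>i\<in>I. c \<le> s i \<and> s i \<le> t i \<and> t i \<le> d) \<Longrightarrow>
      disjoint_family_on (\<lambda>i. {s i<..<t i}) I \<Longrightarrow> (\<Sum>i\<in>I. t i - s i) < \<delta> \<Longrightarrow>
      (\<Sum>i\<in>I. \<bar>F (t i) - F (s i)\<bar>) < \<epsilon> / 2"
      by (rule abs_cont_on_familyE[OF F half_gt_zero[OF e], where 'i="nat \<times> nat"]) (rule that)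
    show "\<exists>\<delta>>0. \<forall>n (s :: nat \<Rightarrow> real) t. (\<forall>i<n. c \<le> s i \<and> s i \<le> t i \<and> t i \<le> d) \<and>
          disjoint_family_on (\<lambda>i. {s i<..<t i}) {..<n} \<and> (\<Sum>i<n. t i - s i) < \<delta> \<longrightarrow>
          (\<Sum>i<n. \<bar>V (t i) - V (s i)\<bar>) < \<epsilon>"
    proof (intro exI[of _ \<delta>] conjI allI impI, fact)
      fix n and s t :: "nat \<Rightarrow> real"
      assume "(\<forall>i<n. c \<le> s i \<and> s i \<le> t i \<and> t i \<le> d) \<and>
          disjoint_family_on (\<lambda>i. {s i<..<t i}) {..<n} \<and> (\<Sum>i<n. t i - s i) < \<delta>"
      then have st: "\<And>i. i < n \<Longrightarrow> c \<le> s i \<and> s i \<le> t i \<and> t i \<le> d"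
        and dis: "disjoint_family_on (\<lambda>i. {s i<..<t i}) {..<n}" and sm: "(\<Sum>i<n. t i - s i) < \<delta>" by auto
      \<comment> \<open>The \<open>n\<close> approximation errors add up to at most
        \<open>\<epsilon> / 2\<close>; the \<open>+ 1\<close> covers \<open>n = 0\<close>.\<close>
      define \<eta> where "\<eta> = \<epsilon> / (2 * (real n + 1))"
      have \<eta>: "\<eta> > 0" using e by (simp add: \<eta>_def)
      have "\<forall>i\<in>{..<n}. \<exists>kp. chain_in (s i) (t i) (snd kp) \<and> V (t i) - V (s i) - \<eta> < chain_sum F (fst kp) (snd kp)"
        using V_incr[OF _ _ _ \<eta>] st by (metis fst_conv snd_conv lessThan_iff)
      from bchoice[OF this] obtain kp where
        "\<forall>i\<in>{..<n}. chain_in (s i) (t i) (snd (kp i)) \<and> V (t i) - V (s i) - \<eta> < chain_sum F (fst (kp i)) (snd (kp i))"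
        by blast
      then have kp: "chain_in (s i) (t i) (snd (kp i))"
          "V (t i) - V (s i) - \<eta> < chain_sum F (fst (kp i)) (snd (kp i))" if "i < n" for i
        using that by auto
      define k where "k i = fst (kp i)" for i
      define p where "p i = snd (kp i)" for i
      have p: "chain_in (s i) (t i) (p i)" and Vp: "V (t i) - V (s i) - \<eta> < chain_sum F (k i) (p i)"
        if "i < n" for i
        using kp[OF that] by (auto simp: k_def p_def)
      have pin: "s i \<le> p i j" "p i j \<le> t i" "p i j \<le> p i (Suc j)" if "i < n" for i j
        using p[OF that] by (auto simp: chain_in_iff)
      \<comment> \<open>All steps of all chains form one disjoint family of intervals. Its total
        length does not exceed that of the given one, so the \<open>\<delta>\<close> found for
        \<open>F\<close> serves for \<open>V\<close>.\<close>
      define I where "I = Sigma {..<n} (\<lambda>i. {..<k i})"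
      have sumI: "(\<Sum>x\<in>I. f (fst x) (snd x)) = (\<Sum>i<n. \<Sum>j<k i. f i j)" for f :: "nat \<Rightarrow> nat \<Rightarrow> real"
        unfolding I_def by (subst sum.Sigma) (auto simp: case_prod_unfold)
      have "(\<Sum>x\<in>I. \<bar>F (p (fst x) (Suc (snd x))) - F (p (fst x) (snd x))\<bar>) < \<epsilon> / 2"
      proof (rule \<delta>)
        show "finite I" by (simp add: I_def)
        show "\<forall>x\<in>I. c \<le> p (fst x) (snd x) \<and> p (fst x) (snd x) \<le> p (fst x) (Suc (snd x)) \<and> p (fst x) (Suc (snd x)) \<le> d"
        proof
          fix x assume "x \<in> I"
          then have "fst x < n" by (auto simp: I_def)
          with st[OF this] pin[OF this, of "snd x"] pin[OF this, of "Suc (snd x)"]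
          show "c \<le> p (fst x) (snd x) \<and> p (fst x) (snd x) \<le> p (fst x) (Suc (snd x)) \<and> p (fst x) (Suc (snd x)) \<le> d"
            by linarith
        qed
        show "disjoint_family_on (\<lambda>x. {p (fst x) (snd x)<..<p (fst x) (Suc (snd x))}) I"
          unfolding disjoint_family_on_def
        proof (intro ballI impI)
          fix x y assume xy: "x \<in> I" "y \<in> I" "x \<noteq> y"
          then have n: "fst x < n" "fst y < n" by (auto simp: I_def)
          show "{p (fst x) (snd x)<..<p (fst x) (Suc (snd x))} \<inter> {p (fst y) (snd y)<..<p (fst y) (Suc (snd y))} = {}"
          proof (cases "fst x = fst y")
            case True
            with xy have "snd x \<noteq> snd y" by (auto simp: prod_eq_iff)
            then show ?thesis
              using disjoint_family_chain[of "p (fst x)" UNIV] p[OF n(1)] True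
              by (auto simp: chain_in_def disjoint_family_on_def)
          next
            case False
            then have "{s (fst x)<..<t (fst x)} \<inter> {s (fst y)<..<t (fst y)} = {}"
              using dis n by (auto simp: disjoint_family_on_def)
            moreover have "{p (fst x) (snd x)<..<p (fst x) (Suc (snd x))} \<subseteq> {s (fst x)<..<t (fst x)}"
              "{p (fst y) (snd y)<..<p (fst y) (Suc (snd y))} \<subseteq> {s (fst y)<..<t (fst y)}"
              using pin(1)[OF n(1), of "snd x"] pin(2)[OF n(1), of "Suc (snd x)"]
                pin(1)[OF n(2), of "snd y"] pin(2)[OF n(2), of "Suc (snd y)"] by auto
            ultimately show ?thesis by blast
          qed
        qed
        have "(\<Sum>x\<in>I. p (fst x) (Suc (snd x)) - p (fst x) (snd x)) = (\<Sum>i<n. p i (k i) - p i 0)"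
          using sumI[of "\<lambda>i j. p i (Suc j) - p i j"] by (simp add: sum_lessThan_telescope)
        also have "\<dots> \<le> (\<Sum>i<n. t i - s i)"
          by (intro sum_mono diff_mono) (auto simp: pin)
        finally show "(\<Sum>x\<in>I. p (fst x) (Suc (snd x)) - p (fst x) (snd x)) < \<delta>" using sm by linarith
      qed
      then have small: "(\<Sum>i<n. chain_sum F (k i) (p i)) < \<epsilon> / 2"
        using sumI[of "\<lambda>i j. \<bar>F (p i (Suc j)) - F (p i j)\<bar>"] by (simp add: chain_sum_def)
      have "(\<Sum>i<n. \<bar>V (t i) - V (s i)\<bar>) \<le> (\<Sum>i<n. chain_sum F (k i) (p i) + \<eta>)"
      proof (rule sum_mono)
        fix i assume "i \<in> {..<n}"
        then show "\<bar>V (t i) - V (s i)\<bar> \<le> chain_sum F (k i) (p i) + \<eta>"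
          using Vp[of i] V_mono[of "s i" "t i"] st[of i] by auto
      qed
      also have "\<dots> = (\<Sum>i<n. chain_sum F (k i) (p i)) + real n * \<eta>"
        by (simp add: sum.distrib)
      also have "real n * \<eta> \<le> \<epsilon> / 2" using e by (simp add: \<eta>_def field_simps)
      finally show "(\<Sum>i<n. \<bar>V (t i) - V (s i)\<bar>) < \<epsilon>" using small by linarith
    qed
  qed
  then show ?thesis using V_mono that by blast
qed

text \<open>A null compact set is covered by finitely many intervals of small total length, which
  \<open>G\<close> maps to a set of small total length.\<close>

lemma abs_cont_on_compact_null:
  fixes c d :: real
  assumes G: "abs_cont_on c d G" and cd: "c \<le> d"
    and mono: "\<And>x y. c \<le> x \<Longrightarrow> x \<le> y \<Longrightarrow> y \<le> d \<Longrightarrow> G x \<le> G y"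
    and H: "H = (\<lambda>x. G (max c (min d x)))"
    and K: "compact K" "emeasure lborel K = 0"
  shows "emeasure (interval_measure H) K = 0"
proof -
  let ?\<nu> = "interval_measure H" and ?cl = "\<lambda>x. max c (min d x)"
  have H_mono: "H x \<le> H y" if "x \<le> y" for x y
    using that cd unfolding H by (intro mono) auto
  have H_cont: "continuous_on UNIV H"
    unfolding H using cd
    by (intro continuous_on_compose2[OF abs_cont_on_continuous[OF G]] continuous_intros) auto
  have Icc: "emeasure ?\<nu> {s..t} = ennreal (H t - H s)" if "s \<le> t" for s t
    using emeasure_interval_measure_Icc[OF that H_mono H_cont] by simp
  have Kb: "K \<in> sets borel" using K(1) by (simp add: borel_compact)
  have "emeasure ?\<nu> K \<le> ennreal \<epsilon>" if e: "0 < \<epsilon>" for \<epsilon>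
  proof -
    obtain \<delta> where "\<delta> > 0" and \<delta>: "\<And>(I :: real set set) s t. finite I \<Longrightarrow> (\<forall>i\<in>I. c \<le> s i \<and> s i \<le> t i \<and> t i \<le> d) \<Longrightarrow>
      disjoint_family_on (\<lambda>i. {s i<..<t i}) I \<Longrightarrow> (\<Sum>i\<in>I. t i - s i) < \<delta> \<Longrightarrow>
      (\<Sum>i\<in>I. \<bar>G (t i) - G (s i)\<bar>) < \<epsilon>"
      by (rule abs_cont_on_familyE[OF G e, where 'i="real set"]) (rule that)
    obtain U where U: "open U" "K \<subseteq> U" "emeasure lborel (U - K) < \<delta>"
      using outer_regular_lborel[OF Kb \<open>\<delta> > 0\<close>] by blast
    have "emeasure lborel U \<le> emeasure lborel (U - K) + emeasure lborel K"
      using U Kb by (intro order_trans[OF emeasure_mono emeasure_subadditive]) auto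
    then have lU: "emeasure lborel U < \<delta>" using U(3) K(2) by simp
    have "\<forall>x\<in>K. \<exists>e>0. cball x e \<subseteq> U"
      using U(1,2) open_contains_cball by blast
    then obtain r where r: "\<And>x. x \<in> K \<Longrightarrow> 0 < r x" "\<And>x. x \<in> K \<Longrightarrow> cball x (r x) \<subseteq> U"
      by metis
    have "K \<subseteq> (\<Union>x\<in>K. ball x (r x))" using r(1) by auto
    then obtain D where D: "D \<subseteq> K" "finite D" "K \<subseteq> (\<Union>x\<in>D. ball x (r x))"
      using compactE_image[OF K(1), of K "\<lambda>x. ball x (r x)"] by auto
    \<comment> \<open>The covering balls overlap. A division of the union of their closures consists
      of non-overlapping intervals, as absolute continuity requires.\<close>
    define W where "W = (\<lambda>x. cbox (x - r x) (x + r x)) ` D"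
    obtain p where p: "p division_of (\<Union>W)"
      by (rule elementary_unions_intervals[of W]) (use D(2) in \<open>auto simp: W_def\<close>)
    have WU: "\<Union>W \<subseteq> U"
      using r(2) D(1) by (auto simp: W_def subset_eq dist_real_def abs_le_iff)
    have KW: "K \<subseteq> \<Union>W"
      using D(3) by (force simp: W_def dist_real_def abs_less_iff)
    note pD = division_ofD[OF p]
    have "\<exists>a b. k = {a..b} \<and> a \<le> b" if k: "k \<in> p" for k
    proof -
      obtain a b where "k = {a..b}" using pD(4)[OF k] by (auto simp: cbox_interval)
      with pD(3)[OF k] show ?thesis by auto
    qed
    then have "\<forall>k\<in>p. \<exists>x. k = {fst x..snd x} \<and> fst x \<le> snd x" by (metis fst_conv snd_conv)
    from bchoice[OF this] obtain st where st: "\<forall>k\<in>p. k = {fst (st k)..snd (st k)} \<and> fst (st k) \<le> snd (st k)" ..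
    define s where "s k = fst (st k)" for k
    define t where "t k = snd (st k)" for k
    have st: "k = {s k..t k}" "s k \<le> t k" if "k \<in> p" for k
      using st that by (auto simp: s_def t_def)
    have int: "interior k = {s k<..<t k}" if "k \<in> p" for k
      by (subst st(1)[OF that]) (rule interior_atLeastAtMost_real)
    have dis: "{s k<..<t k} \<inter> {s l<..<t l} = {}" if "k \<in> p" "l \<in> p" "k \<noteq> l" for k l
      using pD(5)[OF that] by (simp add: int that)
    have "(\<Sum>k\<in>p. ennreal (t k - s k)) = (\<Sum>k\<in>p. emeasure lborel {s k<..<t k})"
      using st by (intro sum.cong) auto
    also have "\<dots> = emeasure lborel (\<Union>k\<in>p. {s k<..<t k})"
      using pD(1) dis by (intro sum_emeasure) (auto simp: disjoint_family_on_def)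
    also have "\<dots> \<le> emeasure lborel U"
    proof (rule emeasure_mono)
      show "(\<Union>k\<in>p. {s k<..<t k}) \<subseteq> U"
      proof (rule UN_least)
        fix k assume k: "k \<in> p"
        have "{s k<..<t k} \<subseteq> {s k..t k}" by auto
        also have "\<dots> = k" using st(1)[OF k] by simp
        also have "\<dots> \<subseteq> U" using WU pD(6) Union_upper[OF k] by simp
        finally show "{s k<..<t k} \<subseteq> U" .
      qed
    qed (use U in auto)
    finally have "ennreal (\<Sum>k\<in>p. t k - s k) < ennreal \<delta>"
      using lU st(2) by (subst sum_ennreal[symmetric]) auto
    then have small: "(\<Sum>k\<in>p. t k - s k) < \<delta>"
      using \<open>\<delta> > 0\<close> by (simp add: ennreal_less_iff sum_nonneg st(2))
    \<comment> \<open>\<open>G\<close> is controlled on \<open>[c,d]\<close> only. Clamping the end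
      points leaves the values of \<open>H\<close> unchanged, keeps the intervals disjoint and can
      only shorten them.\<close>
    have "(\<Sum>k\<in>p. \<bar>G (?cl (t k)) - G (?cl (s k))\<bar>) < \<epsilon>"
    proof (rule \<delta>[OF pD(1)])
      show "\<forall>k\<in>p. c \<le> ?cl (s k) \<and> ?cl (s k) \<le> ?cl (t k) \<and> ?cl (t k) \<le> d"
      proof
        fix k assume "k \<in> p"
        then show "c \<le> ?cl (s k) \<and> ?cl (s k) \<le> ?cl (t k) \<and> ?cl (t k) \<le> d"
          using st(2)[of k] cd by (auto simp: max_def min_def)
      qed
      have sub: "{?cl (s k)<..<?cl (t k)} \<subseteq> {s k<..<t k}" for k
        using cd by (auto simp: max_def min_def split: if_splits)
      then show "disjoint_family_on (\<lambda>k. {?cl (s k)<..<?cl (t k)}) p"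
        using dis unfolding disjoint_family_on_def by blast
      have "(\<Sum>k\<in>p. ?cl (t k) - ?cl (s k)) \<le> (\<Sum>k\<in>p. t k - s k)"
      proof (rule sum_mono)
        fix k assume "k \<in> p"
        then show "?cl (t k) - ?cl (s k) \<le> t k - s k"
          using st(2)[of k] cd by (auto simp: max_def min_def)
      qed
      then show "(\<Sum>k\<in>p. ?cl (t k) - ?cl (s k)) < \<delta>" using small by linarith
    qed
    moreover have "(\<Sum>k\<in>p. H (t k) - H (s k)) \<le> (\<Sum>k\<in>p. \<bar>G (?cl (t k)) - G (?cl (s k))\<bar>)"
      by (intro sum_mono) (simp add: H)
    ultimately have sumH: "(\<Sum>k\<in>p. H (t k) - H (s k)) \<le> \<epsilon>" by linarith
    have "emeasure ?\<nu> K \<le> emeasure ?\<nu> (\<Union>k\<in>p. {s k..t k})"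
    proof (rule emeasure_mono)
      have "(\<Union>k\<in>p. {s k..t k}) = (\<Union>k\<in>p. k)"
        using st(1) by (intro SUP_cong) auto
      then show "K \<subseteq> (\<Union>k\<in>p. {s k..t k})" using KW pD(6) by simp
    qed (use pD(1) in auto)
    also have "\<dots> \<le> (\<Sum>k\<in>p. emeasure ?\<nu> {s k..t k})"
      using pD(1) by (intro emeasure_subadditive_finite) auto
    also have "\<dots> = ennreal (\<Sum>k\<in>p. H (t k) - H (s k))"
      using st(2) Icc H_mono by (subst sum_ennreal[symmetric]) (auto intro!: sum.cong)
    also have "\<dots> \<le> ennreal \<epsilon>" using sumH by (rule ennreal_leI)
    finally show ?thesis .
  qed
  then have "emeasure ?\<nu> K \<le> 0"
    by - (rule ennreal_le_epsilon, simp)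
  then show ?thesis by simp
qed

text \<open>Extended by constants, \<open>G\<close> induces a finite Stieltjes measure. Inner
  regularity reduces its null sets to compact ones, so it is absolutely continuous with respect to
  Lebesgue measure, and the integrand is its Radon-Nikodym density.\<close>

lemma abs_cont_on_mono_has_integral:
  fixes c d :: real
  assumes G: "abs_cont_on c d G" and cd: "c \<le> d"
    and mono: "\<And>x y. c \<le> x \<Longrightarrow> x \<le> y \<Longrightarrow> y \<le> d \<Longrightarrow> G x \<le> G y"
  obtains g where "\<And>s t. c \<le> s \<Longrightarrow> s \<le> t \<Longrightarrow> t \<le> d \<Longrightarrow> (g has_integral (G t - G s)) {s..t}"
proof -
  define H where "H = (\<lambda>x. G (max c (min d x)))"
  let ?\<nu> = "interval_measure H"
  have H_mono: "H x \<le> H y" if "x \<le> y" for x y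
    using that cd unfolding H_def by (intro mono) auto
  have H_cont: "continuous_on UNIV H"
    unfolding H_def using cd
    by (intro continuous_on_compose2[OF abs_cont_on_continuous[OF G]] continuous_intros) auto
  have Icc: "emeasure ?\<nu> {s..t} = ennreal (H t - H s)" if "s \<le> t" for s t
    using emeasure_interval_measure_Icc[OF that H_mono H_cont] by simp
  have "(SUP n. emeasure ?\<nu> {- real n..real n}) = emeasure ?\<nu> (\<Union>n. {- real n..real n})"
    by (rule SUP_emeasure_incseq) (auto simp: incseq_def)
  moreover have "(\<Union>n. {- real n..real n}) = UNIV"
  proof (rule equalityI, simp, rule subsetI)
    fix x :: real
    obtain n :: nat where "\<bar>x\<bar> \<le> real n" using real_arch_simple by blast
    then show "x \<in> (\<Union>n. {- real n..real n})" by (auto simp: abs_le_iff intro!: exI[of _ n])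
  qed
  moreover have "emeasure ?\<nu> {- real n..real n} \<le> ennreal (G d - G c)" for n
  proof -
    have "H (real n) \<le> G d" "G c \<le> H (- real n)" 
      unfolding H_def using cd by (auto intro!: mono)
    then show ?thesis using Icc[of "- real n" "real n"] by (auto intro!: ennreal_leI)
  qed
  ultimately have "emeasure ?\<nu> UNIV \<le> ennreal (G d - G c)"
    by (metis (no_types, lifting) SUP_least)
  then have fin: "emeasure ?\<nu> UNIV < \<infinity>"
    by (metis ennreal_less_top infinity_ennreal_def le_less_trans)
  have "absolutely_continuous lborel ?\<nu>"
    unfolding absolutely_continuous_def
  proof
    fix N :: "real set" assume N: "N \<in> null_sets lborel"
    have "emeasure ?\<nu> N = (SUP K \<in> {K. K \<subseteq> N \<and> compact K}. emeasure ?\<nu> K)"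
      using fin N by (intro inner_regular) auto
    also have "\<dots> = 0"
    proof -
      have "emeasure ?\<nu> K = 0" if "K \<subseteq> N" "compact K" for K
      proof (rule abs_cont_on_compact_null[OF G cd mono H_def that(2)])
        have "emeasure lborel K \<le> emeasure lborel N"
          using that N by (intro emeasure_mono) auto
        then show "emeasure lborel K = 0" using N by auto
      qed
      then show ?thesis by (auto intro!: SUP_eq_const)
    qed
    finally show "N \<in> null_sets ?\<nu>" using N by (intro null_setsI) auto
  qed
  then obtain f where f[measurable]: "f \<in> borel_measurable lborel" and fd: "density lborel f = ?\<nu>"
    using sigma_finite_measure.Radon_Nikodym[OF sigma_finite_lborel, of ?\<nu>] by auto
  have em: "(\<integral>\<^sup>+x. f x * indicator A x \<partial>lborel) = emeasure ?\<nu> A" if "A \<in> sets borel" for A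
    using that unfolding fd[symmetric] by (subst emeasure_density) auto
  have "(\<integral>\<^sup>+x. f x \<partial>lborel) \<noteq> \<infinity>" using em[of UNIV] fin by auto
  then have AEf: "AE x in lborel. f x \<noteq> \<infinity>"
    by (intro nn_integral_PInf_AE) auto
  show ?thesis
  proof (rule that)
    fix s t assume st: "c \<le> s" "s \<le> t" "t \<le> d"
    \<comment> \<open>The total mass is finite, so the density is finite almost everywhere and
      \<open>enn2real\<close> changes it on a null set only.\<close>
    have "(\<integral>\<^sup>+x. ennreal (indicator {s..t} x * enn2real (f x)) \<partial>lborel) = (\<integral>\<^sup>+x. f x * indicator {s..t} x \<partial>lborel)"
      using AEf by (intro nn_integral_cong_AE) (auto simp: indicator_def less_top ennreal_enn2real)
    also have "\<dots> = ennreal (G t - G s)"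
      using em[of "{s..t}"] Icc[OF st(2)] st cd by (simp add: H_def)
    finally have "((\<lambda>x. indicator {s..t} x * enn2real (f x)) has_integral (G t - G s)) UNIV"
      using mono st by (intro nn_integral_has_integral) (auto simp: indicator_def)
    moreover have "(\<lambda>x. if x \<in> {s..t} then enn2real (f x) else 0) = (\<lambda>x. indicator {s..t} x * enn2real (f x))"
      by (auto simp: indicator_def fun_eq_iff)
    ultimately show "((\<lambda>x. enn2real (f x)) has_integral (G t - G s)) {s..t}"
      by (subst has_integral_restrict_UNIV[symmetric]) simp
  qed
qed

lemma abs_cont_on_has_integral:
  fixes c d :: real
  assumes F: "abs_cont_on c d F" and cd: "c \<le> d"
  obtains g where "\<And>s t. c \<le> s \<Longrightarrow> s \<le> t \<Longrightarrow> t \<le> d \<Longrightarrow> (g has_integral (F t - F s)) {s..t}"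
proof -
  obtain V where V: "abs_cont_on c d V"
    and FV: "\<And>x y. c \<le> x \<Longrightarrow> x \<le> y \<Longrightarrow> y \<le> d \<Longrightarrow> \<bar>F y - F x\<bar> \<le> V y - V x"
    using abs_cont_on_Jordan[OF F] by blast
  have "V x \<le> V y" if "c \<le> x" "x \<le> y" "y \<le> d" for x y
    using FV[OF that] by linarith
  then obtain g where g: "\<And>s t. c \<le> s \<Longrightarrow> s \<le> t \<Longrightarrow> t \<le> d \<Longrightarrow> (g has_integral (V t - V s)) {s..t}"
    using abs_cont_on_mono_has_integral[OF V cd] by blast
  have "F x + V x \<le> F y + V y" if "c \<le> x" "x \<le> y" "y \<le> d" for x y
    using FV[OF that] by linarith
  then obtain h where h: "\<And>s t. c \<le> s \<Longrightarrow> s \<le> t \<Longrightarrow> t \<le> d \<Longrightarrow> (h has_integral (F t + V t - (F s + V s))) {s..t}"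
    using abs_cont_on_mono_has_integral[OF abs_cont_on_add[OF F V] cd] by blast
  show ?thesis
  proof (rule that)
    fix s t assume "c \<le> s" "s \<le> t" "t \<le> d"
    from has_integral_diff[OF h[OF this] g[OF this]]
    show "((\<lambda>x. h x - g x) has_integral (F t - F s)) {s..t}" by (simp add: algebra_simps)
  qed
qed

section \<open>Differentiation almost everywhere and a mean value inequality\<close>

lemma indefinite_integral_right_derivative:
  fixes f :: "real \<Rightarrow> real"
  assumes "\<And>a b. f integrable_on {a..b}"
  obtains N where "negligible N"
    "\<And>x e. x \<notin> N \<Longrightarrow> 0 < e \<Longrightarrow> \<exists>d>0. \<forall>h. 0 < h \<and> h < d \<longrightarrow> \<bar>integral {x..x + h} f / h - f x\<bar> < e"
proof -
  obtain N where N: "negligible N" "\<And>x e. \<lbrakk>x \<notin> N; 0 < e\<rbrakk> \<Longrightarrow>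
      \<exists>d>0. \<forall>h. 0 < h \<and> h < d \<longrightarrow> norm(integral (cbox x (x + h *\<^sub>R One)) f /\<^sub>R h ^ DIM(real) - f x) < e"
    using integrable_ccontinuous_explicit[of f] assms by (auto simp: cbox_interval)
  show ?thesis
    by (rule that[OF N(1)]) (use N(2) in \<open>simp add: divide_inverse mult.commute\<close>)
qed

text \<open>Differentiation of the indefinite integral is available from the right. Applied to the
  reflected integrand it yields the difference quotients with negative \<open>h\<close>, at the
  price of a reflected null set.\<close>

lemma abs_cont_on_AE_derivative:
  fixes c d :: real
  assumes F: "abs_cont_on c d F" and cd: "c \<le> d"
  obtains g N where "\<And>s t. c \<le> s \<Longrightarrow> s \<le> t \<Longrightarrow> t \<le> d \<Longrightarrow> (g has_integral (F t - F s)) {s..t}"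
    "negligible N" "\<And>x. x \<in> {c<..<d} - N \<Longrightarrow> (F has_real_derivative g x) (at x)"
proof -
  obtain g where g: "\<And>s t. c \<le> s \<Longrightarrow> s \<le> t \<Longrightarrow> t \<le> d \<Longrightarrow> (g has_integral (F t - F s)) {s..t}"
    using abs_cont_on_has_integral[OF F cd] by blast
  \<comment> \<open>The cut-off makes the integrand integrable over every interval and does not
    affect increments inside \<open>[c,d]\<close>.\<close>
  define f where "f = (\<lambda>x. if x \<in> {c..d} then g x else 0)"
  have gcd: "g integrable_on {c..d}" using g[of c d] cd by auto
  have int: "f integrable_on {a..b}" for a b
    unfolding f_def integrable_restrict_Int
    unfolding Int_atLeastAtMost
    by (rule integrable_on_subinterval[OF gcd, of "max c a" "min d b", unfolded cbox_interval]) auto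
  have intF: "integral {s..t} f = F t - F s" if "c \<le> s" "s \<le> t" "t \<le> d" for s t
    by (rule integral_unique, rule has_integral_eq[OF _ g[OF that]]) (use that in \<open>auto simp: f_def\<close>)
  obtain N1 where N1: "negligible N1"
    "\<And>x e. x \<notin> N1 \<Longrightarrow> 0 < e \<Longrightarrow> \<exists>d>0. \<forall>h. 0 < h \<and> h < d \<longrightarrow> \<bar>integral {x..x + h} f / h - f x\<bar> < e"
    using indefinite_integral_right_derivative[OF int] by blast
  have "(\<lambda>x. f (- x)) integrable_on {a..b}" for a b
    using int[of "- b" "- a"] Henstock_Kurzweil_Integration.integrable_reflect_real[where f = f and a = "- b" and b = "- a"] by simp
  then obtain N2 where N2: "negligible N2"
    "\<And>x e. x \<notin> N2 \<Longrightarrow> 0 < e \<Longrightarrow> \<exists>d>0. \<forall>h. 0 < h \<and> h < d \<longrightarrow> \<bar>integral {x..x + h} (\<lambda>x. f (- x)) / h - f (- x)\<bar> < e"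
    using indefinite_integral_right_derivative[of "\<lambda>x. f (- x)"] by blast
  have "negligible (uminus ` N2)"
    using N2(1) by (intro negligible_differentiable_image_negligible) (auto simp: differentiable_on_def intro!: derivative_intros)
  with N1 have N: "negligible (N1 \<union> uminus ` N2)" by (simp add: negligible_Un)
  have "(F has_real_derivative g x) (at x)" if x: "x \<in> {c<..<d} - (N1 \<union> uminus ` N2)" for x
    unfolding DERIV_def LIM_eq
  proof (intro allI impI)
    fix e :: real assume e: "0 < e"
    have xN: "x \<notin> N1" "- x \<notin> N2" using x by (auto simp: image_iff) 
    obtain d1 where d1: "d1 > 0" "\<And>h. 0 < h \<Longrightarrow> h < d1 \<Longrightarrow> \<bar>integral {x..x + h} f / h - f x\<bar> < e"
      using N1(2)[OF xN(1) e] by blast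
    obtain d2 where d2: "d2 > 0" "\<And>h. 0 < h \<Longrightarrow> h < d2 \<Longrightarrow> \<bar>integral {- x..- x + h} (\<lambda>x. f (- x)) / h - f x\<bar> < e"
      using N2(2)[OF xN(2) e] by auto
    have fx: "f x = g x" using x by (simp add: f_def)
    show "\<exists>s>0. \<forall>h::real. h \<noteq> 0 \<and> norm (h - 0) < s \<longrightarrow> norm ((F (x + h) - F x) / h - g x) < e"
    proof (intro exI[of _ "min (min d1 d2) (min (x - c) (d - x))"] conjI allI impI)
      show "0 < min (min d1 d2) (min (x - c) (d - x))" using d1 d2 x by auto
      fix h :: real assume h: "h \<noteq> 0 \<and> norm (h - 0) < min (min d1 d2) (min (x - c) (d - x))"
      then have h0: "h \<noteq> 0" and hs: "\<bar>h\<bar> < d1" "\<bar>h\<bar> < d2" "\<bar>h\<bar> < x - c" "\<bar>h\<bar> < d - x" by auto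
      show "norm ((F (x + h) - F x) / h - g x) < e"
      proof (cases "0 < h")
        case True
        have "integral {x..x + h} f = F (x + h) - F x"
          using True hs x by (intro intF) auto
        then show ?thesis using d1(2)[OF True] hs True fx by (simp add: real_norm_def)
      next
        case False
        then have neg: "0 < - h" using h0 by simp
        have "integral {- x..- x + - h} (\<lambda>x. f (- x)) = integral {x + h..x} f"
          using Henstock_Kurzweil_Integration.integral_reflect_real[where a = "x + h" and b = x and f = f]
          by simp
        also have "\<dots> = F x - F (x + h)"
          using neg hs x by (intro intF) auto
        finally have "integral {- x..- x + - h} (\<lambda>x. f (- x)) / - h = (F (x + h) - F x) / h"
          using h0 by (simp add: divide_simps)
        then show ?thesis using d2(2)[OF neg] hs neg fx by (simp add: real_norm_def)
      qed
    qed
  qed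
  with g N that show ?thesis by blast
qed

text \<open>Both increments are integrals of the derivatives, so a null set of exceptions is
  harmless. For a merely continuous \<open>F\<close> this would fail, as the Cantor function
  shows.\<close>

lemma abs_cont_on_mean_bound:
  fixes c d :: real
  assumes F: "abs_cont_on c d F" and cd: "c \<le> d"
    and N: "negligible N" and dF: "\<And>x. x \<in> {c<..<d} - N \<Longrightarrow> (F has_real_derivative F' x) (at x)"
    and le: "\<And>x. x \<in> {c<..<d} - N \<Longrightarrow> \<bar>F' x\<bar> \<le> h x"
    and H: "\<And>x. x \<in> {c..d} \<Longrightarrow> (H has_real_derivative h x) (at x within {c..d})"
  shows "\<bar>F d - F c\<bar> \<le> H d - H c"
proof -
  obtain g M where g: "\<And>s t. c \<le> s \<Longrightarrow> s \<le> t \<Longrightarrow> t \<le> d \<Longrightarrow> (g has_integral (F t - F s)) {s..t}"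
    and M: "negligible M" "\<And>x. x \<in> {c<..<d} - M \<Longrightarrow> (F has_real_derivative g x) (at x)"
    using abs_cont_on_AE_derivative[OF F cd] by blast
  \<comment> \<open>Putting both integrands to 0 on the exceptional set makes the comparison hold
    everywhere without changing the integrals.\<close>
  define k where "k x = (if x \<in> {c<..<d} - (M \<union> N) then g x else 0)" for x
  define h' where "h' x = (if x \<in> {c<..<d} - (M \<union> N) then h x else 0)" for x
  have neg: "negligible (M \<union> N \<union> {c, d})" using M(1) N by (simp add: negligible_Un)
  have k: "(k has_integral (F d - F c)) {c..d}"
    by (rule has_integral_spike[OF neg _ g]) (use cd in \<open>auto simp: k_def\<close>)
  have "(h has_integral (H d - H c)) {c..d}"
    using H cd by (intro fundamental_theorem_of_calculus) (auto simp: has_real_derivative_iff_has_vector_derivative)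
  then have h': "(h' has_integral (H d - H c)) {c..d}"
    by (rule has_integral_spike[OF neg, rotated]) (auto simp: h'_def)
  have "\<bar>k x\<bar> \<le> h' x" for x
    using le M(2) dF DERIV_unique unfolding k_def h'_def by (metis DiffD1 DiffD2 DiffI UnCI abs_zero order_refl)
  then have "norm (integral {c..d} k) \<le> integral {c..d} h'"
    using k h' by (intro Henstock_Kurzweil_Integration.integral_norm_bound_integral) auto
  then show ?thesis using k h' by (simp add: integral_unique)
qed

section \<open>The Bernstein operator on polynomials\<close>

text \<open>The weighted sum of the absolute values of the coefficients, with weight
  \<open>s ^ i\<close> at order \<open>i\<close>. It is submultiplicative, bounds the polynomial on
  \<open>\<bar>h\<bar> \<le> s\<close>, and adds up over monomials without loss.\<close>

definition pnorm :: "real \<Rightarrow> real poly \<Rightarrow> real" where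
  "pnorm s p = poly (map_poly abs p) s"

lemma pnorm_0 [simp]: "pnorm s 0 = 0"
  by (simp add: pnorm_def)

lemma pnorm_pCons [simp]: "pnorm s (pCons c p) = \<bar>c\<bar> + s * pnorm s p"
  by (simp add: pnorm_def map_poly_pCons)

lemma pnorm_nonneg: "0 \<le> s \<Longrightarrow> 0 \<le> pnorm s p"
  by (induction p) auto

lemma pnorm_add: "0 \<le> s \<Longrightarrow> pnorm s (p + q) \<le> pnorm s p + pnorm s q"
proof (induction p arbitrary: q)
  case (pCons c p)
  obtain d q' where q: "q = pCons d q'" by (cases q)
  have "s * pnorm s (p + q') \<le> s * (pnorm s p + pnorm s q')"
    using pCons by (intro mult_left_mono) auto
  then show ?case by (simp add: q algebra_simps)
qed simp

lemma pnorm_smult: "pnorm s (smult c p) = \<bar>c\<bar> * pnorm s p"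
  by (induction p) (auto simp: abs_mult algebra_simps)

lemma pnorm_minus: "pnorm s (- p) = pnorm s p"
  using pnorm_smult[of s "-1" p] by simp

lemma pnorm_sum: "0 \<le> s \<Longrightarrow> pnorm s (\<Sum>i\<in>A. p i) \<le> (\<Sum>i\<in>A. pnorm s (p i))"
  by (induction A rule: infinite_finite_induct) (auto intro: order_trans[OF pnorm_add])

lemma pnorm_mult: "0 \<le> s \<Longrightarrow> pnorm s (p * q) \<le> pnorm s p * pnorm s q"
proof (induction p)
  case (pCons c p)
  have "pnorm s (pCons c p * q) \<le> \<bar>c\<bar> * pnorm s q + s * pnorm s (p * q)"
    using pnorm_add[of s "smult c q" "pCons 0 (p * q)"] pCons by (simp add: pnorm_smult)
  also have "\<dots> \<le> \<bar>c\<bar> * pnorm s q + s * (pnorm s p * pnorm s q)"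
    using pCons by (intro add_left_mono mult_left_mono) auto
  finally show ?case by (simp add: algebra_simps)
qed simp

lemma pnorm_monom: "pnorm s (monom c n) = \<bar>c\<bar> * s ^ n"
  by (induction n) (auto simp: monom_Suc monom_0 mult_ac)

lemma abs_poly_le_pnorm: "\<bar>h\<bar> \<le> s \<Longrightarrow> \<bar>poly p h\<bar> \<le> pnorm s p"
proof (induction p)
  case (pCons c p)
  have "\<bar>h * poly p h\<bar> \<le> s * pnorm s p"
    unfolding abs_mult using pCons by (intro mult_mono) auto
  then show ?case by simp
qed simp

text \<open>Coefficientwise, \<open>s\<close> times the derivative multiplies the term of order
  \<open>i\<close> by \<open>i\<close>. Keeping \<open>s\<close> on the left makes the constant
  independent of the scale.\<close>

lemma pnorm_pderiv: "0 \<le> s \<Longrightarrow> s * pnorm s (pderiv p) \<le> real (degree p) * pnorm s p"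
proof (induction p)
  case (pCons c p)
  show ?case
  proof (cases "p = 0")
    case False
    have "pnorm s (pderiv (pCons c p)) \<le> pnorm s p + s * pnorm s (pderiv p)"
      unfolding pderiv_pCons using pnorm_add[of s p "pCons 0 (pderiv p)"] pCons by simp
    also have "\<dots> \<le> pnorm s p + real (degree p) * pnorm s p"
      using pCons by simp
    finally have "s * pnorm s (pderiv (pCons c p)) \<le> s * ((1 + real (degree p)) * pnorm s p)"
      using pCons.prems by (intro mult_left_mono) (auto simp: algebra_simps)
    also have "\<dots> \<le> real (degree (pCons c p)) * pnorm s (pCons c p)"
      using False by (simp add: algebra_simps)
    finally show ?thesis .
  qed (simp add: pderiv_pCons)
qed simp

lemma pnorm_eq_sum:
  "degree p \<le> n \<Longrightarrow> pnorm s p = (\<Sum>i\<le>n. \<bar>coeff p i\<bar> * s ^ i)"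
proof (induction p arbitrary: n)
  case (pCons c p)
  show ?case
  proof (cases n)
    case 0
    then show ?thesis using pCons.prems by (auto split: if_splits)
  next
    case (Suc k)
    then have "degree p \<le> k" using pCons.prems by (auto split: if_splits)
    then show ?thesis
      unfolding Suc sum.atMost_Suc_shift
      using pCons.IH by (simp add: sum_distrib_left mult_ac)
  qed
qed simp

section \<open>Bernstein basis and moments about a point\<close>

lemma bern_basis_nonneg: "0 < a \<Longrightarrow> \<bar>x\<bar> \<le> a \<Longrightarrow> 0 \<le> bern_basis a m k x"
  by (auto simp: bern_basis_def intro!: mult_nonneg_nonneg zero_le_power divide_nonneg_pos)

lemma sum_bern_basis: "0 < a \<Longrightarrow> (\<Sum>k=0..m. bern_basis a m k x) = 1"
proof -
  assume a: "0 < a"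
  have "(\<Sum>k=0..m. bern_basis a m k x) = ((a + x) / (2 * a) + (a - x) / (2 * a)) ^ m"
    by (simp add: bern_basis_def binomial_ring atLeast0AtMost)
  also have "(a + x) / (2 * a) + (a - x) / (2 * a) = 1"
    using a by (simp add: field_simps)
  finally show ?thesis by simp
qed

lemma bern_node_bounds: 
  assumes "0 < a" "k \<le> m" shows "\<bar>bern_node a m k\<bar> \<le> a"
proof (cases "m = 0")
  case False
  have "real k * (2 * a / real m) \<le> real m * (2 * a / real m)"
    using assms by (intro mult_right_mono) auto
  moreover have "0 \<le> real k * (2 * a / real m)" using assms by simp
  ultimately show ?thesis using False unfolding bern_node_def by (auto simp: abs_le_iff)
qed (use assms in \<open>auto simp: bern_node_def\<close>)

text \<open>At \<open>n = 0\<close> the truncated exponent is wrong, but the factor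
  \<open>real n\<close> vanishes.\<close>

lemma power_pred_mult: "real n * z ^ (n - Suc 0) * z = real n * z ^ n"
  by (cases n) auto

text \<open>The classical differential equation of the basis, stated without division so that it
  includes the endpoints. It trades multiplication by the node offset for a differentiation.\<close>

lemma bern_basis_deriv:
  assumes "0 < a" "1 \<le> m" "k \<le> m"
  obtains D where "(bern_basis a m k has_real_derivative D) (at t)"
    "(a\<^sup>2 - t\<^sup>2) * D = real m * (bern_node a m k - t) * bern_basis a m k t"
proof -
  define u where "u = (a + t) / (2 * a)"
  define v where "v = (a - t) / (2 * a)"
  define b where "b = real (m choose k)"
  define D where "D = b * (real k * (1 / (2 * a) * u ^ (k - Suc 0)) * v ^ (m - k)
      + real (m - k) * (- 1 / (2 * a) * v ^ (m - k - Suc 0)) * u ^ k)"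
  have du: "((\<lambda>x. (a + x) / (2 * a)) has_real_derivative 1 / (2 * a)) (at t)"
    and dv: "((\<lambda>x. (a - x) / (2 * a)) has_real_derivative - 1 / (2 * a)) (at t)"
    using assms by (auto intro!: derivative_eq_intros)
  have "((\<lambda>x. b * (((a + x) / (2 * a)) ^ k * ((a - x) / (2 * a)) ^ (m - k))) has_real_derivative D) (at t)"
    unfolding D_def u_def v_def
    using DERIV_cmult[OF DERIV_mult[OF DERIV_power[OF du, of k] DERIV_power[OF dv, of "m - k"]], of b] by simp
  then have D: "(bern_basis a m k has_real_derivative D) (at t)"
    unfolding bern_basis_def[abs_def] b_def by (simp add: mult.assoc)
  have uv: "a\<^sup>2 - t\<^sup>2 = 4 * a\<^sup>2 * u * v"
    using assms by (simp add: u_def v_def field_simps power2_eq_square)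
  have node: "real m * (bern_node a m k - t) = 2 * a * (real k * v - real (m - k) * u)"
    using assms by (simp add: u_def v_def bern_node_def of_nat_diff field_simps)
  have "(a\<^sup>2 - t\<^sup>2) * D = 2 * a * b * ((real k * u ^ (k - Suc 0) * u) * v ^ (m - k) * v
      - u ^ k * u * (real (m - k) * v ^ (m - k - Suc 0) * v))"
    unfolding uv D_def using assms by (simp add: field_simps power2_eq_square)
  also have "\<dots> = 2 * a * b * (real k * u ^ k * v ^ (m - k) * v - u ^ k * u * (real (m - k) * v ^ (m - k)))"
    by (simp only: power_pred_mult)
  also have "\<dots> = real m * (bern_node a m k - t) * bern_basis a m k t"
    unfolding node bern_basis_def u_def[symmetric] v_def[symmetric] b_def[symmetric]
    by (simp add: algebra_simps)
  finally show ?thesis using D that by blast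
qed

text \<open>Write the offset of a node from \<open>x0\<close> as \<open>t - x0\<close> plus its
  offset from \<open>t\<close>; by \<open>bern_basis_deriv\<close> the second summand turns into a
  derivative of the operator.\<close>

lemma bern_op_shift:
  assumes "0 < a" "1 \<le> m" and "(bern_op a m g has_real_derivative D) (at t)"
  shows "bern_op a m (\<lambda>u. (u - x0) * g u) t = (t - x0) * bern_op a m g t + (a\<^sup>2 - t\<^sup>2) / m * D"
proof -
  have "\<exists>D. \<forall>k\<in>{0..m}. (bern_basis a m k has_real_derivative D k) (at t) \<and>
    (a\<^sup>2 - t\<^sup>2) * D k = real m * (bern_node a m k - t) * bern_basis a m k t"
    using bern_basis_deriv[OF assms(1,2)] by (intro bchoice) (metis atLeastAtMost_iff)
  then obtain E where E: "\<And>k. k \<in> {0..m} \<Longrightarrow> (bern_basis a m k has_real_derivative E k) (at t)"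
    "\<And>k. k \<in> {0..m} \<Longrightarrow> (a\<^sup>2 - t\<^sup>2) * E k = real m * (bern_node a m k - t) * bern_basis a m k t"
    by blast
  have "(bern_op a m g has_real_derivative (\<Sum>k=0..m. g (bern_node a m k) * E k)) (at t)"
    unfolding bern_op_def using E(1) by (auto intro!: derivative_eq_intros sum.cong)
  then have D: "D = (\<Sum>k=0..m. g (bern_node a m k) * E k)"
    using assms(3) DERIV_unique by blast
  have "(a\<^sup>2 - t\<^sup>2) * D = (\<Sum>k=0..m. g (bern_node a m k) * ((a\<^sup>2 - t\<^sup>2) * E k))"
    unfolding D sum_distrib_left by (intro sum.cong) auto
  also have "\<dots> = m * (\<Sum>k=0..m. (bern_node a m k - t) * g (bern_node a m k) * bern_basis a m k t)"
    unfolding sum_distrib_left by (intro sum.cong refl, subst E(2)) (auto simp: algebra_simps)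
  finally have *: "(a\<^sup>2 - t\<^sup>2) / m * D = (\<Sum>k=0..m. (bern_node a m k - t) * g (bern_node a m k) * bern_basis a m k t)"
    using assms by (simp add: field_simps)
  show ?thesis unfolding * 
    by (simp add: bern_op_def sum_distrib_left sum.distrib[symmetric] algebra_simps)
qed

text \<open>The recurrence of \<open>bern_op_shift\<close> for powers, as polynomials in
  \<open>h = t - x0\<close>; the quadratic factor is \<open>a\<^sup>2 - t\<^sup>2\<close> expanded
  in \<open>h\<close>.\<close>

primrec bern_moment :: "real \<Rightarrow> nat \<Rightarrow> real \<Rightarrow> nat \<Rightarrow> real poly" where
  "bern_moment a m x0 0 = 1"
| "bern_moment a m x0 (Suc j) = pCons 0 (bern_moment a m x0 j)
     + smult (1 / m) ([:a\<^sup>2 - x0\<^sup>2, - 2 * x0, - 1:] * pderiv (bern_moment a m x0 j))"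

lemma bern_op_moment:
  assumes "0 < a" "1 \<le> m"
  shows "bern_op a m (\<lambda>u. (u - x0) ^ j) t = poly (bern_moment a m x0 j) (t - x0)"
proof (induction j arbitrary: t)
  case 0
  then show ?case using sum_bern_basis[OF assms(1), of m t] by (simp add: bern_op_def)
next
  case (Suc j)
  have *: "bern_op a m (\<lambda>u. (u - x0) ^ j) = (\<lambda>t. poly (bern_moment a m x0 j) (t - x0))"
    using Suc by auto
  have "(bern_op a m (\<lambda>u. (u - x0) ^ j) has_real_derivative
      poly (pderiv (bern_moment a m x0 j)) (t - x0)) (at t)"
    unfolding * by (auto intro!: derivative_eq_intros)
  from bern_op_shift[OF assms this, of x0] 
  have "bern_op a m (\<lambda>u. (u - x0) * (u - x0) ^ j) t =
    (t - x0) * poly (bern_moment a m x0 j) (t - x0) + (a\<^sup>2 - t\<^sup>2) / m * poly (pderiv (bern_moment a m x0 j)) (t - x0)"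
    using * by simp
  moreover have w: "poly [:a\<^sup>2 - x0\<^sup>2, - 2 * x0, - 1:] (t - x0) = a\<^sup>2 - t\<^sup>2"
    by (simp add: power2_eq_square algebra_simps)
  ultimately show ?case
    unfolding bern_moment.simps poly_add poly_smult poly_mult w power_Suc by simp
qed

lemma degree_bern_moment: "degree (bern_moment a m x0 j) \<le> j"
proof (induction j)
  case (Suc j)
  have "degree (pderiv (bern_moment a m x0 j)) \<le> j - 1"
    using Suc by (simp add: degree_pderiv)
  then have "degree ([:a\<^sup>2 - x0\<^sup>2, - 2 * x0, - 1:] * pderiv (bern_moment a m x0 j)) \<le> Suc j"
  proof (cases j)
    case 0
    then have "pderiv (bern_moment a m x0 j) = 0" by (simp)
    then show ?thesis by simp
  next
    case (Suc i)
    then show ?thesis using \<open>degree (pderiv (bern_moment a m x0 j)) \<le> j - 1\<close>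
      by (intro order_trans[OF degree_mult_le]) simp
  qed
  moreover have "degree (pCons 0 (bern_moment a m x0 j)) \<le> Suc j"
    using Suc degree_pCons_le[of 0 "bern_moment a m x0 j"] by linarith
  ultimately show ?case
    by (auto intro!: degree_add_le order_trans[OF degree_smult_le])
qed simp

text \<open>Here \<open>s\<close> is a free length scale for \<open>h = t - x0\<close>. Measured at that scale, the operator moves \<open>h\<^sup>j\<close>
  by a relative amount of order \<open>\<theta>\<close>, because \<open>\<phi>\<^sup>2(t) = \<phi>\<^sup>2(x0) - 2 x0 h - h\<^sup>2\<close>.\<close>

definition bern_scale :: "real \<Rightarrow> nat \<Rightarrow> real \<Rightarrow> real \<Rightarrow> real \<Rightarrow> bool" where
  "bern_scale a m x0 s \<theta> \<longleftrightarrow> 0 < a \<and> 1 \<le> m \<and> \<bar>x0\<bar> \<le> a \<and> 0 < s \<and>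
     a\<^sup>2 - x0\<^sup>2 + 2 * a * s + s\<^sup>2 \<le> \<theta> * (m * s\<^sup>2)"

lemma bern_scale_pos: "bern_scale a m x0 s \<theta> \<Longrightarrow> 0 < \<theta>"
proof -
  assume A: "bern_scale a m x0 s \<theta>"
  then have x0a: "x0\<^sup>2 \<le> a\<^sup>2" by (auto simp: bern_scale_def abs_le_square_iff[symmetric])
  have "0 < 2 * a * s" using A by (auto simp: bern_scale_def)
  then have "0 < \<theta> * (m * s\<^sup>2)"
    using A x0a unfolding bern_scale_def by (smt (verit) zero_le_power2)
  moreover have "0 < m * s\<^sup>2" using A by (auto simp: bern_scale_def)
  ultimately show "0 < \<theta>" using zero_less_mult_pos2 by blast
qed

text \<open>Each step of the recurrence adds \<open>w / m\<close> times a derivative. Since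
  \<open>bern_scale\<close> bounds the norm of \<open>w\<close> by
  \<open>\<theta> * m * s\<^sup>2\<close> and a derivative costs \<open>j / s\<close>, the relative
  error grows by a multiple of \<open>\<theta>\<close>. The cap \<open>\<Theta>\<close> tames the
  quadratic term in \<open>\<theta>\<close>, so that the constant depends on \<open>j\<close> and
  \<open>\<Theta>\<close> only.\<close>

lemma bern_moment_error:
  fixes \<Theta> :: real
  assumes "0 \<le> \<Theta>"
  shows "\<exists>C\<ge>0. \<forall>a m x0 s \<theta>. bern_scale a m x0 s \<theta> \<longrightarrow> \<theta> \<le> \<Theta> \<longrightarrow>
     pnorm s (bern_moment a m x0 j - monom 1 j) \<le> C * \<theta> * s ^ j"
proof (induction j)
  case 0
  show ?case by (intro exI[of _ 0]) auto
next
  case (Suc j)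
  then obtain C where C: "0 \<le> C" and IH: "\<And>a m x0 s \<theta>. bern_scale a m x0 s \<theta> \<Longrightarrow> \<theta> \<le> \<Theta> \<Longrightarrow>
     pnorm s (bern_moment a m x0 j - monom 1 j) \<le> C * \<theta> * s ^ j" by blast
  show ?case
  proof (intro exI conjI allI impI)
    show "0 \<le> C + j * (1 + C * \<Theta>)" using C assms by simp
    fix a x0 s \<theta> :: real and m :: nat
    assume sc: "bern_scale a m x0 s \<theta>" and th: "\<theta> \<le> \<Theta>"
    then have a: "0 < a" and m: "1 \<le> m" and x0: "\<bar>x0\<bar> \<le> a" and s: "0 < s"
      and le: "a\<^sup>2 - x0\<^sup>2 + 2 * a * s + s\<^sup>2 \<le> \<theta> * (real m * s\<^sup>2)"
      by (auto simp: bern_scale_def)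
    let ?P = "bern_moment a m x0 j"
    define w where "w = [:a\<^sup>2 - x0\<^sup>2, - 2 * x0, - 1:]"
    define E where "E = ?P - monom 1 j"
    have E: "pnorm s E \<le> C * \<theta> * s ^ j" unfolding E_def using IH[OF sc th] .
    have x0a: "x0\<^sup>2 \<le> a\<^sup>2" using x0 a by (simp add: abs_le_square_iff[symmetric])
    have th0: "0 < \<theta>" using bern_scale_pos[OF sc] .
    have dE: "degree ?P \<le> j" by (rule degree_bern_moment)
    have nP: "pnorm s ?P \<le> (1 + C * \<theta>) * s ^ j"
      using pnorm_add[of s E "monom 1 j"] E s by (simp add: E_def pnorm_monom algebra_simps)
    have "s * pnorm s (pderiv ?P) \<le> real (degree ?P) * pnorm s ?P"
      using pnorm_pderiv s by simp
    also have "\<dots> \<le> real j * ((1 + C * \<theta>) * s ^ j)"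
      using dE nP pnorm_nonneg[of s ?P] s by (intro mult_mono) auto
    also have "\<dots> \<le> real j * ((1 + C * \<Theta>) * s ^ j)"
      using C th s by (intro mult_left_mono mult_right_mono add_left_mono) auto
    finally have dP: "s * pnorm s (pderiv ?P) \<le> real j * (1 + C * \<Theta>) * s ^ j" by (simp add: mult_ac)
    have w: "pnorm s w \<le> \<theta> * (real m * s\<^sup>2)"
    proof -
      have "pnorm s w = a\<^sup>2 - x0\<^sup>2 + 2 * \<bar>x0\<bar> * s + s\<^sup>2"
        using x0a by (simp add: w_def abs_mult power2_eq_square algebra_simps)
      also have "\<dots> \<le> a\<^sup>2 - x0\<^sup>2 + 2 * a * s + s\<^sup>2"
        using x0 s by simp
      finally show ?thesis using le by simp
    qed
    have "pnorm s (w * pderiv ?P) \<le> pnorm s w * pnorm s (pderiv ?P)"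
      using pnorm_mult s by simp
    also have "\<dots> \<le> \<theta> * (real m * s\<^sup>2) * pnorm s (pderiv ?P)"
      using w pnorm_nonneg[of s "pderiv ?P"] s by (intro mult_right_mono) auto
    also have "\<dots> = \<theta> * real m * s * (s * pnorm s (pderiv ?P))"
      by (simp add: power2_eq_square)
    also have "\<dots> \<le> \<theta> * real m * s * (real j * (1 + C * \<Theta>) * s ^ j)"
      using dP th0 s by (intro mult_left_mono) auto
    finally have wd: "pnorm s (smult (1 / m) (w * pderiv ?P)) \<le> \<theta> * (real j * (1 + C * \<Theta>)) * s ^ Suc j"
      using m by (simp add: pnorm_smult divide_le_eq mult_ac)
    have "bern_moment a m x0 (Suc j) - monom 1 (Suc j) = pCons 0 E + smult (1 / m) (w * pderiv ?P)"
      by (simp add: E_def w_def monom_Suc)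
    then have "pnorm s (bern_moment a m x0 (Suc j) - monom 1 (Suc j)) \<le>
       s * pnorm s E + pnorm s (smult (1 / m) (w * pderiv ?P))"
      using pnorm_add[of s "pCons 0 E"] s by simp
    also have "\<dots> \<le> s * (C * \<theta> * s ^ j) + \<theta> * (real j * (1 + C * \<Theta>)) * s ^ Suc j"
      using E wd s by (intro add_mono mult_left_mono) auto
    finally show "pnorm s (bern_moment a m x0 (Suc j) - monom 1 (Suc j)) \<le>
       (C + j * (1 + C * \<Theta>)) * \<theta> * s ^ Suc j"
      by (simp add: algebra_simps)
  qed
qed

section \<open>Iterates of the defect operator\<close>

abbreviation bern_defect :: "real \<Rightarrow> nat \<Rightarrow> (real \<Rightarrow> real) \<Rightarrow> real \<Rightarrow> real" where
  "bern_defect a m \<equiv> (\<lambda>g t. g t - bern_op a m g t)"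

text \<open>The defect \<open>Id - B\<^sub>m\<close> does not preserve inequalities. By positivity
  of \<open>B\<^sub>m\<close> it is dominated by \<open>Id + B\<^sub>m\<close>, whose iterates
  transport an upper bound.\<close>

abbreviation bern_majorant :: "real \<Rightarrow> nat \<Rightarrow> (real \<Rightarrow> real) \<Rightarrow> real \<Rightarrow> real" where
  "bern_majorant a m \<equiv> (\<lambda>g t. g t + bern_op a m g t)"

lemma bern_op_add: "bern_op a m (\<lambda>t. f t + g t) x = bern_op a m f x + bern_op a m g x"
  by (simp add: bern_op_def sum.distrib algebra_simps)

lemma bern_op_cmult: "bern_op a m (\<lambda>t. c * f t) x = c * bern_op a m f x"
  by (simp add: bern_op_def sum_distrib_left algebra_simps)

lemma bern_op_sum: "bern_op a m (\<lambda>t. \<Sum>i\<in>A. f i t) x = (\<Sum>i\<in>A. bern_op a m (f i) x)"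
  by (induction A rule: infinite_finite_induct) (auto simp: bern_op_add, auto simp: bern_op_def)

lemma bern_op_abs_le:
  assumes "0 < a" "\<bar>x\<bar> \<le> a" "\<And>t. \<bar>t\<bar> \<le> a \<Longrightarrow> \<bar>f t\<bar> \<le> g t"
  shows "\<bar>bern_op a m f x\<bar> \<le> bern_op a m g x"
proof -
  have "\<bar>bern_op a m f x\<bar> \<le> (\<Sum>k=0..m. \<bar>f (bern_node a m k) * bern_basis a m k x\<bar>)"
    unfolding bern_op_def by (rule sum_abs)
  also have "\<dots> \<le> bern_op a m g x"
    unfolding bern_op_def using assms bern_basis_nonneg[OF assms(1,2)] bern_node_bounds[OF assms(1)]
    by (intro sum_mono) (auto simp: abs_mult intro!: mult_right_mono)
  finally show ?thesis .
qed

lemma bern_defect_abs_le_majorant: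
  assumes "0 < a" "\<bar>x\<bar> \<le> a" "\<And>t. \<bar>t\<bar> \<le> a \<Longrightarrow> \<bar>f t\<bar> \<le> g t"
  shows "\<bar>(bern_defect a m ^^ l) f x\<bar> \<le> (bern_majorant a m ^^ l) g x"
  using assms(2)
proof (induction l arbitrary: x)
  case 0
  then show ?case using assms by simp
next
  case (Suc l)
  have "\<bar>bern_op a m ((bern_defect a m ^^ l) f) x\<bar> \<le> bern_op a m ((bern_majorant a m ^^ l) g) x"
    using bern_op_abs_le[OF assms(1) Suc.prems Suc.IH] .
  with Suc.IH[OF Suc.prems] show ?case by simp
qed

text \<open>A constant is an eigenfunction of \<open>Id + B\<^sub>m\<close> with eigenvalue
  2.\<close>

lemma bern_defect_bound:
  assumes "0 < a" "\<bar>x\<bar> \<le> a" "\<And>t. \<bar>t\<bar> \<le> a \<Longrightarrow> \<bar>f t\<bar> \<le> M"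
  shows "\<bar>(bern_defect a m ^^ l) f x\<bar> \<le> 2 ^ l * M"
proof -
  have *: "(bern_majorant a m ^^ l) (\<lambda>_. M) = (\<lambda>_. 2 ^ l * M)"
  proof (induction l)
    case (Suc l)
    have "bern_op a m (\<lambda>_. 2 ^ l * M) t = 2 ^ l * M" for t
      using sum_bern_basis[OF assms(1), of m t] by (simp add: bern_op_def sum_distrib_left[symmetric])
    then show ?case unfolding funpow.simps comp_apply Suc by (simp add: fun_eq_iff)
  qed simp
  show ?thesis
    using bern_defect_abs_le_majorant[OF assms, where m = m and l = l] by (simp add: *)
qed

lemma bern_defect_linear:
  "(bern_defect a m ^^ l) (\<lambda>t. (\<Sum>i\<in>A. c i * f i t) + g t) x =
    (\<Sum>i\<in>A. c i * (bern_defect a m ^^ l) (f i) x) + (bern_defect a m ^^ l) g x"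
proof (induction l arbitrary: x)
  case (Suc l)
  have *: "(bern_defect a m ^^ l) (\<lambda>t. (\<Sum>i\<in>A. c i * f i t) + g t) =
    (\<lambda>x. (\<Sum>i\<in>A. c i * (bern_defect a m ^^ l) (f i) x) + (bern_defect a m ^^ l) g x)"
    using Suc by blast
  show ?case
    unfolding funpow.simps comp_apply *
    by (simp add: bern_op_add bern_op_sum bern_op_cmult right_diff_distrib sum_subtractf)
qed simp

lemma continuous_on_bern_defect:
  assumes "0 < a" "continuous_on {-a..a} f"
  shows "continuous_on {-a..a} ((bern_defect a m ^^ l) f)"
proof (induction l)
  case (Suc l)
  have "continuous_on {-a..a} (bern_op a m g)" for g
    unfolding bern_op_def[abs_def] bern_basis_def using assms by (intro continuous_intros) auto
  with Suc show ?case by (auto intro!: continuous_intros)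
qed (use assms in simp)

text \<open>The moment estimates are summed over the coefficients of \<open>q\<close>. The image is
  again a polynomial in \<open>t - x0\<close> with the same degree bound, so the estimate can be
  iterated with one constant.\<close>

lemma bern_op_poly:
  fixes \<Theta> :: real
  assumes "0 \<le> \<Theta>"
  shows "\<exists>C\<ge>0. \<forall>a m x0 s \<theta> q. bern_scale a m x0 s \<theta> \<longrightarrow> \<theta> \<le> \<Theta> \<longrightarrow> degree q \<le> d \<longrightarrow>
     (\<exists>q'. degree q' \<le> d \<and> (\<forall>t. bern_op a m (\<lambda>u. poly q (u - x0)) t = poly q' (t - x0)) \<and>
       pnorm s (q' - q) \<le> C * \<theta> * pnorm s q)"
proof -
  have "\<exists>C. \<forall>j. C j \<ge> 0 \<and> (\<forall>a m x0 s \<theta>. bern_scale a m x0 s \<theta> \<longrightarrow> \<theta> \<le> \<Theta> \<longrightarrow>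
     pnorm s (bern_moment a m x0 j - monom 1 j) \<le> C j * \<theta> * s ^ j)"
    by (rule choice) (use bern_moment_error[OF assms] in blast)
  then obtain C where C0: "\<And>j. C j \<ge> 0" and C: "\<And>j a m x0 s \<theta>. bern_scale a m x0 s \<theta> \<Longrightarrow> \<theta> \<le> \<Theta> \<Longrightarrow>
     pnorm s (bern_moment a m x0 j - monom 1 j) \<le> C j * \<theta> * s ^ j"
    by blast
  define K where "K = (\<Sum>j\<le>d. C j)"
  have CK: "C j \<le> K" if "j \<le> d" for j
    unfolding K_def using that C0 by (intro member_le_sum) auto
  show ?thesis
  proof (intro exI[of _ K] conjI allI impI)
    show "K \<ge> 0" unfolding K_def using C0 by (intro sum_nonneg) auto
    fix a m x0 s \<theta> and q :: "real poly"
    assume sc: "bern_scale a m x0 s \<theta>" and th: "\<theta> \<le> \<Theta>" and dq: "degree q \<le> d"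
    have s: "0 < s" and a: "0 < a" and m: "1 \<le> m" using sc by (auto simp: bern_scale_def)
    define q' where "q' = (\<Sum>i\<le>d. smult (coeff q i) (bern_moment a m x0 i))"
    have q: "q = (\<Sum>i\<le>d. smult (coeff q i) (monom 1 i))"
      using poly_as_sum_of_monoms'[OF dq] by (simp add: smult_monom)
    show "\<exists>q'. degree q' \<le> d \<and> (\<forall>t. bern_op a m (\<lambda>u. poly q (u - x0)) t = poly q' (t - x0)) \<and>
       pnorm s (q' - q) \<le> K * \<theta> * pnorm s q"
    proof (intro exI[of _ q'] conjI allI)
      show "degree q' \<le> d"
        unfolding q'_def by (intro degree_sum_le) (auto intro: order_trans[OF degree_smult_le] order_trans[OF degree_bern_moment])
      fix t
      have "(\<lambda>u. poly q (u - x0)) = (\<lambda>u. \<Sum>i\<le>d. coeff q i * (u - x0) ^ i)"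
        by (subst q) (simp add: poly_sum poly_monom)
      then show "bern_op a m (\<lambda>u. poly q (u - x0)) t = poly q' (t - x0)"
        by (simp add: bern_op_sum bern_op_cmult bern_op_moment[OF a m] q'_def poly_sum)
    next
      have "q' - q = (\<Sum>i\<le>d. smult (coeff q i) (bern_moment a m x0 i - monom 1 i))"
        by (subst q) (simp add: q'_def sum_subtractf smult_diff_right)
      then have "pnorm s (q' - q) \<le> (\<Sum>i\<le>d. \<bar>coeff q i\<bar> * pnorm s (bern_moment a m x0 i - monom 1 i))"
        using pnorm_sum[of s "\<lambda>i. smult (coeff q i) (bern_moment a m x0 i - monom 1 i)" "{..d}"] s
        by (simp add: pnorm_smult)
      also have "\<dots> \<le> (\<Sum>i\<le>d. \<bar>coeff q i\<bar> * (K * \<theta> * s ^ i))"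
      proof (intro sum_mono mult_left_mono)
        fix i assume "i \<in> {..d}"
        then have "C i * \<theta> * s ^ i \<le> K * \<theta> * s ^ i"
          using CK bern_scale_pos[OF sc] s by (intro mult_right_mono) auto
        then show "pnorm s (bern_moment a m x0 i - monom 1 i) \<le> K * \<theta> * s ^ i"
          using C[OF sc th, of i] by linarith
      qed auto
      also have "\<dots> = K * \<theta> * pnorm s q"
        by (simp add: pnorm_eq_sum[OF dq] sum_distrib_left algebra_simps)
      finally show "pnorm s (q' - q) \<le> K * \<theta> * pnorm s q" .
    qed
  qed
qed

text \<open>Every application of the defect costs a factor \<open>C * \<theta>\<close> in the norm
  at scale \<open>s\<close>; the last norm is then evaluated at a point within distance
  \<open>s\<close> of \<open>x0\<close>.\<close>

lemma bern_defect_poly: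
  fixes \<Theta> :: real
  assumes "0 \<le> \<Theta>"
  shows "\<exists>C\<ge>0. \<forall>a m x0 s \<theta> q x. bern_scale a m x0 s \<theta> \<longrightarrow> \<theta> \<le> \<Theta> \<longrightarrow> degree q \<le> d \<longrightarrow> \<bar>x - x0\<bar> \<le> s \<longrightarrow>
     \<bar>(bern_defect a m ^^ l) (\<lambda>u. poly q (u - x0)) x\<bar> \<le> C * \<theta> ^ l * pnorm s q"
proof -
  obtain C where C0: "C \<ge> 0" and C: "\<And>a m x0 s \<theta> q. bern_scale a m x0 s \<theta> \<Longrightarrow> \<theta> \<le> \<Theta> \<Longrightarrow> degree q \<le> d \<Longrightarrow>
     (\<exists>q'. degree q' \<le> d \<and> (\<forall>t. bern_op a m (\<lambda>u. poly q (u - x0)) t = poly q' (t - x0)) \<and>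
       pnorm s (q' - q) \<le> C * \<theta> * pnorm s q)"
    using bern_op_poly[OF assms, of d] by blast
  show ?thesis
  proof (intro exI[of _ "C ^ l"] conjI allI impI)
    show "C ^ l \<ge> 0" using C0 by simp
    fix a m x0 s \<theta> x and q :: "real poly"
    assume sc: "bern_scale a m x0 s \<theta>" and th: "\<theta> \<le> \<Theta>" and dq: "degree q \<le> d" and x: "\<bar>x - x0\<bar> \<le> s"
    have "\<exists>q'. degree q' \<le> d \<and> (bern_defect a m ^^ l) (\<lambda>u. poly q (u - x0)) = (\<lambda>t. poly q' (t - x0)) \<and>
       pnorm s q' \<le> (C * \<theta>) ^ l * pnorm s q"
    proof (induction l)
      case 0
      then show ?case using dq by auto
    next
      case (Suc l)
      then obtain p where p: "degree p \<le> d" "(bern_defect a m ^^ l) (\<lambda>u. poly q (u - x0)) = (\<lambda>t. poly p (t - x0))"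
         "pnorm s p \<le> (C * \<theta>) ^ l * pnorm s q" by blast
      obtain p' where p': "degree p' \<le> d" "\<And>t. bern_op a m (\<lambda>u. poly p (u - x0)) t = poly p' (t - x0)"
        "pnorm s (p' - p) \<le> C * \<theta> * pnorm s p" using C[OF sc th p(1)] by blast
      have "pnorm s (p - p') \<le> C * \<theta> * pnorm s p"
        using p'(3) pnorm_minus[of s "p' - p"] by simp
      also have "\<dots> \<le> C * \<theta> * ((C * \<theta>) ^ l * pnorm s q)"
        using p(3) C0 bern_scale_pos[OF sc] by (intro mult_left_mono) auto
      finally show ?case
        using p(1) p'(1,2) p(2)
        by (intro exI[of _ "p - p'"]) (auto intro: degree_diff_le simp: mult.assoc)
    qed
    then obtain q' where q': "(bern_defect a m ^^ l) (\<lambda>u. poly q (u - x0)) = (\<lambda>t. poly q' (t - x0))"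
       "pnorm s q' \<le> (C * \<theta>) ^ l * pnorm s q" by blast
    then show "\<bar>(bern_defect a m ^^ l) (\<lambda>u. poly q (u - x0)) x\<bar> \<le> C ^ l * \<theta> ^ l * pnorm s q"
      using abs_poly_le_pnorm[OF x, of q'] by (simp add: power_mult_distrib)
  qed
qed

text \<open>No gain is sought here. \<open>Id + B\<^sub>m\<close> is twice the identity up to a
  relative error \<open>C * \<theta>\<close>, which stays bounded under
  \<open>\<theta> \<le> \<Theta>\<close>; the use is at a scale with \<open>\<theta>\<close> of
  order 1.\<close>

lemma bern_majorant_poly:
  fixes \<Theta> :: real
  assumes "0 \<le> \<Theta>"
  shows "\<exists>C\<ge>0. \<forall>a m x0 s \<theta> q x. bern_scale a m x0 s \<theta> \<longrightarrow> \<theta> \<le> \<Theta> \<longrightarrow> degree q \<le> d \<longrightarrow> \<bar>x - x0\<bar> \<le> s \<longrightarrow>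
     (bern_majorant a m ^^ l) (\<lambda>u. poly q (u - x0)) x \<le> C * pnorm s q"
proof -
  obtain C where C0: "C \<ge> 0" and C: "\<And>a m x0 s \<theta> q. bern_scale a m x0 s \<theta> \<Longrightarrow> \<theta> \<le> \<Theta> \<Longrightarrow> degree q \<le> d \<Longrightarrow>
     (\<exists>q'. degree q' \<le> d \<and> (\<forall>t. bern_op a m (\<lambda>u. poly q (u - x0)) t = poly q' (t - x0)) \<and>
       pnorm s (q' - q) \<le> C * \<theta> * pnorm s q)"
    using bern_op_poly[OF assms, of d] by blast
  let ?K = "2 + C * \<Theta>"
  have K: "?K \<ge> 0" using C0 assms by simp
  show ?thesis
  proof (intro exI[of _ "?K ^ l"] conjI allI impI)
    show "?K ^ l \<ge> 0" using K by simp
    fix a m x0 s \<theta> x and q :: "real poly"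
    assume sc: "bern_scale a m x0 s \<theta>" and th: "\<theta> \<le> \<Theta>" and dq: "degree q \<le> d" and x: "\<bar>x - x0\<bar> \<le> s"
    have s: "0 \<le> s" using sc by (auto simp: bern_scale_def)
    have "\<exists>q'. degree q' \<le> d \<and> (bern_majorant a m ^^ l) (\<lambda>u. poly q (u - x0)) = (\<lambda>t. poly q' (t - x0)) \<and>
       pnorm s q' \<le> ?K ^ l * pnorm s q"
    proof (induction l)
      case 0
      then show ?case using dq by auto
    next
      case (Suc l)
      then obtain p where p: "degree p \<le> d" "(bern_majorant a m ^^ l) (\<lambda>u. poly q (u - x0)) = (\<lambda>t. poly p (t - x0))"
         "pnorm s p \<le> ?K ^ l * pnorm s q" by blast
      obtain p' where p': "degree p' \<le> d" "\<And>t. bern_op a m (\<lambda>u. poly p (u - x0)) t = poly p' (t - x0)"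
        "pnorm s (p' - p) \<le> C * \<theta> * pnorm s p" using C[OF sc th p(1)] by blast
      have pp': "p + p' = smult 2 p + (p' - p)" by (rule poly_eqI) simp
      have "pnorm s (p + p') \<le> pnorm s (smult 2 p) + pnorm s (p' - p)"
        unfolding pp' by (rule pnorm_add[OF s])
      also have "\<dots> \<le> 2 * pnorm s p + C * \<Theta> * pnorm s p"
        using p'(3) mult_right_mono[OF mult_left_mono[OF th C0] pnorm_nonneg[OF s, of p]] by (simp add: pnorm_smult)
      also have "\<dots> = ?K * pnorm s p" by (simp add: algebra_simps)
      also have "\<dots> \<le> ?K * (?K ^ l * pnorm s q)"
        using p(3) K by (intro mult_left_mono) auto
      finally show ?case
        using p(1) p'(1,2) p(2)
        by (intro exI[of _ "p + p'"]) (auto intro: degree_add_le simp: mult.assoc)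
    qed
    then obtain q' where q': "(bern_majorant a m ^^ l) (\<lambda>u. poly q (u - x0)) = (\<lambda>t. poly q' (t - x0))"
       "pnorm s q' \<le> ?K ^ l * pnorm s q" by blast
    then show "(bern_majorant a m ^^ l) (\<lambda>u. poly q (u - x0)) x \<le> ?K ^ l * pnorm s q"
      using abs_poly_le_pnorm[OF x, of q'] by simp
  qed
qed

section \<open>Growth and Taylor expansion in the Sobolev-type space\<close>

text \<open>Equivalence of norms on the polynomials of degree below \<open>n\<close>, by induction
  on \<open>n\<close>. It will bound derivatives at the center by the size of the function.\<close>

lemma poly_coeffs_bounded:
  fixes b :: real
  assumes "0 < b"
  shows "\<exists>C\<ge>0. \<forall>(c :: nat \<Rightarrow> real) M. (\<forall>t. \<bar>t\<bar> \<le> b \<longrightarrow> \<bar>\<Sum>j<n. c j * t ^ j\<bar> \<le> M) \<longrightarrow> (\<forall>j<n. \<bar>c j\<bar> \<le> C * M)"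
proof (induction n)
  case 0
  show ?case by (intro exI[of _ 0]) auto
next
  case (Suc n)
  then obtain C where C0: "C \<ge> 0" and C: "\<And>(c :: nat \<Rightarrow> real) M j.
      (\<And>t. \<bar>t\<bar> \<le> b \<Longrightarrow> \<bar>\<Sum>j<n. c j * t ^ j\<bar> \<le> M) \<Longrightarrow> j < n \<Longrightarrow> \<bar>c j\<bar> \<le> C * M" by blast
  define D where "D = C * (1 + 2 ^ n)"
  define E where "E = (1 + (\<Sum>j<n. D * b ^ j)) / b ^ n"
  have D0: "D \<ge> 0" using C0 by (simp add: D_def)
  have E0: "E \<ge> 0" using D0 assms by (auto simp: E_def intro!: divide_nonneg_pos add_nonneg_nonneg sum_nonneg)
  show ?case
  proof (intro exI[of _ "D + E"] conjI allI impI)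
    show "D + E \<ge> 0" using D0 E0 by simp
    fix c :: "nat \<Rightarrow> real" and M j
    assume "\<forall>t. \<bar>t\<bar> \<le> b \<longrightarrow> \<bar>\<Sum>j<Suc n. c j * t ^ j\<bar> \<le> M" and j: "j < Suc n"
    then have M: "\<bar>\<Sum>j<Suc n. c j * t ^ j\<bar> \<le> M" if "\<bar>t\<bar> \<le> b" for t
      using that by blast
    have M0: "M \<ge> 0" using M[of 0] assms by simp
    text \<open>Passing from \<open>p(t)\<close> to \<open>p(t) - 2\<^sup>n p(t/2)\<close> cancels the leading term.\<close>
    define c' where "c' j = c j * (1 - 2 ^ n / 2 ^ j)" for j
    have low: "\<bar>c j\<bar> \<le> D * M" if "j < n" for j
    proof -
      have "\<bar>c' j\<bar> \<le> C * ((1 + 2 ^ n) * M)"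
      proof (rule C[OF _ that])
        fix t assume t: "\<bar>t\<bar> \<le> b"
        have "(\<Sum>j<n. c' j * t ^ j) = (\<Sum>j<Suc n. c' j * t ^ j)" by (simp add: c'_def)
        also have "\<dots> = (\<Sum>j<Suc n. c j * t ^ j) - 2 ^ n * (\<Sum>j<Suc n. c j * (t / 2) ^ j)"
          by (simp only: sum_distrib_left sum_subtractf[symmetric] c'_def)
            (auto simp: power_divide algebra_simps intro!: sum.cong)
        also have "\<bar>\<dots>\<bar> \<le> M + 2 ^ n * M"
        proof -
          have "\<bar>2 ^ n * (\<Sum>j<Suc n. c j * (t / 2) ^ j)\<bar> \<le> 2 ^ n * M"
            unfolding abs_mult using M[of "t / 2"] t by (intro mult_mono) auto
          then show ?thesis using M[OF t] by linarith
        qed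
        finally show "\<bar>\<Sum>j<n. c' j * t ^ j\<bar> \<le> (1 + 2 ^ n) * M" by (simp add: algebra_simps)
      qed
      moreover have "1 \<le> \<bar>1 - 2 ^ n / (2::real) ^ j\<bar>"
      proof -
        have "(2::real) * 2 ^ j \<le> 2 ^ n" using that power_increasing[of "Suc j" n "2::real"] by simp
        then have "2 \<le> 2 ^ n / (2::real) ^ j" by (simp add: field_simps)
        then show ?thesis by linarith
      qed
      then have "\<bar>c j\<bar> * 1 \<le> \<bar>c' j\<bar>" unfolding c'_def abs_mult by (intro mult_left_mono) auto
      ultimately show ?thesis by (simp add: D_def mult.assoc)
    qed
    show "\<bar>c j\<bar> \<le> (D + E) * M"
    proof (cases "j < n")
      case True
      have "D * M \<le> (D + E) * M" using E0 M0 by (intro mult_right_mono) auto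
      then show ?thesis using low[OF True] by linarith
    next
      case False
      then have [simp]: "j = n" using j by simp
      have "\<bar>\<Sum>j<n. c j * b ^ j\<bar> \<le> (\<Sum>j<n. D * M * b ^ j)"
        using low assms by (intro order_trans[OF sum_abs] sum_mono) (auto simp: abs_mult intro!: mult_right_mono)
      moreover have "c n * b ^ n = (\<Sum>j<Suc n. c j * b ^ j) - (\<Sum>j<n. c j * b ^ j)" by simp
      ultimately have "\<bar>c n * b ^ n\<bar> \<le> M + (\<Sum>j<n. D * M * b ^ j)" using M[of b] assms by linarith
      also have "\<dots> = (1 + (\<Sum>j<n. D * b ^ j)) * M"
        by (simp add: sum_distrib_left sum_distrib_right algebra_simps)
      finally have "\<bar>c n\<bar> * b ^ n \<le> (1 + (\<Sum>j<n. D * b ^ j)) * M" using assms by (simp add: abs_mult)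
      then have "\<bar>c n\<bar> \<le> E * M" using assms by (simp add: E_def field_simps)
      also have "\<dots> \<le> (D + E) * M" using D0 M0 by (intro mult_right_mono) auto
      finally show ?thesis by simp
    qed
  qed
qed

lemma C1_lipschitz_on_interval:
  fixes G :: "real \<Rightarrow> real"
  assumes "\<And>x. x \<in> {c..d} \<Longrightarrow> (G has_real_derivative G' x) (at x)" "continuous_on {c..d} G'"
  obtains L where "0 \<le> L" "\<And>s t. c \<le> s \<Longrightarrow> s \<le> t \<Longrightarrow> t \<le> d \<Longrightarrow> \<bar>G t - G s\<bar> \<le> L * (t - s)"
proof -
  have "bounded (G' ` {c..d})"
    using assms(2) by (intro compact_imp_bounded compact_continuous_image) auto
  then obtain L where L: "0 < L" "\<And>x. x \<in> {c..d} \<Longrightarrow> \<bar>G' x\<bar> \<le> L"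
    unfolding bounded_pos by (auto simp: real_norm_def)
  show ?thesis
  proof (rule that)
    show "0 \<le> L" using L by simp
    fix s t assume st: "c \<le> s" "s \<le> t" "t \<le> d"
    have "norm (G t - G s) \<le> L * norm (t - s)"
    proof (rule field_differentiable_bound[of "{s..t}" G G'])
      fix x assume "x \<in> {s..t}"
      then show "(G has_field_derivative G' x) (at x within {s..t})" "norm (G' x) \<le> L"
        using assms(1)[of x] L(2)[of x] st by (auto intro: has_field_derivative_at_within)
    qed (use st in auto)
    then show "\<bar>G t - G s\<bar> \<le> L * (t - s)" using st by simp
  qed
qed

lemma abs_cont_on_mult_lipschitz:
  assumes F: "abs_cont_on c d F" and L: "0 \<le> L" "\<And>s t. c \<le> s \<Longrightarrow> s \<le> t \<Longrightarrow> t \<le> d \<Longrightarrow> \<bar>P t - P s\<bar> \<le> L * (t - s)"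
  shows "abs_cont_on c d (\<lambda>x. F x * P x)"
proof -
  have "bounded (F ` {c..d})"
    using abs_cont_on_continuous[OF F] by (intro compact_imp_bounded compact_continuous_image) auto
  then obtain A where A: "0 < A" "\<And>x. x \<in> {c..d} \<Longrightarrow> \<bar>F x\<bar> \<le> A"
    unfolding bounded_pos by (auto simp: real_norm_def)
  define B where "B = \<bar>P c\<bar> + L * \<bar>d - c\<bar>"
  have B: "\<bar>P x\<bar> \<le> B" if "x \<in> {c..d}" for x
  proof -
    have "L * (x - c) \<le> L * \<bar>d - c\<bar>" using that L(1) by (intro mult_left_mono) auto
    then show ?thesis using L(2)[of c x] that by (auto simp: B_def)
  qed
  let ?M = "A * L + \<bar>B\<bar> + 1"
  show ?thesis
  proof (rule abs_cont_on_dominated[OF F, of _ ?M])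
    fix s t assume st: "c \<le> s" "s \<le> t" "t \<le> d"
    have "F t * P t - F s * P s = (F t - F s) * P t + F s * (P t - P s)" by (simp add: algebra_simps)
    then have "\<bar>F t * P t - F s * P s\<bar> \<le> \<bar>F t - F s\<bar> * \<bar>P t\<bar> + \<bar>F s\<bar> * \<bar>P t - P s\<bar>"
      by (metis abs_mult abs_triangle_ineq)
    also have "\<dots> \<le> \<bar>F t - F s\<bar> * ?M + A * (L * (t - s))"
    proof (intro add_mono mult_mono)
      have "\<bar>P t\<bar> \<le> B" using B[of t] st by auto
      then show "\<bar>P t\<bar> \<le> ?M" using A L by (smt (verit) mult_nonneg_nonneg)
    qed (use A L st in auto)
    also have "A * (L * (t - s)) \<le> ?M * (t - s)"
      unfolding mult.assoc[symmetric] using st by (intro mult_right_mono) auto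
    finally show "\<bar>F t * P t - F s * P s\<bar> \<le> ?M * \<bar>F t - F s\<bar> + ?M * (t - s)" by (simp add: mult.commute)
  next
    show "0 < ?M" using A L by (smt (verit) mult_nonneg_nonneg)
  qed
qed

lemma abs_cont_on_sum:
  "finite I \<Longrightarrow> (\<And>i. i \<in> I \<Longrightarrow> abs_cont_on c d (F i)) \<Longrightarrow> abs_cont_on c d (\<lambda>x. \<Sum>i\<in>I. F i x)"
proof (induction I rule: finite_induct)
  case empty
  show ?case by (rule abs_cont_on_lipschitz[of _ _ _ 0]) auto
next
  case (insert i I)
  then show ?case by (auto intro!: abs_cont_on_add)
qed

text \<open>The difference of the two sides factors through \<open>u - x0\<close>, and the other
  factor is nonnegative because \<open>u\<close> lies between \<open>x0\<close> and
  \<open>t\<close>. Read as a quotient: \<open>\<bar>t - u\<bar>\<close> over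
  \<open>a\<^sup>2 - u\<^sup>2\<close> is at most its value at \<open>u = x0\<close>.\<close>

lemma phi_ratio:
  fixes a :: real
  assumes "\<bar>t\<bar> \<le> a" "x0 \<le> u \<and> u \<le> t \<or> t \<le> u \<and> u \<le> x0"
  shows "\<bar>t - u\<bar> * (a\<^sup>2 - x0\<^sup>2) \<le> \<bar>t - x0\<bar> * (a\<^sup>2 - u\<^sup>2)"
proof -
  have ta: "t\<^sup>2 \<le> a\<^sup>2" using assms(1) by (metis abs_le_square_iff abs_of_nonneg abs_ge_zero order_trans)
  have "(t - x0) * (a\<^sup>2 - u\<^sup>2) - (t - u) * (a\<^sup>2 - x0\<^sup>2) = (u - x0) * (a\<^sup>2 - t\<^sup>2 + (t - u) * (t - x0))"
    by (simp add: power2_eq_square algebra_simps)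
  moreover from assms(2) show ?thesis
  proof
    assume *: "x0 \<le> u \<and> u \<le> t"
    then have "0 \<le> (u - x0) * (a\<^sup>2 - t\<^sup>2 + (t - u) * (t - x0))" using ta by (intro mult_nonneg_nonneg add_nonneg_nonneg) auto
    then show ?thesis using * calculation by simp
  next
    assume *: "t \<le> u \<and> u \<le> x0"
    then have "(u - x0) * (a\<^sup>2 - t\<^sup>2 + (t - u) * (t - x0)) \<le> 0" using ta
      by (intro mult_nonpos_nonneg add_nonneg_nonneg mult_nonpos_nonpos) auto
    then have "(t - x0) * (a\<^sup>2 - u\<^sup>2) \<le> (t - u) * (a\<^sup>2 - x0\<^sup>2)" using calculation by linarith
    then show ?thesis using * by (simp add: algebra_simps)
  qed
qed

text \<open>\<open>g j\<close> stands for the derivative of order \<open>j\<close>. One null set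
  \<open>Z\<close> collects the points where \<open>g (r - 1)\<close> may fail to be differentiable
  or the essential bound fails; the conventions behind \<open>deriv\<close> and the essential
  supremum are thereby confined to a single lemma.\<close>

locale sobolev_chain =
  fixes a :: real and r :: nat and g :: "nat \<Rightarrow> real \<Rightarrow> real" and Z :: "real set" and S :: real
  assumes a_pos: "0 < a" and r_pos: "1 \<le> r" and Z: "negligible Z"
    and cont0: "continuous_on {-a..a} (g 0)"
    and deriv_low: "\<And>j x. j < r - 1 \<Longrightarrow> \<bar>x\<bar> < a \<Longrightarrow> (g j has_real_derivative g (Suc j) x) (at x)"
    and lac: "loc_abs_cont a (g (r - 1))"
    and deriv_top: "\<And>x. \<bar>x\<bar> < a \<Longrightarrow> x \<notin> Z \<Longrightarrow> (g (r - 1) has_real_derivative g r x) (at x)"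
    and top_bound: "\<And>x. \<bar>x\<bar> < a \<Longrightarrow> x \<notin> Z \<Longrightarrow> \<bar>g r x\<bar> * sqrt (a\<^sup>2 - x\<^sup>2) ^ r \<le> S"
    and S_nonneg: "0 \<le> S"
begin

lemma deriv_ae:
  assumes "j < r" "\<bar>x\<bar> < a" "x \<notin> Z"
  shows "(g j has_real_derivative g (Suc j) x) (at x)"
proof (cases "j < r - 1")
  case False
  then have "j = r - 1" "Suc j = r" using assms r_pos by auto
  then show ?thesis using deriv_top[OF assms(2,3)] by simp
qed (use deriv_low assms in auto)

lemma cont_mid:
  assumes "j < r" "- a < c" "d < a"
  shows "continuous_on {c..d} (g j)"
proof (cases "j < r - 1")
  case True
  show ?thesis
  proof (rule DERIV_continuous_on)
    fix x assume "x \<in> {c..d}"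
    then have "\<bar>x\<bar> < a" using assms by auto
    from deriv_low[OF True this]
    show "(g j has_real_derivative g (Suc j) x) (at x within {c..d})"
      by (rule has_field_derivative_at_within)
  qed
next
  case False
  then have "j = r - 1" using assms by auto
  then show ?thesis using lac assms abs_cont_on_continuous unfolding loc_abs_cont_def
    by (cases "c \<le> d") auto
qed

lemma abs_cont_mid:
  assumes "j < r" "- a < c" "c \<le> d" "d < a"
  shows "abs_cont_on c d (g j)"
proof (cases "j < r - 1")
  case True
  obtain L where "0 \<le> L" "\<And>s t. c \<le> s \<Longrightarrow> s \<le> t \<Longrightarrow> t \<le> d \<Longrightarrow> \<bar>g j t - g j s\<bar> \<le> L * (t - s)"
    by (rule C1_lipschitz_on_interval[of c d "g j" "g (Suc j)"])
      (use True assms in \<open>auto intro!: deriv_low cont_mid simp: abs_less_iff\<close>)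
  then show ?thesis by (intro abs_cont_on_lipschitz)
next
  case False
  then have "j = r - 1" using assms by auto
  then show ?thesis using lac assms unfolding loc_abs_cont_def by auto
qed

lemma growth_step:
  assumes j: "j < r" and p: "0 < p" and A: "0 \<le> A"
    and le: "\<And>x. \<bar>x\<bar> < a \<Longrightarrow> x \<notin> Z \<Longrightarrow> \<bar>g (Suc j) x\<bar> \<le> A * (a - \<bar>x\<bar>) powr (- (p + 1))"
    and x: "\<bar>x\<bar> < a"
  shows "\<bar>g j x\<bar> \<le> \<bar>g j 0\<bar> + A / p * (a - \<bar>x\<bar>) powr (- p)"
proof -
  \<comment> \<open>The power of \<open>a - \<bar>u\<bar>\<close> is replaced by the sum of the two
    one-sided powers. This majorant \<open>h\<close> is smooth and has the odd antiderivative
    \<open>H\<close>, so integrating from 0 treats both signs of \<open>x\<close>.\<close>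
  define H where "H u = A / p * ((a - u) powr (- p) - (a + u) powr (- p))" for u
  define h where "h u = A * ((a - u) powr (- p - 1) + (a + u) powr (- p - 1))" for u
  have H: "(H has_real_derivative h u) (at u)" if "\<bar>u\<bar> < a" for u
  proof -
    have "((\<lambda>u. (a - u) powr (- p)) has_real_derivative - p * (a - u) powr (- p - of_nat 1) * - 1) (at u)"
      using that by (intro DERIV_fun_powr) (auto intro!: derivative_eq_intros)
    moreover have "((\<lambda>u. (a + u) powr (- p)) has_real_derivative - p * (a + u) powr (- p - of_nat 1) * 1) (at u)"
      using that by (intro DERIV_fun_powr) (auto intro!: derivative_eq_intros)
    ultimately have "(H has_real_derivative A / p * (- p * (a - u) powr (- p - of_nat 1) * - 1
        - - p * (a + u) powr (- p - of_nat 1) * 1)) (at u)"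
      unfolding H_def[abs_def] by (intro DERIV_cmult DERIV_diff)
    also have "A / p * (- p * (a - u) powr (- p - of_nat 1) * - 1
        - - p * (a + u) powr (- p - of_nat 1) * 1) = h u"
      using p by (simp add: h_def field_simps)
    finally show ?thesis .
  qed
  have h: "\<bar>g (Suc j) u\<bar> \<le> h u" if u: "\<bar>u\<bar> < a" "u \<notin> Z" for u
  proof -
    have "\<bar>g (Suc j) u\<bar> \<le> A * (a - \<bar>u\<bar>) powr (- p - 1)" using le[OF u] by simp
    also have "\<dots> \<le> h u"
      unfolding h_def using A by (intro mult_left_mono) (auto simp: abs_if)
    finally show ?thesis .
  qed
  have mean: "\<bar>g j d - g j c\<bar> \<le> H d - H c" if "- a < c" "c \<le> d" "d < a" for c d
  proof (rule abs_cont_on_mean_bound[OF abs_cont_mid[OF j that] that(2) Z])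
    fix u assume "u \<in> {c<..<d} - Z"
    then have u: "\<bar>u\<bar> < a" "u \<notin> Z" using that by auto
    show "(g j has_real_derivative g (Suc j) u) (at u)" using deriv_ae[OF j u] .
    show "\<bar>g (Suc j) u\<bar> \<le> h u" using h[OF u] .
  next
    fix u assume "u \<in> {c..d}"
    then have "\<bar>u\<bar> < a" using that by auto
    from H[OF this] show "(H has_real_derivative h u) (at u within {c..d})"
      by (rule has_field_derivative_at_within)
  qed
  have H0: "H 0 = 0" by (simp add: H_def)
  have Ap: "0 \<le> A / p" using A p by simp
  show ?thesis
  proof (cases "0 \<le> x")
    case True
    have "H x \<le> A / p * (a - \<bar>x\<bar>) powr (- p)"
      unfolding H_def using True Ap by (intro mult_left_mono) auto
    then show ?thesis using mean[of 0 x] True x H0 by linarith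
  next
    case False
    have "- H x = A / p * ((a + x) powr (- p) - (a - x) powr (- p))" by (simp add: H_def algebra_simps)
    also have "\<dots> \<le> A / p * (a - \<bar>x\<bar>) powr (- p)"
      using False Ap by (intro mult_left_mono) auto
    finally show ?thesis using mean[of x 0] False x H0 by linarith
  qed
qed

lemma taylor_remainder:
  assumes x0: "\<bar>x0\<bar> < a" and t: "\<bar>t\<bar> \<le> a"
  shows "\<bar>g 0 t - (\<Sum>j<r. g j x0 / fact j * (t - x0) ^ j)\<bar> \<le> 2 * S * \<bar>t - x0\<bar> ^ r / sqrt (a\<^sup>2 - x0\<^sup>2) ^ r"
proof -
  have phi_pos: "0 < a\<^sup>2 - u\<^sup>2" if "\<bar>u\<bar> < a" for u
    using that abs_square_less_1[of "u / a"] a_pos by (simp add: power_divide abs_less_iff field_simps)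
  have inner: "\<bar>g 0 t - (\<Sum>j<r. g j x0 / fact j * (t - x0) ^ j)\<bar> \<le> 2 * S * \<bar>t - x0\<bar> ^ r / sqrt (a\<^sup>2 - x0\<^sup>2) ^ r"
    if t: "\<bar>t\<bar> < a" for t
  proof -
    text \<open>Moving the expansion point: \<open>\<psi>\<close> is locally absolutely continuous with telescoping
      derivative \<open>\<psi>'\<close>, and runs from the Taylor polynomial at \<open>x0\<close> to \<open>f(t)\<close>. Bounding \<open>\<psi>'\<close> through
      \<open>phi_ratio\<close> loses nothing near the endpoints, where \<open>g r\<close> is unbounded.\<close>
    define \<psi> where "\<psi> u = (\<Sum>j<r. g j u * ((t - u) ^ j / fact j))" for u
    define \<psi>' where "\<psi>' u = g r u * ((t - u) ^ (r - 1) / fact (r - 1))" for u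
    define \<phi> where "\<phi> u = sqrt (a\<^sup>2 - u\<^sup>2)" for u
    define B where "B = sqrt \<bar>t - x0\<bar>"
    define K where "K = S * B ^ (2 * r - 1) / \<phi> x0 ^ r"
    have \<phi>0: "0 < \<phi> u" if "\<bar>u\<bar> < a" for u using phi_pos[OF that] by (simp add: \<phi>_def)
    have K0: "0 \<le> K" using S_nonneg \<phi>0[OF x0] by (auto simp: K_def B_def)
    have \<psi>t: "\<psi> t = g 0 t"
    proof -
      have "\<psi> t = (\<Sum>j<r. if j = 0 then g 0 t else 0)"
        unfolding \<psi>_def by (intro sum.cong) auto
      then show ?thesis using r_pos by simp
    qed
    have \<psi>x0: "\<psi> x0 = (\<Sum>j<r. g j x0 / fact j * (t - x0) ^ j)"
      by (simp add: \<psi>_def)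
    have d\<psi>: "(\<psi> has_real_derivative \<psi>' u) (at u)" if u: "\<bar>u\<bar> < a" "u \<notin> Z" for u
    proof -
      define D where "D j = (if j = 0 then 0 else g j u * ((t - u) ^ (j - 1) / fact (j - 1)))" for j
      have "((\<lambda>u. g j u * ((t - u) ^ j / fact j)) has_real_derivative D (Suc j) - D j) (at u)" if "j < r" for j
      proof -
        have "((\<lambda>u. (t - u) ^ j / fact j) has_real_derivative
            (if j = 0 then 0 else - ((t - u) ^ (j - 1) / fact (j - 1)))) (at u)"
        proof (cases j)
          case (Suc n)
          have d: "((\<lambda>u. t - u) has_real_derivative - 1) (at u)"
            by (auto intro!: derivative_eq_intros)
          have "((\<lambda>u. (t - u) ^ Suc n / fact (Suc n)) has_real_derivative
              real (Suc n) * (- 1 * (t - u) ^ n) / fact (Suc n)) (at u)"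
            using DERIV_cdivide[OF DERIV_power[OF d, of "Suc n"], of "fact (Suc n)"] by simp
          also have "real (Suc n) * (- 1 * (t - u) ^ n) / fact (Suc n) = - ((t - u) ^ n / fact n)"
            unfolding fact_Suc by (simp add: field_simps del: of_nat_Suc)
          finally show ?thesis using Suc by simp
        qed simp
        from DERIV_mult[OF deriv_ae[OF that u] this]
        show ?thesis by (simp add: D_def algebra_simps split: if_splits)
      qed
      then have "(\<psi> has_real_derivative (\<Sum>j<r. D (Suc j) - D j)) (at u)"
        unfolding \<psi>_def[abs_def] by (intro DERIV_sum) auto
      also have "(\<Sum>j<r. D (Suc j) - D j) = D r - D 0" by (rule sum_lessThan_telescope)
      also have "\<dots> = \<psi>' u" using r_pos by (simp add: D_def \<psi>'_def)
      finally show ?thesis .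
    qed
    have AC: "abs_cont_on c d \<psi>" if cd: "- a < c" "c \<le> d" "d < a" for c d
      unfolding \<psi>_def[abs_def]
    proof (intro abs_cont_on_sum)
      fix j assume j: "j \<in> {..<r}"
      obtain L where "0 \<le> L" "\<And>s u. c \<le> s \<Longrightarrow> s \<le> u \<Longrightarrow> u \<le> d \<Longrightarrow> \<bar>(t - u) ^ j / fact j - (t - s) ^ j / fact j\<bar> \<le> L * (u - s)"
        by (rule C1_lipschitz_on_interval[of c d "\<lambda>u. (t - u) ^ j / fact j" "\<lambda>u. - (real j * (t - u) ^ (j - 1) / fact j)"])
          (auto intro!: derivative_eq_intros continuous_intros)
      then show "abs_cont_on c d (\<lambda>x. g j x * ((t - x) ^ j / fact j))"
        using abs_cont_mid[of j c d] cd j by (intro abs_cont_on_mult_lipschitz) auto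
    qed simp
    \<comment> \<open>With \<open>w = sqrt \<bar>t - u\<bar>\<close>, the ratio bound consumes
      \<open>w ^ r\<close> while \<open>\<psi>'\<close> provides only
      \<open>w ^ (2 * r - 2)\<close>, which is too little for \<open>r = 1\<close>. Borrowing one
      factor \<open>w\<close> covers all \<open>r\<close> and leaves the singularity
      \<open>1 / w\<close>, which is integrable up to \<open>t\<close>.\<close>
    have bound: "\<bar>\<psi>' u\<bar> \<le> K / sqrt \<bar>t - u\<bar>"
      if u: "x0 \<le> u \<and> u < t \<or> t < u \<and> u \<le> x0" "u \<notin> Z" for u
    proof -
      have ua: "\<bar>u\<bar> < a" using u x0 t by auto
      define w where "w = sqrt \<bar>t - u\<bar>"
      have w: "0 < w" "\<bar>t - u\<bar> = w\<^sup>2" using u by (auto simp: w_def)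
      have "w * \<phi> x0 \<le> B * \<phi> u"
      proof -
        have "\<bar>t - u\<bar> * (a\<^sup>2 - x0\<^sup>2) \<le> \<bar>t - x0\<bar> * (a\<^sup>2 - u\<^sup>2)"
          using u t by (intro phi_ratio) auto
        then have "sqrt (\<bar>t - u\<bar> * (a\<^sup>2 - x0\<^sup>2)) \<le> sqrt (\<bar>t - x0\<bar> * (a\<^sup>2 - u\<^sup>2))" by simp
        then show ?thesis by (simp add: w_def B_def \<phi>_def real_sqrt_mult)
      qed
      then have 1: "(w * \<phi> x0) ^ r \<le> (B * \<phi> u) ^ r"
        using w \<phi>0[OF x0] by (intro power_mono) auto
      have "w \<le> B" using u unfolding w_def B_def by (intro real_sqrt_le_mono) auto
      then have 2: "w ^ (r - 1) \<le> B ^ (r - 1)" using w by (intro power_mono) auto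
      have "r + (r - 1) = 2 * r - 1" using r_pos by auto
      then have pw: "v ^ (2 * r - 1) = v ^ r * v ^ (r - 1)" for v :: real by (metis power_add)
      have "w ^ (2 * r - 1) * \<phi> x0 ^ r = (w * \<phi> x0) ^ r * w ^ (r - 1)"
        unfolding pw power_mult_distrib by simp
      also have "\<dots> \<le> (B * \<phi> u) ^ r * B ^ (r - 1)"
        using 1 2 w \<phi>0[OF ua] by (intro mult_mono) (auto simp: B_def)
      also have "\<dots> = B ^ (2 * r - 1) * \<phi> u ^ r"
        unfolding pw power_mult_distrib by simp
      finally have key: "w ^ (2 * r - 1) * \<phi> x0 ^ r \<le> B ^ (2 * r - 1) * \<phi> u ^ r" .
      have "\<bar>\<psi>' u\<bar> = \<bar>g r u\<bar> * ((w\<^sup>2) ^ (r - 1) / fact (r - 1))"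
        by (simp add: \<psi>'_def abs_mult power_abs w(2))
      also have "\<dots> \<le> \<bar>g r u\<bar> * (w\<^sup>2) ^ (r - 1)"
        using w by (intro mult_left_mono) (auto simp: divide_le_eq fact_ge_1 mult_le_cancel_left1)
      also have "\<dots> \<le> S / \<phi> u ^ r * (w\<^sup>2) ^ (r - 1)"
        using top_bound[OF ua u(2)] \<phi>0[OF ua] by (intro mult_right_mono) (auto simp: \<phi>_def field_simps)
      also have "\<dots> \<le> K / w"
      proof -
        have "(w\<^sup>2) ^ (r - 1) * w = w ^ (2 * r - 1)"
          using r_pos by (cases r) (auto simp: power_mult[symmetric])
        then have "(w\<^sup>2) ^ (r - 1) * w * \<phi> x0 ^ r \<le> B ^ (2 * r - 1) * \<phi> u ^ r" using key by simp
        then have "(w\<^sup>2) ^ (r - 1) / \<phi> u ^ r \<le> B ^ (2 * r - 1) / \<phi> x0 ^ r / w"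
          using w \<phi>0[OF ua] \<phi>0[OF x0] by (simp add: field_simps)
        then have "S * ((w\<^sup>2) ^ (r - 1) / \<phi> u ^ r) \<le> S * (B ^ (2 * r - 1) / \<phi> x0 ^ r / w)"
          using S_nonneg by (rule mult_left_mono)
        then show ?thesis by (simp add: K_def)
      qed
      finally show ?thesis by (simp add: w_def)
    qed
    have KB: "2 * K * B = 2 * S * \<bar>t - x0\<bar> ^ r / sqrt (a\<^sup>2 - x0\<^sup>2) ^ r"
    proof -
      have "2 * r = Suc (2 * r - 1)" using r_pos by simp
      then have "B ^ (2 * r - 1) * B = B ^ (2 * r)" by (metis power_Suc2)
      then have "B ^ (2 * r - 1) * B = (B\<^sup>2) ^ r" by (simp add: power_mult)
      then show ?thesis by (simp add: K_def B_def \<phi>_def)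
    qed
    have "\<bar>\<psi> t - \<psi> x0\<bar> \<le> 2 * K * B"
    proof (cases x0 t rule: linorder_cases)
      case equal
      then show ?thesis using K0 by (simp add: B_def)
    next
      case less
      \<comment> \<open>The antiderivative of \<open>K / sqrt (t - u)\<close> has infinite slope at
        \<open>t\<close>, so the estimate is proved short of \<open>t\<close> and extended by
        continuity.\<close>
      have le: "\<bar>\<psi> s - \<psi> x0\<bar> \<le> 2 * K * B" if s: "s \<in> {x0..<t}" for s
      proof -
        have "\<bar>\<psi> s - \<psi> x0\<bar> \<le> - 2 * K * sqrt (t - s) - - 2 * K * sqrt (t - x0)"
        proof (rule abs_cont_on_mean_bound[where h = "\<lambda>u. K / sqrt (t - u)", OF AC _ Z])
          fix u assume "u \<in> {x0<..<s} - Z"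
          then show "(\<psi> has_real_derivative \<psi>' u) (at u)" "\<bar>\<psi>' u\<bar> \<le> K / sqrt (t - u)"
            using d\<psi>[of u] bound[of u] s x0 t by auto
        next
          fix u assume "u \<in> {x0..s}"
          then show "((\<lambda>u. - 2 * K * sqrt (t - u)) has_real_derivative K / sqrt (t - u)) (at u within {x0..s})"
            using s by (auto intro!: derivative_eq_intros simp: field_simps)
        qed (use s x0 t in auto)
        also have "\<dots> \<le> 2 * K * B" using K0 s less by (simp add: B_def)
        finally show ?thesis .
      qed
      have "continuous_on {x0..t} \<psi>"
        using less x0 t by (intro abs_cont_on_continuous AC) auto
      then have "continuous_on (closure {x0..<t}) (\<lambda>s. \<bar>\<psi> s - \<psi> x0\<bar>)"
        using less by (simp add: continuous_on_rabs continuous_on_diff)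
      then show ?thesis
        by (rule continuous_le_on_closure) (use less le in auto)
    next
      case greater
      have le: "\<bar>\<psi> s - \<psi> x0\<bar> \<le> 2 * K * B" if s: "s \<in> {t<..x0}" for s
      proof -
        have "\<bar>\<psi> x0 - \<psi> s\<bar> \<le> 2 * K * sqrt (x0 - t) - 2 * K * sqrt (s - t)"
        proof (rule abs_cont_on_mean_bound[where h = "\<lambda>u. K / sqrt (u - t)", OF AC _ Z])
          fix u assume "u \<in> {s<..<x0} - Z"
          then show "(\<psi> has_real_derivative \<psi>' u) (at u)" "\<bar>\<psi>' u\<bar> \<le> K / sqrt (u - t)"
            using d\<psi>[of u] bound[of u] s x0 t by auto
        next
          fix u assume "u \<in> {s..x0}"
          then show "((\<lambda>u. 2 * K * sqrt (u - t)) has_real_derivative K / sqrt (u - t)) (at u within {s..x0})"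
            using s by (auto intro!: derivative_eq_intros simp: field_simps)
        qed (use s x0 t in auto)
        also have "\<dots> \<le> 2 * K * B" using K0 s greater by (simp add: B_def)
        finally show ?thesis by (simp add: abs_minus_commute)
      qed
      have "continuous_on {t..x0} \<psi>"
        using greater x0 t by (intro abs_cont_on_continuous AC) auto
      then have "continuous_on (closure {t<..x0}) (\<lambda>s. \<bar>\<psi> s - \<psi> x0\<bar>)"
        using greater by (simp add: continuous_on_rabs continuous_on_diff)
      then show ?thesis
        by (rule continuous_le_on_closure) (use greater le in auto)
    qed
    then show ?thesis by (simp only: \<psi>t \<psi>x0 KB)
  qed
  \<comment> \<open>The derivatives live in the open interval only; \<open>t = a\<close> and
    \<open>t = - a\<close> are reached by continuity of \<open>g 0\<close>.\<close>
  let ?R = "\<lambda>t. \<bar>g 0 t - (\<Sum>j<r. g j x0 / fact j * (t - x0) ^ j)\<bar> - 2 * S * \<bar>t - x0\<bar> ^ r / sqrt (a\<^sup>2 - x0\<^sup>2) ^ r"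
  have cl: "closure {-a<..<a} = {-a..a}" using a_pos by simp
  have "?R t \<le> 0"
  proof (rule continuous_le_on_closure[of "{-a<..<a}" ?R])
    show "continuous_on (closure {-a<..<a}) ?R"
      unfolding cl using phi_pos[OF x0] by (intro continuous_intros cont0) auto
    show "t \<in> closure {-a<..<a}" unfolding cl using t by auto
  next
    fix t assume "t \<in> {-a<..<a}"
    then show "?R t \<le> 0" using inner[of t] by auto
  qed
  then show ?thesis by simp
qed

end

text \<open>Absolute continuity is local, so almost everywhere differentiability is obtained on
  countably many compact subintervals exhausting the open one. Their null sets are united with the
  exceptional set of the essential supremum.\<close>

lemma sobolev_chain_of_sobolev:
  assumes a: "0 < a" and r: "1 \<le> r" and f: "f \<in> sobolev a r"
  obtains Z where "sobolev_chain a r (\<lambda>j. (deriv ^^ j) f) Z (real_of_ereal (sobolev_seminorm a r f))"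
proof -
  define F where "F = (deriv ^^ (r - 1)) f"
  have F': "(deriv ^^ r) f = deriv F"
    using r by (cases r) (auto simp: F_def)
  have lac: "loc_abs_cont a F" and fin: "sobolev_seminorm a r f < \<infinity>"
    using f by (auto simp: sobolev_def F_def)
  have "\<exists>N. negligible N \<and> (\<forall>x\<in>{- a + a / (real n + 2)<..<a - a / (real n + 2)} - N. F differentiable at x)" for n
  proof -
    have "a / (real n + 2) \<le> a / 2" "0 < a / (real n + 2)" using a by (intro divide_left_mono divide_pos_pos; simp)+
    then have cd: "- a < - a + a / (real n + 2)" "- a + a / (real n + 2) \<le> a - a / (real n + 2)" "a - a / (real n + 2) < a"
      by auto
    then have "abs_cont_on (- a + a / (real n + 2)) (a - a / (real n + 2)) F"
      using lac unfolding loc_abs_cont_def by blast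
    from abs_cont_on_AE_derivative[OF this cd(2)] show ?thesis
      using real_differentiable_def by metis
  qed
  then obtain N where N: "\<And>n. negligible (N n)"
      "\<And>n x. x \<in> {- a + a / (real n + 2)<..<a - a / (real n + 2)} - N n \<Longrightarrow> F differentiable at x"
    by metis
  have diff: "F differentiable at x" if x: "\<bar>x\<bar> < a" "x \<notin> (\<Union>n. N n)" for x
  proof -
    obtain n :: nat where n: "a / (a - \<bar>x\<bar>) < real n" using reals_Archimedean2 by blast
    then have "a < (real n + 2) * (a - \<bar>x\<bar>)" using x by (simp add: field_simps)
    then have "a / (real n + 2) < a - \<bar>x\<bar>" by (simp add: field_simps)
    then show ?thesis using x by (intro N(2)[of x n]) auto
  qed
  let ?v = "\<lambda>x. \<bar>(deriv ^^ r) f x * sqrt (a\<^sup>2 - x\<^sup>2) ^ r\<bar>"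
  have "AE x in lebesgue_on {-a<..<a}. ereal (?v x) \<le> sobolev_seminorm a r f"
    unfolding sobolev_seminorm_def by (rule esssup_AE)
  then have "AE x in lebesgue. x \<in> {-a<..<a} \<longrightarrow> ereal (?v x) \<le> sobolev_seminorm a r f"
    by (subst (asm) AE_restrict_space_iff) auto
  then obtain N' where N': "N' \<in> null_sets lebesgue"
      "{x \<in> space lebesgue. \<not> (x \<in> {-a<..<a} \<longrightarrow> ereal (?v x) \<le> sobolev_seminorm a r f)} \<subseteq> N'"
    unfolding eventually_ae_filter by blast
  define Z where "Z = N' \<union> (\<Union>n. N n)"
  have Z: "negligible Z"
    unfolding Z_def using N'(1) N(1) by (intro negligible_Un negligible_countable_Union) (auto simp: negligible_iff_null_sets)
  have bound: "ereal (?v x) \<le> sobolev_seminorm a r f" if "\<bar>x\<bar> < a" "x \<notin> Z" for x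
  proof (rule ccontr)
    assume "\<not> ?thesis"
    moreover have "x \<in> {-a<..<a}" using that by auto
    ultimately have "x \<in> N'" by (intro subsetD[OF N'(2)]) auto
    then show False using that by (simp add: Z_def)
  qed
  have vreal: "?v x \<le> real_of_ereal (sobolev_seminorm a r f)" if "\<bar>x\<bar> < a" "x \<notin> Z" for x
    using bound[OF that] fin by (cases "sobolev_seminorm a r f") auto
  \<comment> \<open>An open interval is not null, so some point escapes \<open>Z\<close>; the bound
    at that point shows that the seminorm is nonnegative.\<close>
  have "\<not> negligible {-a<..<a}" using a by (intro open_not_negligible) auto
  then have "\<not> {-a<..<a} \<subseteq> Z" using Z negligible_subset by blast
  then obtain x where "x \<in> {-a<..<a}" and xZ: "x \<notin> Z" by blast
  then have x: "\<bar>x\<bar> < a" by auto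
  show ?thesis
  proof (rule that[of Z], unfold_locales)
    show "0 \<le> real_of_ereal (sobolev_seminorm a r f)" using vreal[OF x xZ] by linarith
    show "continuous_on {-a..a} ((deriv ^^ 0) f)" using f by (simp add: sobolev_def)
    fix x :: real assume x: "\<bar>x\<bar> < a"
    show "((deriv ^^ j) f has_real_derivative (deriv ^^ Suc j) f x) (at x)" if "j < r - 1" for j
      using f that x unfolding sobolev_def by (auto simp: DERIV_deriv_iff_field_differentiable abs_less_iff)
    assume xZ: "x \<notin> Z"
    show "((deriv ^^ (r - 1)) f has_real_derivative (deriv ^^ r) f x) (at x)"
      unfolding F' F_def[symmetric] using diff[OF x] xZ
      by (auto simp: Z_def DERIV_deriv_iff_real_differentiable)
    have "0 \<le> sqrt (a\<^sup>2 - x\<^sup>2)"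
      using x by (intro real_sqrt_ge_zero) (metis abs_le_square_iff abs_of_nonneg abs_ge_zero diff_ge_0_iff_ge less_imp_le order_trans)
    then show "\<bar>(deriv ^^ r) f x\<bar> * sqrt (a\<^sup>2 - x\<^sup>2) ^ r \<le> real_of_ereal (sobolev_seminorm a r f)"
      using vreal[OF x xZ] by (simp add: abs_mult)
  qed (use a r Z lac in \<open>auto simp: F_def\<close>)
qed

section \<open>Growth of the derivatives towards the endpoints\<close>

lemma sqrt_power_eq_powr: "0 < y \<Longrightarrow> sqrt y ^ n = y powr (real n / 2)"
  using powr_realpow[of "sqrt y" n] powr_powr[of y "1 / 2" "real n"] by (simp add: powr_half_sqrt)

text \<open>The \<open>j\<close>-th derivative grows like \<open>(a - \<bar>x\<bar>)\<close> to the power \<open>r/2 - j\<close> if \<open>j > r/2\<close>. Cutting the exponent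
  off at \<open>1/2\<close> avoids the logarithm at \<open>j = r/2\<close> and costs nothing later, because the bound will be
  integrated.\<close>

definition growth_exp :: "nat \<Rightarrow> nat \<Rightarrow> real" where
  "growth_exp r j = max (real j - real r / 2) (1 / 2)"

text \<open>Descending from the weighted bound on \<open>g r\<close>, each order is obtained by
  integrating the next one from the center, which lowers the exponent by 1 until the cut-off stops
  it. At the top order the bound holds off \<open>Z\<close> only.\<close>

lemma sobolev_chain_growth:
  assumes "j \<le> r" and a: "0 < a"
  shows "\<exists>C\<ge>0. \<forall>g Z S M x. sobolev_chain a r g Z S \<longrightarrow> S \<le> M \<longrightarrow> (\<forall>i<r. \<bar>g i 0\<bar> \<le> M) \<longrightarrow>
     \<bar>x\<bar> < a \<longrightarrow> j < r \<or> x \<notin> Z \<longrightarrow> \<bar>g j x\<bar> \<le> C * M * (a - \<bar>x\<bar>) powr (- growth_exp r j)"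
  using assms(1)
proof (induction j rule: inc_induct)
  case base
  show ?case
  proof (intro exI[of _ "a powr (- real r / 2)"] conjI allI impI)
    fix g Z S M x
    assume "sobolev_chain a r g Z S" and SM: "S \<le> M" and x: "\<bar>x\<bar> < a" and xZ: "r < r \<or> x \<notin> Z"
    interpret sobolev_chain a r g Z S by fact
    have e: "growth_exp r r = real r / 2" using r_pos by (simp add: growth_exp_def)
    have prod: "0 < a * (a - \<bar>x\<bar>)" using a x by simp
    have "a * (a - \<bar>x\<bar>) \<le> a\<^sup>2 - x\<^sup>2"
    proof -
      have "a\<^sup>2 - x\<^sup>2 - a * (a - \<bar>x\<bar>) = \<bar>x\<bar> * (a - \<bar>x\<bar>)"
        by (simp add: power2_eq_square algebra_simps)
      also have "0 \<le> \<dots>" using x by simp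
      finally show ?thesis by linarith
    qed
    then have le: "sqrt (a * (a - \<bar>x\<bar>)) ^ r \<le> sqrt (a\<^sup>2 - x\<^sup>2) ^ r"
      using prod by (intro power_mono) auto
    have "sqrt (a * (a - \<bar>x\<bar>)) ^ r = (a * (a - \<bar>x\<bar>)) powr (real r / 2)"
      by (rule sqrt_power_eq_powr[OF prod])
    also have "\<dots> = a powr (real r / 2) * (a - \<bar>x\<bar>) powr (real r / 2)"
      using a x by (simp add: powr_mult)
    finally have eq: "sqrt (a * (a - \<bar>x\<bar>)) ^ r = a powr (real r / 2) * (a - \<bar>x\<bar>) powr (real r / 2)" .
    have pos: "0 < a powr (real r / 2) * (a - \<bar>x\<bar>) powr (real r / 2)" using a x by simp
    have "\<bar>g r x\<bar> * (a powr (real r / 2) * (a - \<bar>x\<bar>) powr (real r / 2)) \<le> \<bar>g r x\<bar> * sqrt (a\<^sup>2 - x\<^sup>2) ^ r"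
      using le unfolding eq by (intro mult_left_mono) auto
    also have "\<dots> \<le> M" using top_bound[OF x] xZ SM by auto
    finally have "\<bar>g r x\<bar> \<le> M / (a powr (real r / 2) * (a - \<bar>x\<bar>) powr (real r / 2))"
      using pos by (simp add: pos_le_divide_eq)
    also have "\<dots> = a powr (- real r / 2) * M * (a - \<bar>x\<bar>) powr (- growth_exp r r)"
      by (simp add: e powr_minus field_simps)
    finally show "\<bar>g r x\<bar> \<le> a powr (- real r / 2) * M * (a - \<bar>x\<bar>) powr (- growth_exp r r)" .
  qed simp
next
  case (step j)
  then obtain C where C0: "C \<ge> 0" and C: "\<And>g Z S M x. sobolev_chain a r g Z S \<Longrightarrow> S \<le> M \<Longrightarrow> (\<And>i. i < r \<Longrightarrow> \<bar>g i 0\<bar> \<le> M) \<Longrightarrow>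
     \<bar>x\<bar> < a \<Longrightarrow> x \<notin> Z \<Longrightarrow> \<bar>g (Suc j) x\<bar> \<le> C * M * (a - \<bar>x\<bar>) powr (- growth_exp r (Suc j))" by blast
  define p where "p = growth_exp r j"
  \<comment> \<open>Because of the cut-off the exponent may drop by less than 1; the surplus
    nonnegative power of \<open>a - \<bar>y\<bar>\<close> is bounded by the same power of
    \<open>a\<close>.\<close>
  define K where "K = a powr (p + 1 - growth_exp r (Suc j))"
  have p: "0 < p" "0 \<le> p + 1 - growth_exp r (Suc j)" by (auto simp: p_def growth_exp_def)
  define D where "D = a powr p + C * K / p"
  show ?case
  proof (intro exI[of _ D] conjI allI impI)
    show "D \<ge> 0" using C0 p by (simp add: D_def K_def)
    fix g Z S M x
    assume ch: "sobolev_chain a r g Z S" and SM: "S \<le> M" and M: "\<forall>i<r. \<bar>g i 0\<bar> \<le> M" and x: "\<bar>x\<bar> < a"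
    interpret sobolev_chain a r g Z S by fact
    have M0: "0 \<le> M" using S_nonneg SM by linarith
    have le: "\<bar>g (Suc j) y\<bar> \<le> C * M * K * (a - \<bar>y\<bar>) powr (- (p + 1))" if y: "\<bar>y\<bar> < a" "y \<notin> Z" for y
    proof -
      have "(a - \<bar>y\<bar>) powr (- growth_exp r (Suc j)) = (a - \<bar>y\<bar>) powr (p + 1 - growth_exp r (Suc j)) * (a - \<bar>y\<bar>) powr (- (p + 1))"
        by (simp add: powr_add[symmetric])
      also have "\<dots> \<le> K * (a - \<bar>y\<bar>) powr (- (p + 1))"
        unfolding K_def using y p by (intro mult_right_mono powr_mono2) auto
      finally have "C * M * (a - \<bar>y\<bar>) powr (- growth_exp r (Suc j)) \<le> C * M * (K * (a - \<bar>y\<bar>) powr (- (p + 1)))"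
        using C0 M0 by (intro mult_left_mono) auto
      moreover have "\<bar>g (Suc j) y\<bar> \<le> C * M * (a - \<bar>y\<bar>) powr (- growth_exp r (Suc j))"
        using M by (intro C[OF ch SM _ y]) auto
      ultimately show ?thesis by (simp add: mult.assoc)
    qed
    have "\<bar>g j x\<bar> \<le> \<bar>g j 0\<bar> + C * M * K / p * (a - \<bar>x\<bar>) powr (- p)"
      by (rule growth_step[OF \<open>j < r\<close> p(1) _ le x]) (use C0 M0 in \<open>auto simp: K_def\<close>)
    moreover have "\<bar>g j 0\<bar> \<le> M * (a powr p * (a - \<bar>x\<bar>) powr (- p))"
    proof -
      have "(a - \<bar>x\<bar>) powr p \<le> a powr p" using x p by (intro powr_mono2) auto
      then have "1 \<le> a powr p * (a - \<bar>x\<bar>) powr (- p)" using x by (simp add: powr_minus field_simps)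
      then have "M * 1 \<le> M * (a powr p * (a - \<bar>x\<bar>) powr (- p))" using M0 by (intro mult_left_mono) auto
      then show ?thesis using M \<open>j < r\<close> by (smt (verit) mult_cancel_left2)
    qed
    ultimately have "\<bar>g j x\<bar> \<le> M * (a powr p * (a - \<bar>x\<bar>) powr (- p)) + C * M * K / p * (a - \<bar>x\<bar>) powr (- p)"
      by linarith
    also have "\<dots> = D * M * (a - \<bar>x\<bar>) powr (- p)" by (simp add: D_def algebra_simps)
    finally show "\<bar>g j x\<bar> \<le> D * M * (a - \<bar>x\<bar>) powr (- growth_exp r j)" by (simp add: p_def)
  qed
qed

text \<open>The Taylor polynomial at 0 differs from \<open>g 0\<close> by at most
  \<open>2 * S\<close> on the whole interval, hence is bounded by \<open>2 * (U + S)\<close>, and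
  its coefficients are controlled by \<open>poly_coeffs_bounded\<close>.\<close>

lemma sobolev_chain_center:
  assumes a: "0 < a"
  shows "\<exists>C\<ge>0. \<forall>g Z S U. sobolev_chain a r g Z S \<longrightarrow> (\<forall>x. \<bar>x\<bar> \<le> a \<longrightarrow> \<bar>g 0 x\<bar> \<le> U) \<longrightarrow>
     (\<forall>j<r. \<bar>g j 0\<bar> \<le> C * (U + S))"
proof -
  obtain C where C0: "C \<ge> 0" and C: "\<And>(c :: nat \<Rightarrow> real) M j. (\<And>t. \<bar>t\<bar> \<le> a \<Longrightarrow> \<bar>\<Sum>j<r. c j * t ^ j\<bar> \<le> M) \<Longrightarrow> j < r \<Longrightarrow> \<bar>c j\<bar> \<le> C * M"
    using poly_coeffs_bounded[OF a, of r] by blast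
  show ?thesis
  proof (intro exI[of _ "fact r * C * 2"] conjI allI impI)
    show "fact r * C * 2 \<ge> 0" using C0 by simp
    fix g Z S U j assume "sobolev_chain a r g Z S" and U: "\<forall>x. \<bar>x\<bar> \<le> a \<longrightarrow> \<bar>g 0 x\<bar> \<le> U" and j: "j < r"
    interpret sobolev_chain a r g Z S by fact
    have U0: "0 \<le> U" using U[rule_format, of 0] a by simp
    have "\<bar>g j 0 / fact j\<bar> \<le> C * (2 * (U + S))"
    proof (rule C[OF _ j])
      fix t assume t: "\<bar>t\<bar> \<le> a"
      have "\<bar>g 0 t - (\<Sum>j<r. g j 0 / fact j * t ^ j)\<bar> \<le> 2 * S * (\<bar>t\<bar> ^ r / a ^ r)"
        using taylor_remainder[of 0 t] t a by simp
      also have "\<dots> \<le> 2 * S * 1"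
      proof (rule mult_left_mono)
        show "\<bar>t\<bar> ^ r / a ^ r \<le> 1" using t a power_mono[of "\<bar>t\<bar>" a r] by simp
      qed (use S_nonneg in simp)
      finally show "\<bar>\<Sum>j<r. g j 0 / fact j * t ^ j\<bar> \<le> 2 * (U + S)"
        using U[rule_format, OF t] U0
          abs_triangle_ineq4[of "g 0 t" "g 0 t - (\<Sum>j<r. g j 0 / fact j * t ^ j)"] by simp
    qed
    then have "\<bar>g j 0\<bar> \<le> fact j * (C * (2 * (U + S)))"
      by (simp add: field_simps)
    also have "\<dots> \<le> fact r * (C * (2 * (U + S)))"
      using j C0 U0 S_nonneg by (intro mult_right_mono fact_mono) auto
    finally show "\<bar>g j 0\<bar> \<le> fact r * C * 2 * (U + S)" by (simp add: algebra_simps)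
  qed
qed

lemma unif_norm_ge:
  assumes "continuous_on {-a..a} f" "\<bar>x\<bar> \<le> a"
  shows "\<bar>f x\<bar> \<le> unif_norm a f"
proof -
  have "bounded (f ` {-a..a})"
    using assms(1) by (intro compact_imp_bounded compact_continuous_image) auto
  then obtain B where "\<forall>y\<in>f ` {-a..a}. norm y \<le> B"
    unfolding bounded_iff by blast
  then have "\<bar>f x\<bar> \<le> B" if "x \<in> {-a..a}" for x using that by simp
  then have "bdd_above ((\<lambda>x. \<bar>f x\<bar>) ` {-a..a})" by (intro bdd_aboveI2)
  then show ?thesis
    unfolding unif_norm_def using assms(2) by (intro cSUP_upper) (auto simp: abs_le_iff)
qed

lemma unif_norm_le:
  assumes "0 < a" "\<And>x. \<bar>x\<bar> \<le> a \<Longrightarrow> \<bar>f x\<bar> \<le> B"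
  shows "unif_norm a f \<le> B"
  unfolding unif_norm_def using assms by (intro cSUP_least) (auto simp: abs_le_iff)

lemma sobolev_derivative_growth:
  assumes a: "0 < a" and r: "1 \<le> r"
  shows "\<exists>G\<ge>0. \<forall>f\<in>sobolev a r. \<forall>j<r. \<forall>x. \<bar>x\<bar> < a \<longrightarrow>
    \<bar>(deriv ^^ j) f x\<bar> \<le> G * sobolev_norm a r f * (a - \<bar>x\<bar>) powr (- growth_exp r j)"
proof -
  obtain C where C0: "C \<ge> 0" and C: "\<And>g Z S U j. sobolev_chain a r g Z S \<Longrightarrow> (\<And>x. \<bar>x\<bar> \<le> a \<Longrightarrow> \<bar>g 0 x\<bar> \<le> U) \<Longrightarrow>
     j < r \<Longrightarrow> \<bar>g j 0\<bar> \<le> C * (U + S)"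
    using sobolev_chain_center[OF a, of r] by blast
  have "\<forall>j\<in>{..<r}. \<exists>D\<ge>0. \<forall>g Z S M x. sobolev_chain a r g Z S \<longrightarrow> S \<le> M \<longrightarrow> (\<forall>i<r. \<bar>g i 0\<bar> \<le> M) \<longrightarrow>
     \<bar>x\<bar> < a \<longrightarrow> \<bar>g j x\<bar> \<le> D * M * (a - \<bar>x\<bar>) powr (- growth_exp r j)"
    using sobolev_chain_growth[OF _ a] by (metis lessThan_iff less_imp_le)
  from bchoice[OF this] obtain D where D0: "\<And>j. j < r \<Longrightarrow> D j \<ge> 0"
    and D: "\<And>j g Z S M x. j < r \<Longrightarrow> sobolev_chain a r g Z S \<Longrightarrow> S \<le> M \<Longrightarrow> (\<And>i. i < r \<Longrightarrow> \<bar>g i 0\<bar> \<le> M) \<Longrightarrow>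
     \<bar>x\<bar> < a \<Longrightarrow> \<bar>g j x\<bar> \<le> D j * M * (a - \<bar>x\<bar>) powr (- growth_exp r j)"
    by (metis lessThan_iff)
  define E where "E = (\<Sum>j<r. D j)"
  have E0: "0 \<le> E" unfolding E_def using D0 by (intro sum_nonneg) auto
  show ?thesis
  proof (intro exI[of _ "E * (C + 1)"] conjI ballI allI impI)
    show "0 \<le> E * (C + 1)" using E0 C0 by simp
    fix f j x assume f: "f \<in> sobolev a r" and j: "j < r" and x: "\<bar>x\<bar> < a"
    define S where "S = real_of_ereal (sobolev_seminorm a r f)"
    define N where "N = sobolev_norm a r f"
    obtain Z where ch: "sobolev_chain a r (\<lambda>j. (deriv ^^ j) f) Z S"
      using sobolev_chain_of_sobolev[OF a r f] unfolding S_def by blast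
    interpret sobolev_chain a r "\<lambda>j. (deriv ^^ j) f" Z S by fact
    have N: "N = unif_norm a f + S" by (simp add: N_def S_def sobolev_norm_def)
    have cf: "continuous_on {-a..a} f" using cont0 by simp
    have U0: "0 \<le> unif_norm a f" using unif_norm_ge[OF cf, of 0] a by simp
    have N0: "0 \<le> N" using U0 S_nonneg N by simp
    have "\<bar>(deriv ^^ j) f x\<bar> \<le> D j * ((C + 1) * N) * (a - \<bar>x\<bar>) powr (- growth_exp r j)"
    proof (rule D[OF j ch _ _ x])
      show "S \<le> (C + 1) * N" using U0 mult_nonneg_nonneg[OF C0 N0] N by (simp add: distrib_right)
      fix i assume "i < r"
      then have "\<bar>(deriv ^^ i) f 0\<bar> \<le> C * N"
        unfolding N using unif_norm_ge[OF cf] by (intro C[OF ch]) auto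
      then show "\<bar>(deriv ^^ i) f 0\<bar> \<le> (C + 1) * N" using N0 by (simp add: algebra_simps)
    qed
    also have "\<dots> \<le> E * ((C + 1) * N) * (a - \<bar>x\<bar>) powr (- growth_exp r j)"
    proof (intro mult_right_mono)
      show "D j \<le> E" unfolding E_def using D0 j by (intro member_le_sum) auto
    qed (use C0 N0 in auto)
    finally show "\<bar>(deriv ^^ j) f x\<bar> \<le> E * (C + 1) * sobolev_norm a r f * (a - \<bar>x\<bar>) powr (- growth_exp r j)"
      by (simp add: N_def mult.assoc)
  qed
qed

section \<open>The quadrature error\<close>

lemma bern_defect_sobolev_pointwise:
  assumes a: "0 < a" and r: "1 \<le> r" "r \<le> 2 * l"
  shows "\<exists>C\<ge>0. \<forall>f\<in>sobolev a r. \<forall>m\<ge>1. \<forall>x. \<bar>x\<bar> < a \<longrightarrow>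
    \<bar>(bern_defect a m ^^ l) f x\<bar> \<le> C * sobolev_norm a r f / sqrt (real m) ^ r * (1 + 1 / sqrt (a - \<bar>x\<bar>))"
proof -
  obtain G where G0: "G \<ge> 0" and G: "\<And>f j x. f \<in> sobolev a r \<Longrightarrow> j < r \<Longrightarrow> \<bar>x\<bar> < a \<Longrightarrow>
      \<bar>(deriv ^^ j) f x\<bar> \<le> G * sobolev_norm a r f * (a - \<bar>x\<bar>) powr (- growth_exp r j)"
    using sobolev_derivative_growth[OF a r(1)] by blast
  obtain A where A0: "A \<ge> 0" and A: "\<And>m x0 s \<theta> q x. bern_scale a m x0 s \<theta> \<Longrightarrow> \<theta> \<le> 5 \<Longrightarrow> degree q \<le> r \<Longrightarrow> \<bar>x - x0\<bar> \<le> s \<Longrightarrow>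
     \<bar>(bern_defect a m ^^ l) (\<lambda>u. poly q (u - x0)) x\<bar> \<le> A * \<theta> ^ l * pnorm s q"
    using bern_defect_poly[of 5 r l] by auto
  obtain B where B0: "B \<ge> 0" and B: "\<And>m x0 s \<theta> q x. bern_scale a m x0 s \<theta> \<Longrightarrow> \<theta> \<le> 5 \<Longrightarrow> degree q \<le> 2 * r \<Longrightarrow> \<bar>x - x0\<bar> \<le> s \<Longrightarrow>
     (bern_majorant a m ^^ l) (\<lambda>u. poly q (u - x0)) x \<le> B * pnorm s q"
    using bern_majorant_poly[of 5 "2 * r" l] by auto
  \<comment> \<open>The first summand serves the low orders (scale \<open>a\<close>,
    \<open>\<theta> = 4 / M\<close>), the second the high ones (scale \<open>d\<close>,
    \<open>\<theta> = 5 * a / (M * d)\<close>). In \<open>C\<close>, the factor 4 joins the 2 of the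
    Taylor remainder with the 2 from the two terms of its majorant.\<close>
  define E where "E j = A * (4 ^ l * a ^ j + (5 * a) ^ l * a powr (real r / 2 - real l))" for j
  have E0: "0 \<le> E j" for j using A0 a by (simp add: E_def)
  define C where "C = G * (\<Sum>j<r. E j) + 4 * B"
  show ?thesis
  proof (intro exI[of _ C] conjI ballI allI impI)
    show "0 \<le> C" using G0 E0 B0 by (simp add: C_def sum_nonneg)
    fix f x and m :: nat assume f: "f \<in> sobolev a r" and m: "1 \<le> m" and x: "\<bar>x\<bar> < a"
    define S where "S = real_of_ereal (sobolev_seminorm a r f)"
    define N where "N = sobolev_norm a r f"
    define M where "M = real m"
    have M: "1 \<le> M" using m by (simp add: M_def)
    obtain Z where "sobolev_chain a r (\<lambda>j. (deriv ^^ j) f) Z S"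
      using sobolev_chain_of_sobolev[OF a r(1) f] unfolding S_def by blast
    then interpret sobolev_chain a r "\<lambda>j. (deriv ^^ j) f" Z S .
    have cf: "continuous_on {-a..a} f" using cont0 by simp
    have "0 \<le> unif_norm a f" using unif_norm_ge[OF cf, of 0] a by simp
    then have N0: "0 \<le> N" and SN: "S \<le> N" using S_nonneg by (auto simp: N_def S_def sobolev_norm_def)
    define w where "w = 1 + 1 / sqrt (a - \<bar>x\<bar>)"
    have w: "1 \<le> w" "1 / sqrt (a - \<bar>x\<bar>) \<le> w" using x by (auto simp: w_def)
    text \<open>Taylor expansion at \<open>x\<close> itself, or at distance \<open>a / m\<close> from the nearer endpoint
      when \<open>x\<close> is closer to it.\<close>
    define d where "d = max (a - \<bar>x\<bar>) (a / M)"
    define x0 where "x0 = sgn x * (a - d)"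
    define \<sigma> where "\<sigma> = sqrt (a * d / M)"
    have aM: "0 < a / M" "a / M \<le> a" using a M by (auto simp: field_simps)
    have d: "a / M \<le> d" "d \<le> a" "a - \<bar>x\<bar> \<le> d" "0 < d" using aM by (auto simp: d_def)
    have x0d: "\<bar>x0\<bar> = a - d"
    proof (cases "x = 0")
      case True
      then have "d = a" using aM by (simp add: d_def)
      then show ?thesis by (simp add: x0_def)
    qed (use d in \<open>simp add: x0_def abs_mult abs_sgn_eq\<close>)
    have xx0: "\<bar>x - x0\<bar> \<le> a / M"
    proof -
      have "x - x0 = sgn x * (\<bar>x\<bar> - (a - d))"
        by (simp add: x0_def right_diff_distrib sgn_mult_abs)
      then have "\<bar>x - x0\<bar> \<le> \<bar>\<bar>x\<bar> - (a - d)\<bar>" by (simp add: abs_mult abs_sgn_eq)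
      also have "\<dots> \<le> a / M" using aM x by (auto simp: d_def max_def)
      finally show ?thesis .
    qed
    have x0a: "\<bar>x0\<bar> < a" using x0d d by simp
    have phi: "a\<^sup>2 - x0\<^sup>2 = d * (2 * a - d)"
    proof -
      have "x0\<^sup>2 = (a - d)\<^sup>2" using x0d by (metis power2_abs)
      then show ?thesis by (simp add: power2_eq_square algebra_simps)
    qed
    have phi_le: "a\<^sup>2 - x0\<^sup>2 \<le> 2 * a * d" using d by (simp add: phi algebra_simps)
    have phi_ge: "a * d \<le> a\<^sup>2 - x0\<^sup>2"
    proof -
      have "d * a \<le> d * (2 * a - d)" using d by (intro mult_left_mono) auto
      then show ?thesis by (simp add: phi mult.commute)
    qed
    have \<sigma>: "0 < \<sigma>" "\<sigma>\<^sup>2 = a * d / M" "a / M \<le> \<sigma>"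
    proof -
      show "0 < \<sigma>" "\<sigma>\<^sup>2 = a * d / M" using a d M by (auto simp: \<sigma>_def)
      have "(a / M)\<^sup>2 = a * (a / M) / M" by (simp add: power2_eq_square)
      also have "\<dots> \<le> a * d / M" using a d M by (intro divide_right_mono mult_left_mono) auto
      finally show "a / M \<le> \<sigma>" unfolding \<sigma>_def using aM by (intro real_le_rsqrt)
    qed
    text \<open>The scale \<open>a\<close> serves the low derivatives, \<open>d\<close> (comparable to \<open>\<phi>\<^sup>2(x0)\<close>) the high ones, and \<open>\<sigma>\<close>
      (the standard deviation of the nodes) the Taylor remainder.\<close>
    have sc_a: "bern_scale a m x0 a (4 / M)"
      unfolding bern_scale_def using a m M x0a by (auto simp: M_def[symmetric] power2_eq_square)
    \<comment> \<open>The 5 counts \<open>2 * a * d\<close> from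
      \<open>a\<^sup>2 - x0\<^sup>2\<close>, another \<open>2 * a * d\<close>, and
      \<open>d\<^sup>2 \<le> a * d\<close>.\<close>
    have sc_d: "bern_scale a m x0 d (5 * a / (M * d))"
    proof -
      have "d * d \<le> a * d" using d by (intro mult_right_mono) auto
      then have "a\<^sup>2 - x0\<^sup>2 + 2 * a * d + d\<^sup>2 \<le> 5 * a * d"
        using phi_le unfolding power2_eq_square[of d] by linarith
      also have "\<dots> = 5 * a / (M * d) * (M * d\<^sup>2)" using M d by (simp add: power2_eq_square)
      finally show ?thesis unfolding bern_scale_def using a m d x0a by (auto simp: M_def[symmetric])
    qed
    have sc_\<sigma>: "bern_scale a m x0 \<sigma> 5"
    proof -
      have 1: "a\<^sup>2 - x0\<^sup>2 \<le> 2 * (M * \<sigma>\<^sup>2)" using phi_le M by (simp add: \<sigma>(2))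
      have "a \<le> M * \<sigma>" using \<sigma>(3) M by (simp add: field_simps)
      then have 2: "2 * a * \<sigma> \<le> 2 * (M * \<sigma>\<^sup>2)" using \<sigma>(1) by (simp add: power2_eq_square)
      have "1 * \<sigma>\<^sup>2 \<le> M * \<sigma>\<^sup>2" using M by (intro mult_right_mono) auto
      with 1 2 have "a\<^sup>2 - x0\<^sup>2 + 2 * a * \<sigma> + \<sigma>\<^sup>2 \<le> 5 * (M * \<sigma>\<^sup>2)" by linarith
      then show ?thesis unfolding bern_scale_def using a m \<sigma> x0a by (auto simp: M_def[symmetric])
    qed
    define R where "R t = f t - (\<Sum>j<r. (deriv ^^ j) f x0 / fact j * (t - x0) ^ j)" for t
    have fR: "f = (\<lambda>t. (\<Sum>j<r. (deriv ^^ j) f x0 / fact j * (t - x0) ^ j) + R t)"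
      by (simp add: R_def)
    have split: "(bern_defect a m ^^ l) f x = (\<Sum>j<r. (deriv ^^ j) f x0 / fact j * (bern_defect a m ^^ l) (\<lambda>t. (t - x0) ^ j) x)
       + (bern_defect a m ^^ l) R x"
      by (subst fR) (rule bern_defect_linear)
    have summand: "\<bar>(deriv ^^ j) f x0 / fact j * (bern_defect a m ^^ l) (\<lambda>t. (t - x0) ^ j) x\<bar> \<le> G * E j * N / sqrt M ^ r * w"
      if j: "j < r" for j
    proof -
      define P where "P = \<bar>(bern_defect a m ^^ l) (\<lambda>t. (t - x0) ^ j) x\<bar>"
      have P: "P \<le> A * \<theta> ^ l * s ^ j" if "bern_scale a m x0 s \<theta>" "\<theta> \<le> 5" "\<bar>x - x0\<bar> \<le> s" for s \<theta>
        using A[OF that(1,2), of "monom 1 j" x] that(3) j by (simp add: P_def poly_monom pnorm_monom degree_monom_eq)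
      have "\<bar>(deriv ^^ j) f x0 / fact j\<bar> \<le> \<bar>(deriv ^^ j) f x0\<bar>"
        by (simp add: divide_le_eq mult_le_cancel_left1 fact_ge_1)
      also have "\<dots> \<le> G * N * d powr (- growth_exp r j)"
        using G[OF f j x0a] x0d by (simp add: N_def)
      finally have coeff: "\<bar>(deriv ^^ j) f x0 / fact j\<bar> \<le> G * N * d powr (- growth_exp r j)" .
      have prod: "d powr (- growth_exp r j) * P \<le> E j / sqrt M ^ r * w"
      \<comment> \<open>These are exactly the orders at which \<open>growth_exp\<close> is cut off
        at \<open>1 / 2\<close>: the derivative costs at most the weight \<open>w\<close>, and the
        full \<open>M ^ l\<close> is at least \<open>sqrt M ^ r\<close>.\<close>
      proof (cases "2 * j \<le> r + 1")
        case True
        then have "growth_exp r j = 1 / 2" by (auto simp: growth_exp_def)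
        then have "d powr (- growth_exp r j) = 1 / sqrt d"
          unfolding powr_half_sqrt[OF less_imp_le[OF d(4)], symmetric]
          by (simp only: powr_minus_divide)
        also have "\<dots> \<le> 1 / sqrt (a - \<bar>x\<bar>)" using d x by (intro divide_left_mono) auto
        finally have dw: "d powr (- growth_exp r j) \<le> w" using w by linarith
        have "sqrt M ^ r \<le> sqrt M ^ (2 * l)" using M r by (intro power_increasing) auto
        also have "\<dots> = M ^ l" using M by (simp add: power_mult)
        finally have Ml: "sqrt M ^ r \<le> M ^ l" .
        have "P \<le> A * (4 / M) ^ l * a ^ j"
        proof (rule P[OF sc_a])
          show "4 / M \<le> 5" using M by (simp add: divide_le_eq)
          show "\<bar>x - x0\<bar> \<le> a" using xx0 aM by linarith
        qed
        also have "\<dots> = A * 4 ^ l * a ^ j / M ^ l" by (simp add: power_divide)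
        also have "\<dots> \<le> A * 4 ^ l * a ^ j / sqrt M ^ r"
          using Ml A0 a M by (intro divide_left_mono) auto
        also have "\<dots> \<le> E j / sqrt M ^ r"
          using A0 a M by (intro divide_right_mono) (auto simp: E_def algebra_simps)
        finally have "P \<le> E j / sqrt M ^ r" .
        then have "d powr (- growth_exp r j) * P \<le> w * (E j / sqrt M ^ r)"
          using dw w by (intro mult_mono) (auto simp: P_def)
        then show ?thesis by (simp add: mult.commute)
      next
        case False
        then have e: "growth_exp r j = real j - real r / 2" by (auto simp: growth_exp_def max_def)
        have "P \<le> A * (5 * a / (M * d)) ^ l * d ^ j"
        proof (rule P[OF sc_d])
          show "5 * a / (M * d) \<le> 5" using d M by (simp add: field_simps)
        qed (use xx0 d in auto)
        then have "d powr (- growth_exp r j) * P \<le> d powr (- growth_exp r j) * (A * (5 * a / (M * d)) ^ l * d ^ j)"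
          by (intro mult_left_mono) auto
        also have "\<dots> = A * (5 * a) ^ l / M ^ l * (d powr (- growth_exp r j) * d ^ j / d ^ l)"
          by (simp add: power_divide power_mult_distrib)
        also have "d powr (- growth_exp r j) * d ^ j / d ^ l = d powr (real r / 2 - real l)"
          using d(4) by (simp add: e powr_realpow[symmetric] powr_add[symmetric] powr_diff[symmetric])
        \<comment> \<open>The exponent is nonpositive, so the smallest admissible distance
          \<open>a / M\<close> is the worst case.\<close>
        also have "A * (5 * a) ^ l / M ^ l * d powr (real r / 2 - real l) \<le> A * (5 * a) ^ l / M ^ l * (a / M) powr (real r / 2 - real l)"
          using A0 a M d aM r(2) by (intro mult_left_mono powr_mono2') auto
        also have "(a / M) powr (real r / 2 - real l) = a powr (real r / 2 - real l) * (M ^ l / sqrt M ^ r)"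
        proof -
          have "sqrt M ^ r = M powr (real r / 2)" using M by (intro sqrt_power_eq_powr) simp
          moreover have "M ^ l = M powr real l" using M by (simp add: powr_realpow)
          ultimately show ?thesis using a M by (simp add: powr_divide powr_diff)
        qed
        also have "A * (5 * a) ^ l / M ^ l * (a powr (real r / 2 - real l) * (M ^ l / sqrt M ^ r))
          = A * (5 * a) ^ l * a powr (real r / 2 - real l) / sqrt M ^ r"
          using M by simp
        also have "\<dots> \<le> E j / sqrt M ^ r"
          using A0 a M by (intro divide_right_mono) (auto simp: E_def algebra_simps)
        also have "\<dots> \<le> E j / sqrt M ^ r * w"
          using w(1) E0[of j] M mult_left_mono[OF w(1), of "E j / sqrt M ^ r"] by simp
        finally show ?thesis .
      qed
      have "\<bar>(deriv ^^ j) f x0 / fact j * (bern_defect a m ^^ l) (\<lambda>t. (t - x0) ^ j) x\<bar> \<le> G * N * d powr (- growth_exp r j) * P"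
        unfolding abs_mult P_def[symmetric] using coeff by (intro mult_right_mono) (auto simp: P_def)
      also have "\<dots> \<le> G * N * (E j / sqrt M ^ r * w)"
        unfolding mult.assoc[of _ _ P] using prod G0 N0 by (intro mult_left_mono) auto
      finally show ?thesis by (simp add: mult_ac)
    qed
    have rem: "\<bar>(bern_defect a m ^^ l) R x\<bar> \<le> 4 * B * N / sqrt M ^ r * w"
    proof -
      define \<phi> where "\<phi> = sqrt (a\<^sup>2 - x0\<^sup>2)"
      text \<open>A polynomial majorant, from \<open>\<bar>h\<bar>\<^sup>r \<le> h\<^sup>2\<^sup>r / \<sigma>\<^sup>r + \<sigma>\<^sup>r\<close>.\<close>
      define q where "q = smult (2 * S / \<phi> ^ r) (monom (1 / \<sigma> ^ r) (2 * r) + [:\<sigma> ^ r:])"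
      have ad: "0 < a * d" using a d by simp
      have \<phi>: "sqrt (a * d) \<le> \<phi>" "0 < \<phi>" using phi_ge ad by (auto simp: \<phi>_def)
      have Rq: "\<bar>R t\<bar> \<le> poly q (t - x0)" if t: "\<bar>t\<bar> \<le> a" for t
      proof -
        have "\<bar>t - x0\<bar> ^ r \<le> (t - x0) ^ (2 * r) / \<sigma> ^ r + \<sigma> ^ r"
        proof (cases "\<bar>t - x0\<bar> \<le> \<sigma>")
          case True
          then have "\<bar>t - x0\<bar> ^ r \<le> \<sigma> ^ r" by (intro power_mono) auto
          moreover have "0 \<le> (t - x0) ^ (2 * r) / \<sigma> ^ r" using \<sigma> by (simp add: power_mult)
          ultimately show ?thesis by linarith
        next
          case False
          then have "\<sigma> ^ r \<le> \<bar>t - x0\<bar> ^ r" using \<sigma> by (intro power_mono) auto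
          then have "\<bar>t - x0\<bar> ^ r * \<sigma> ^ r \<le> \<bar>t - x0\<bar> ^ r * \<bar>t - x0\<bar> ^ r" by (intro mult_left_mono) auto
          also have "\<dots> = (t - x0) ^ (2 * r)"
            by (simp add: power_add[symmetric] mult_2[symmetric] power_even_abs)
          finally have "\<bar>t - x0\<bar> ^ r \<le> (t - x0) ^ (2 * r) / \<sigma> ^ r" using \<sigma> by (simp add: field_simps)
          moreover have "0 \<le> \<sigma> ^ r" using \<sigma> by simp
          ultimately show ?thesis by linarith
        qed
        then have "2 * S / \<phi> ^ r * \<bar>t - x0\<bar> ^ r \<le> 2 * S / \<phi> ^ r * ((t - x0) ^ (2 * r) / \<sigma> ^ r + \<sigma> ^ r)"
          using S_nonneg \<phi> by (intro mult_left_mono) auto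
        also have "\<dots> = poly q (t - x0)" by (simp add: q_def poly_monom)
        finally have "2 * S / \<phi> ^ r * \<bar>t - x0\<bar> ^ r \<le> poly q (t - x0)" .
        moreover have "\<bar>R t\<bar> \<le> 2 * S / \<phi> ^ r * \<bar>t - x0\<bar> ^ r"
          using taylor_remainder[OF x0a t] by (simp add: R_def \<phi>_def)
        ultimately show ?thesis by linarith
      qed
      have "\<bar>(bern_defect a m ^^ l) R x\<bar> \<le> (bern_majorant a m ^^ l) (\<lambda>t. poly q (t - x0)) x"
        using Rq x by (intro bern_defect_abs_le_majorant[OF a]) auto
      also have "\<dots> \<le> B * pnorm \<sigma> q"
      proof (rule B[OF sc_\<sigma>])
        show "degree q \<le> 2 * r"
          unfolding q_def by (intro order_trans[OF degree_smult_le] degree_add_le order_trans[OF degree_monom_le]) auto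
      qed (use xx0 \<sigma> in auto)
      also have "pnorm \<sigma> q \<le> 2 * S / \<phi> ^ r * (2 * \<sigma> ^ r)"
      proof -
        have "pnorm \<sigma> (monom (1 / \<sigma> ^ r) (2 * r) + [:\<sigma> ^ r:]) \<le> 1 / \<sigma> ^ r * \<sigma> ^ (2 * r) + \<sigma> ^ r"
          using pnorm_add[of \<sigma> "monom (1 / \<sigma> ^ r) (2 * r)" "[:\<sigma> ^ r:]"] \<sigma> by (simp add: pnorm_monom)
        also have "\<sigma> ^ (2 * r) = \<sigma> ^ r * \<sigma> ^ r" by (metis mult_2 power_add)
        also have "1 / \<sigma> ^ r * (\<sigma> ^ r * \<sigma> ^ r) + \<sigma> ^ r = 2 * \<sigma> ^ r" using \<sigma> by simp
        finally have "\<bar>2 * S / \<phi> ^ r\<bar> * pnorm \<sigma> (monom (1 / \<sigma> ^ r) (2 * r) + [:\<sigma> ^ r:]) \<le> \<bar>2 * S / \<phi> ^ r\<bar> * (2 * \<sigma> ^ r)"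
          by (rule mult_left_mono) simp
        then show ?thesis unfolding q_def pnorm_smult using S_nonneg \<phi> by simp
      qed
      also have "B * (2 * S / \<phi> ^ r * (2 * \<sigma> ^ r)) = 4 * B * S * (\<sigma> / \<phi>) ^ r"
        by (simp add: power_divide)
      \<comment> \<open>Near an endpoint both the spread of the nodes and \<open>\<phi>\<close>
        shrink like \<open>sqrt d\<close>; in their quotient \<open>d\<close> cancels and
        \<open>1 / sqrt M\<close> remains.\<close>
      also have "\<dots> \<le> 4 * B * N * (1 / sqrt M) ^ r"
      proof -
        have "\<sigma> = sqrt (a * d) / sqrt M" by (simp add: \<sigma>_def real_sqrt_divide)
        also have "\<dots> \<le> \<phi> / sqrt M" using \<phi> M by (intro divide_right_mono) auto
        finally have "\<sigma> / \<phi> \<le> 1 / sqrt M" using \<phi> M by (simp add: field_simps)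
        then show ?thesis using B0 SN S_nonneg N0 \<sigma> \<phi>
          by (intro mult_mono power_mono) auto
      qed
      also have "\<dots> = 4 * B * N / sqrt M ^ r" by (simp add: power_divide)
      also have "\<dots> \<le> 4 * B * N / sqrt M ^ r * w"
        using w(1) B0 N0 M mult_left_mono[OF w(1), of "4 * B * N / sqrt M ^ r"] by simp
      finally show ?thesis using B0 by (simp add: mult_left_mono)
    qed
    have "\<bar>(bern_defect a m ^^ l) f x\<bar> \<le> (\<Sum>j<r. G * E j * N / sqrt M ^ r * w) + 4 * B * N / sqrt M ^ r * w"
      unfolding split using summand rem
      by (intro order_trans[OF abs_triangle_ineq] add_mono order_trans[OF sum_abs] sum_mono) auto
    also have "\<dots> = C * N / sqrt M ^ r * w"
      by (simp add: C_def sum_distrib_left sum_distrib_right sum_divide_distrib algebra_simps add_divide_distrib)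
    finally show "\<bar>(bern_defect a m ^^ l) f x\<bar> \<le> C * sobolev_norm a r f / sqrt (real m) ^ r * (1 + 1 / sqrt (a - \<bar>x\<bar>))"
      by (simp add: N_def M_def w_def)
  qed
qed

section \<open>Integration of the weight and conclusion\<close>

text \<open>The two-sided sum majorizes the weight and has an explicit antiderivative. That function
  is continuous up to the endpoints, so differentiability in the interior suffices despite the
  unbounded integrand.\<close>

lemma has_integral_inverse_sqrt_endpoints:
  assumes a: "0 < a"
  shows "((\<lambda>x. 1 + (1 / sqrt (a - x) + 1 / sqrt (a + x))) has_integral (2 * a + 4 * sqrt (2 * a))) {-a..a}"
proof -
  define H where "H x = x + (- 2 * sqrt (a - x) + 2 * sqrt (a + x))" for x
  have "((\<lambda>x. 1 + (1 / sqrt (a - x) + 1 / sqrt (a + x))) has_integral (H a - H (-a))) {-a..a}"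
  proof (rule fundamental_theorem_of_calculus_interior)
    show "continuous_on {-a..a} H" unfolding H_def by (intro continuous_intros)
    fix x assume "x \<in> {-a<..<a}"
    then have "(H has_real_derivative 1 + (1 / sqrt (a - x) + 1 / sqrt (a + x))) (at x)"
      unfolding H_def[abs_def] by (auto intro!: derivative_eq_intros simp: field_simps)
    then show "(H has_vector_derivative 1 + (1 / sqrt (a - x) + 1 / sqrt (a + x))) (at x)"
      by (simp add: has_real_derivative_iff_has_vector_derivative)
  qed (use a in simp)
  also have "H a - H (- a) = 2 * a + 4 * sqrt (2 * a)" by (simp add: H_def)
  finally show ?thesis .
qed

theorem theorem3p1:
  fixes a \<omega> :: real and \<kappa> :: "real \<Rightarrow> real" and l :: nat
  assumes "a > 0" and "\<kappa> = sin \<or> \<kappa> = cos" and "l \<ge> 1"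
  shows "(\<exists>C>0. \<forall>f. continuous_on {-a..a} f \<longrightarrow>
            (SUP m\<in>{1..}. ereal (unif_norm a (osc_quad a \<omega> \<kappa> m l f)))
              \<le> ereal (C * unif_norm a f)) \<and>
         (\<forall>r::nat. 0 < r \<and> r \<le> 2 * l \<longrightarrow>
            (\<exists>C>0. \<forall>f\<in>sobolev a r. \<forall>m\<ge>1.
               unif_norm a (osc_rem a \<omega> \<kappa> m l f)
                 \<le> C * (a ^ (r + 1) * sobolev_norm a r f / sqrt (real m) ^ r)))"
proof -
  note a = assms(1)
  have \<kappa>1: "\<bar>\<kappa> t\<bar> \<le> 1" for t using assms(2) by auto
  have \<kappa>c: "continuous_on A (\<lambda>x. \<kappa> (\<omega> * (y - x)))" for A y
    using assms(2) by (auto intro!: continuous_intros)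
  have integrable: "(\<lambda>x. \<kappa> (\<omega> * (y - x)) * h x) integrable_on {-a..a}" if "continuous_on {-a..a} h" for h y
    using that by (intro integrable_continuous_real continuous_intros \<kappa>c)
  have gen: "gen_bern_op a m l f = (\<lambda>x. f x - (bern_defect a m ^^ l) f x)" for m f
    by (simp add: gen_bern_op_def fun_eq_iff)
  \<comment> \<open>\<open>2 * a\<close> is the length of the interval; \<open>1 + 2 ^ l\<close>
    comes from the generalized operator being the identity minus the iterated defect.\<close>
  have i: "(SUP m\<in>{1..}. ereal (unif_norm a (osc_quad a \<omega> \<kappa> m l f))) \<le> ereal (2 * a * (1 + 2 ^ l) * unif_norm a f)"
    if f: "continuous_on {-a..a} f" for f
  proof (rule SUP_least, unfold ereal_less_eq(3), rule unif_norm_le[OF a])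
    fix m :: nat and y
    let ?U = "(1 + 2 ^ l) * unif_norm a f"
    have "norm (osc_quad a \<omega> \<kappa> m l f y) \<le> integral {-a..a} (\<lambda>x. ?U)"
      unfolding osc_quad_def
    proof (rule integral_norm_bound_integral)
      show "(\<lambda>x. \<kappa> (\<omega> * (y - x)) * gen_bern_op a m l f x) integrable_on {-a..a}"
        unfolding gen by (intro integrable continuous_intros f continuous_on_bern_defect[OF a])
      fix x assume "x \<in> {-a..a}"
      then have x: "\<bar>x\<bar> \<le> a" by auto
      have "\<bar>(bern_defect a m ^^ l) f x\<bar> \<le> 2 ^ l * unif_norm a f"
        by (rule bern_defect_bound[OF a x unif_norm_ge[OF f]])
      then have "\<bar>gen_bern_op a m l f x\<bar> \<le> ?U"
        using unif_norm_ge[OF f x] unfolding gen distrib_right by linarith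
      then have "\<bar>\<kappa> (\<omega> * (y - x))\<bar> * \<bar>gen_bern_op a m l f x\<bar> \<le> 1 * ?U"
        using \<kappa>1 by (intro mult_mono) auto
      then show "norm (\<kappa> (\<omega> * (y - x)) * gen_bern_op a m l f x) \<le> ?U" by (simp add: abs_mult)
    qed (rule integrable_const_ivl)
    then show "\<bar>osc_quad a \<omega> \<kappa> m l f y\<bar> \<le> 2 * a * (1 + 2 ^ l) * unif_norm a f"
      using a by (simp add: mult_ac)
  qed
  have ii: "\<exists>C>0. \<forall>f\<in>sobolev a r. \<forall>m\<ge>1. unif_norm a (osc_rem a \<omega> \<kappa> m l f)
      \<le> C * (a ^ (r + 1) * sobolev_norm a r f / sqrt (real m) ^ r)" if r: "0 < r" "r \<le> 2 * l" for r
  proof -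
    have r1: "1 \<le> r" using r by simp
    obtain C where C0: "0 \<le> C" and C: "\<And>f m x. f \<in> sobolev a r \<Longrightarrow> 1 \<le> m \<Longrightarrow> \<bar>x\<bar> < a \<Longrightarrow>
      \<bar>(bern_defect a m ^^ l) f x\<bar> \<le> C * sobolev_norm a r f / sqrt (real m) ^ r * (1 + 1 / sqrt (a - \<bar>x\<bar>))"
      using bern_defect_sobolev_pointwise[OF a r1 r(2)] by blast
    define I where "I = 2 * a + 4 * sqrt (2 * a)"
    have I: "0 < I" using a by (simp add: I_def add_pos_pos)
    \<comment> \<open>\<open>C + 1\<close> ensures positivity, and the division cancels the factor
      \<open>a ^ (r + 1)\<close> of the claimed bound, since the constant may depend on
      \<open>a\<close>.\<close>
    define D where "D = (C + 1) * I / a ^ (r + 1)"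
    have D: "0 < D" using C0 I a by (simp add: D_def)
    show ?thesis
    proof (intro exI[of _ D] conjI ballI allI impI D unif_norm_le[OF a])
      fix f m y assume f: "f \<in> sobolev a r" and m: "1 \<le> (m::nat)"
      have cf: "continuous_on {-a..a} f" using f by (simp add: sobolev_def)
      obtain Z where "sobolev_chain a r (\<lambda>j. (deriv ^^ j) f) Z (real_of_ereal (sobolev_seminorm a r f))"
        using sobolev_chain_of_sobolev[OF a r1 f] by blast
      then have "0 \<le> real_of_ereal (sobolev_seminorm a r f)" by (simp add: sobolev_chain_def)
      moreover have "0 \<le> unif_norm a f" using unif_norm_ge[OF cf, of 0] a by simp
      ultimately have N0: "0 \<le> sobolev_norm a r f" by (simp add: sobolev_norm_def)
      define K where "K = C * sobolev_norm a r f / sqrt (real m) ^ r"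
      have K0: "0 \<le> K" using C0 N0 by (simp add: K_def)
      let ?h = "\<lambda>x. K * (1 + (1 / sqrt (a - x) + 1 / sqrt (a + x)))"
      let ?g = "\<lambda>x. \<kappa> (\<omega> * (y - x)) * (bern_defect a m ^^ l) f x"
      have h: "(?h has_integral K * I) {-a..a}"
        unfolding I_def by (intro has_integral_mult_right has_integral_inverse_sqrt_endpoints[OF a])
      have g: "?g integrable_on {-a..a}"
        by (intro integrable continuous_on_bern_defect[OF a] cf)
      have "osc_rem a \<omega> \<kappa> m l f y = integral {-a..a} (\<lambda>x. \<kappa> (\<omega> * (y - x)) * f x - \<kappa> (\<omega> * (y - x)) * gen_bern_op a m l f x)"
        unfolding osc_rem_def osc_int_def osc_quad_def gen
        by (intro Henstock_Kurzweil_Integration.integral_diff[symmetric] integrable continuous_intros cf continuous_on_bern_defect[OF a])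
      also have "\<dots> = integral {-a..a} ?g"
        by (intro integral_cong) (simp add: gen algebra_simps)
      \<comment> \<open>The pointwise estimate is available for \<open>\<bar>x\<bar> < a\<close>
        only; dropping the endpoints does not change the integral.\<close>
      also have "\<dots> = integral {-a<..<a} ?g"
        by (simp add: integral_open_interval_real)
      finally have eq: "osc_rem a \<omega> \<kappa> m l f y = integral {-a<..<a} ?g" .
      have "norm (integral {-a<..<a} ?g) \<le> integral {-a<..<a} ?h"
      proof (rule integral_norm_bound_integral)
        show "?g integrable_on {-a<..<a}" "?h integrable_on {-a<..<a}"
          using g h by (auto simp: integrable_on_open_interval_real)
        fix x assume "x \<in> {-a<..<a}"
        then have x: "\<bar>x\<bar> < a" by auto
        have "\<bar>(bern_defect a m ^^ l) f x\<bar> \<le> K * (1 + 1 / sqrt (a - \<bar>x\<bar>))"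
          using C[OF f m x] by (simp add: K_def)
        \<comment> \<open>One of the two square roots is that of \<open>a - \<bar>x\<bar>\<close>;
          the other term is nonnegative.\<close>
        also have "\<dots> \<le> ?h x"
          using x K0 by (intro mult_left_mono) (auto simp: abs_if)
        finally have "\<bar>\<kappa> (\<omega> * (y - x))\<bar> * \<bar>(bern_defect a m ^^ l) f x\<bar> \<le> 1 * ?h x"
          using \<kappa>1 by (intro mult_mono) auto
        then show "norm (?g x) \<le> ?h x" by (simp add: abs_mult)
      qed
      also have "integral {-a<..<a} ?h = K * I"
        unfolding integral_open_interval_real[symmetric] by (rule integral_unique[OF h])
      finally have "\<bar>osc_rem a \<omega> \<kappa> m l f y\<bar> \<le> K * I" by (simp add: eq)
      also have "\<dots> \<le> (C + 1) * sobolev_norm a r f / sqrt (real m) ^ r * I"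
        unfolding K_def using I N0 by (intro mult_right_mono divide_right_mono) auto
      also have "\<dots> = D * (a ^ (r + 1) * sobolev_norm a r f / sqrt (real m) ^ r)"
        using a by (simp add: D_def)
      finally show "\<bar>osc_rem a \<omega> \<kappa> m l f y\<bar> \<le> D * (a ^ (r + 1) * sobolev_norm a r f / sqrt (real m) ^ r)" .
    qed
  qed
  have "0 < 2 * a * (1 + 2 ^ l)" using a by (simp add: add_pos_pos)
  with i ii show ?thesis by blast
qed

end
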